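(* Suppose $0<p<1$. Let $P:H^p(\mathbb{T})\to H^p(\mathbb{T})$ be a contractive projection satisfying $P\mathbf{1}=\mathbf{1}$, where $\mathbf 1$ is the constant function $1$. If $Pz^n\in H^\infty(\mathbb{T})$ for each $n\ge1$, then either $Pf=f(0)$ for all $f\in H^p(\mathbb{T})$, or $P$ is the identity.
   Context: $\mathbb{T}$ is the unit circle with normalized Lebesgue measure $m$. For $0<p<\infty$, $H^p(\mathbb{T})$ is the closure of the analytic polynomials in $L^p(\mathbb{T})$, with (quasi-)norm $\|f\|_p=(\int_{\mathbb T}|f|^p\,dm)^{1/p}$; each $f\in H^p(\mathbb{T})$ is identified with the analytic function on the unit disc $\mathbb{D}$ whose radial limits equal $f$ a.e. on $\mathbb{T}$, and $f(0)$ is the value of this function at $0$ (also regarded as a constant function). $H^\infty(\mathbb{T})$ is the space of (boundary functions of) bounded analytic functions on $\mathbb{D}$. A contractive projection is a nonzero bounded linear operator $P$ with $P^2=P$ and $\|P\|:=\sup_{\|x\|=1}\|Px\|=1$. *)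

theory Defs
  imports "HOL-Complex_Analysis.Complex_Analysis" "HOL-Computational_Algebra.Polynomial"
begin

text \<open>Elements of \<open>L\<^sup>p\<close> and \<open>H\<^sup>p\<close> of the unit circle are represented by functions on the
  complex plane; equality of elements is equality almost everywhere with respect to
  \<open>circle_measure\<close>. The space of that measure is the unit circle itself, so the values (and the
  measurability) of a function elsewhere play no role.\<close>

definition circle_measure :: "complex measure" where
  "circle_measure = distr (uniform_measure lborel {0..2 * pi}) (restrict_space borel (sphere 0 1)) cis"

definition Lp_circle :: "real \<Rightarrow> (complex \<Rightarrow> complex) set" where
  "Lp_circle p = {f \<in> borel_measurable circle_measure.
     integrable circle_measure (\<lambda>z. norm (f z) powr p)}"

definition Lp_norm :: "real \<Rightarrow> (complex \<Rightarrow> complex) \<Rightarrow> real" where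
  "Lp_norm p f = (\<integral>z. norm (f z) powr p \<partial>circle_measure) powr (1 / p)"

definition Hp_circle :: "real \<Rightarrow> (complex \<Rightarrow> complex) set" where
  "Hp_circle p = {f \<in> Lp_circle p.
     \<forall>\<epsilon>>0. \<exists>q :: complex poly. Lp_norm p (\<lambda>z. f z - poly q z) < \<epsilon>}"

definition has_radial_limits :: "(complex \<Rightarrow> complex) \<Rightarrow> (complex \<Rightarrow> complex) \<Rightarrow> bool" where
  "has_radial_limits F f \<longleftrightarrow>
     (AE z in circle_measure. ((\<lambda>r. F (complex_of_real r * z)) \<longlongrightarrow> f z) (at_left 1))"

text \<open>The analytic function on the disc identified with \<open>f \<in> H\<^sup>p\<close>. The bound on the integral
  means is what makes it unique: a nonzero analytic function on the disc may have radial limit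
  \<open>0\<close> almost everywhere, but no such function has bounded \<open>p\<close>-th integral means.\<close>

definition analytic_extension ::
    "real \<Rightarrow> (complex \<Rightarrow> complex) \<Rightarrow> (complex \<Rightarrow> complex) \<Rightarrow> bool" where
  "analytic_extension p f F \<longleftrightarrow>
     F holomorphic_on ball 0 1 \<and>
     (\<exists>C. \<forall>r\<in>{0..<1}.
        (\<integral>z. norm (F (complex_of_real r * z)) powr p \<partial>circle_measure) \<le> C) \<and>
     has_radial_limits F f"

definition Hinf_circle :: "(complex \<Rightarrow> complex) set" where
  "Hinf_circle = {f \<in> borel_measurable circle_measure.
     \<exists>F. F holomorphic_on ball 0 1 \<and> bounded (F ` ball 0 1) \<and> has_radial_limits F f}"

text \<open>Operators act on representatives, so a linear operator has to respect equality almost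
  everywhere, and its linearity is required up to equality almost everywhere.\<close>

definition Hp_linear ::
    "real \<Rightarrow> ((complex \<Rightarrow> complex) \<Rightarrow> complex \<Rightarrow> complex) \<Rightarrow> bool" where
  "Hp_linear p P \<longleftrightarrow>
     (\<forall>f\<in>Hp_circle p. P f \<in> Hp_circle p) \<and>
     (\<forall>f\<in>Hp_circle p. \<forall>g\<in>Hp_circle p.
        (AE z in circle_measure. f z = g z) \<longrightarrow> (AE z in circle_measure. P f z = P g z)) \<and>
     (\<forall>f\<in>Hp_circle p. \<forall>g\<in>Hp_circle p.
        AE z in circle_measure. P (\<lambda>w. f w + g w) z = P f z + P g z) \<and>
     (\<forall>c. \<forall>f\<in>Hp_circle p. AE z in circle_measure. P (\<lambda>w. c * f w) z = c * P f z)"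

definition Hp_bounded ::
    "real \<Rightarrow> ((complex \<Rightarrow> complex) \<Rightarrow> complex \<Rightarrow> complex) \<Rightarrow> bool" where
  "Hp_bounded p P \<longleftrightarrow> (\<exists>C. \<forall>f\<in>Hp_circle p. Lp_norm p (P f) \<le> C * Lp_norm p f)"

definition Hp_opnorm ::
    "real \<Rightarrow> ((complex \<Rightarrow> complex) \<Rightarrow> complex \<Rightarrow> complex) \<Rightarrow> real" where
  "Hp_opnorm p P = (SUP f\<in>{f \<in> Hp_circle p. Lp_norm p f = 1}. Lp_norm p (P f))"

definition contractive_projection ::
    "real \<Rightarrow> ((complex \<Rightarrow> complex) \<Rightarrow> complex \<Rightarrow> complex) \<Rightarrow> bool" where
  "contractive_projection p P \<longleftrightarrow>
     Hp_linear p P \<and> Hp_bounded p P \<and>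
     \<not> (\<forall>f\<in>Hp_circle p. AE z in circle_measure. P f z = 0) \<and>
     (\<forall>f\<in>Hp_circle p. AE z in circle_measure. P (P f) z = P f z) \<and>
     Hp_opnorm p P = 1"

end

theory Submission
  imports Defs "HOL-Computational_Algebra.Fundamental_Theorem_Algebra"
begin

text \<open>
  Expanding \<open>\<parallel>1 + t h + \<delta> k\<parallel>\<close> in \<open>\<delta>\<close> and then in \<open>t\<close>, for bounded \<open>h\<close> in the range and bounded \<open>k\<close> in
  the kernel of \<open>P\<close>, shows that \<open>\<integral> f k = 0\<close> for \<open>f = cnj h\<close>, \<open>f = h\<^sub>1 * cnj h\<^sub>2\<close> and
  \<open>f = cnj h\<^sub>1 * cnj h\<^sub>2\<close>. In particular \<open>P\<close> acts on bounded functions as an orthogonal projection of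
  \<open>H\<^sup>2\<close>. Suppose that \<open>h = P z\<^sup>N\<close> is nonzero for some \<open>N \<ge> 1\<close>, and put \<open>\<zeta> = z - P z\<close>. Since
  \<open>h\<close> vanishes at \<open>0\<close>, the orthogonality relations show that both \<open>h * \<zeta>\<close> and \<open>h * cnj \<zeta>\<close> are analytic and
  lie in the kernel. The kernel therefore contains \<open>h * r\<close> for the real functions
  \<open>r = Re \<zeta>\<close> and \<open>r = Im \<zeta>\<close>, and contractivity gives
  \<open>\<integral> \<bar>h\<bar>\<^sup>p \<le> \<integral> \<bar>h\<bar>\<^sup>p (1 \<plusminus> \<delta> r)\<^sup>p\<close>. As \<open>t \<mapsto> t\<^sup>p\<close> is strictly concave for \<open>p < 1\<close>, this forces
  \<open>h * \<zeta> = 0\<close>, hence \<open>P z = z\<close>, and then \<open>P z\<^sup>n = z\<^sup>n\<close> for all \<open>n\<close> by orthogonality.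
  If instead \<open>P z\<^sup>n = 0\<close> for all \<open>n \<ge> 1\<close>, then \<open>P q = q(0)\<close> for polynomials, and the subharmonicity
  of \<open>\<bar>F - q\<bar>\<^sup>s\<close> makes \<open>F(0)\<close> the limit of \<open>q(0)\<close> as \<open>q\<close> tends to \<open>f\<close>.
\<close>

section \<open>Integration over the unit circle\<close>

text \<open>The remedy is to vary only around functions of the range that stay away from 0, namely 1
  + t h with h bounded and t small; P 1 = 1 and the boundedness of P z^n provide them. In the
  variable \<delta> a one-sided quadratic upper bound suffices, because \<delta> runs over all
  complex numbers; a genuine Taylor expansion is made only in t. Its t^2 coefficient mixes h^2,
  |h|^2 and cnj h^2, which rotations of h separate. Orthogonality to the range puts a function into
  the kernel only if the function is analytic (\<open>killed_if_orth_monom_images\<close>). This is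
  why h * cnj \<zeta> = cnj z * h - h * cnj (P z) needs care: the first term is analytic since h has
  mean 0, the second by splitting z^m into P z^m and a kernel element. Bounded analytic functions
  are treated on the circle, through Fourier coefficients and polynomial approximation. The
  extension to the disc matters only for reading the hypothesis on P z^n and for the value
  F(0).\<close>

lemma space_circle_measure [simp]: "space circle_measure = sphere 0 1"
  by (simp add: circle_measure_def space_restrict_space)

lemma sets_circle_measure: "sets circle_measure = sets (restrict_space borel (sphere 0 1))"
  by (simp add: circle_measure_def)

lemma measurable_circle_measure:
  "measurable circle_measure M = measurable (restrict_space borel (sphere 0 1)) M"
  by (rule measurable_cong_sets) (simp_all add: sets_circle_measure)

lemma borel_measurable_circle:
  fixes f :: "complex \<Rightarrow> 'a::topological_space"
  assumes "continuous_on (sphere 0 1) f"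
  shows "f \<in> borel_measurable circle_measure"
  using borel_measurable_continuous_on_restrict[OF assms] by (simp add: measurable_circle_measure)

lemma borel_measurable_circle_id [measurable]: "(\<lambda>z. z) \<in> borel_measurable circle_measure"
  by (intro borel_measurable_circle continuous_intros)

lemma borel_measurable_cnj [measurable]: "cnj \<in> borel_measurable borel"
  by (intro borel_measurable_continuous_onI continuous_intros)

lemma AE_circle_norm: "AE z in circle_measure. norm z = 1"
  by (rule AE_I2) simp

lemma cis_measurable_circle:
  "cis \<in> measurable (uniform_measure lborel {0..2 * pi}) (restrict_space borel (sphere 0 1))"
proof (rule measurable_restrict_space2)
  have "cis \<in> borel_measurable borel"
    by (intro borel_measurable_continuous_onI continuous_intros)
  then show "cis \<in> borel_measurable (uniform_measure lborel {0..2 * pi})"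
    by simp
qed auto

lemma prob_circle: "emeasure circle_measure (sphere 0 1) = 1"
proof -
  have "emeasure circle_measure (sphere 0 1) =
      emeasure (uniform_measure lborel {0..2*pi}) (cis -` sphere 0 1 \<inter> space (uniform_measure lborel {0..2*pi}))"
    unfolding circle_measure_def
    by (rule emeasure_distr[OF cis_measurable_circle]) (auto simp: sets_restrict_space)
  also have "cis -` sphere 0 1 \<inter> space (uniform_measure lborel {0..2*pi}) = UNIV"
    by auto
  also have "emeasure (uniform_measure lborel {0..2*pi}) UNIV = 1"
    by (subst emeasure_uniform_measure) (auto simp: divide_ennreal[symmetric])
  finally show ?thesis .
qed

interpretation circle: finite_measure circle_measure
  by standard (simp add: prob_circle)

lemma measure_circle [simp]: "measure circle_measure (sphere 0 1) = 1"
  by (simp add: measure_def prob_circle)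

lemma integral_circle:
  fixes f :: "complex \<Rightarrow> complex"
  assumes f: "continuous_on (sphere 0 1) f"
  shows "(\<integral>z. f z \<partial>circle_measure) = integral {0..2*pi} (\<lambda>t. f (cis t)) / (2 * pi)"
proof -
  have c: "continuous_on {0..2*pi} (\<lambda>t. f (cis t))"
    by (rule continuous_on_compose2[OF f]) (auto intro!: continuous_intros)
  have m: "(\<lambda>t. f (cis t)) \<in> borel_measurable lborel"
  proof -
    have "continuous_on UNIV (\<lambda>t. f (cis t))"
      by (rule continuous_on_compose2[OF f]) (auto intro!: continuous_intros)
    then show ?thesis
      using borel_measurable_continuous_onI by auto
  qed
  have i: "set_integrable lborel {0..2*pi} (\<lambda>t. f (cis t))"
    by (rule borel_integrable_atLeastAtMost'[OF c])
  have "uniform_measure lborel {0..2 * pi} =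
     density lborel (\<lambda>t. ennreal (indicator {0..2*pi} t / (2*pi)))"
    unfolding uniform_measure_def
    by (rule arg_cong[where f="density lborel"])
       (auto simp: fun_eq_iff indicator_def divide_ennreal[symmetric])
  then have "(\<integral>z. f z \<partial>circle_measure) =
     (\<integral>t. f (cis t) \<partial>density lborel (\<lambda>t. ennreal (indicator {0..2*pi} t / (2*pi))))"
    unfolding circle_measure_def
    by (subst integral_distr[OF cis_measurable_circle])
       (use borel_measurable_continuous_on_restrict[OF f] in auto)
  also have "\<dots> = (\<integral>t. (indicator {0..2*pi} t / (2*pi)) *\<^sub>R f (cis t) \<partial>lborel)"
    by (rule integral_density) (use m in auto)
  also have "\<dots> = (\<integral>t. (indicator {0..2*pi} t *\<^sub>R f (cis t)) / (2*pi) \<partial>lborel)"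
    by (rule Bochner_Integration.integral_cong) (auto simp: indicator_def scaleR_conv_of_real)
  also have "\<dots> = (\<integral>t. (indicator {0..2*pi} t *\<^sub>R f (cis t)) \<partial>lborel) / (2*pi)"
    by simp
  also have "(\<integral>t. (indicator {0..2*pi} t *\<^sub>R f (cis t)) \<partial>lborel) = integral {0..2*pi} (\<lambda>t. f (cis t))"
    using set_borel_integral_eq_integral(2)[OF i] unfolding set_lebesgue_integral_def .
  finally show ?thesis .
qed

lemma mean_value_circle:
  assumes f: "f holomorphic_on cball 0 1"
  shows "(\<integral>z. f z \<partial>circle_measure) = f 0"
proof -
  have "((\<lambda>u. f u / (u - 0)) has_contour_integral (2 * of_real pi * \<i> * f 0)) (part_circlepath 0 1 0 (2*pi))"
    using Cauchy_integral_circlepath_simple[OF f, of 0] by (simp add: circlepath_def)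
  then have "((\<lambda>t. f (cis t) / cis t * \<i> * cis t) has_integral (2 * of_real pi * \<i> * f 0)) {0..2*pi}"
    by (subst (asm) has_contour_integral_part_circlepath_iff) auto
  then have "((\<lambda>t. f (cis t) * \<i>) has_integral (2 * of_real pi * \<i> * f 0)) {0..2*pi}"
    by (simp add: field_simps)
  then have "((\<lambda>t. (f (cis t) * \<i>) * (-\<i>)) has_integral ((2 * of_real pi * \<i> * f 0) * (-\<i>))) {0..2*pi}"
    by (rule has_integral_mult_left)
  then have "((\<lambda>t. f (cis t)) has_integral (2 * of_real pi * f 0)) {0..2*pi}"
    by (simp add: algebra_simps)
  moreover have "continuous_on (sphere 0 1) f"
    using holomorphic_on_imp_continuous_on[OF f] by (rule continuous_on_subset) auto
  ultimately show ?thesis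
    by (simp add: integral_circle integral_unique)
qed

lemma integral_poly_circle: "(\<integral>z. poly q z \<partial>circle_measure) = poly q 0"
  by (rule mean_value_circle) (auto intro!: holomorphic_intros)

section \<open>Essentially bounded functions\<close>

definition ess_bounded :: "(complex \<Rightarrow> complex) \<Rightarrow> bool" where
  "ess_bounded f \<longleftrightarrow>
     f \<in> borel_measurable circle_measure \<and> (\<exists>M. AE z in circle_measure. norm (f z) \<le> M)"

named_theorems ess_bounded_intros

lemma ess_bounded_measurable [measurable_dest]:
  "ess_bounded f \<Longrightarrow> f \<in> borel_measurable circle_measure"
  by (simp add: ess_bounded_def)

lemma ess_boundedE:
  assumes "ess_bounded f"
  obtains M where "M > 0" "AE z in circle_measure. norm (f z) \<le> M"
proof -
  obtain M where "AE z in circle_measure. norm (f z) \<le> M"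
    using assms by (auto simp: ess_bounded_def)
  then have "AE z in circle_measure. norm (f z) \<le> max 1 M"
    by eventually_elim auto
  then show ?thesis by (intro that[of "max 1 M"]) auto
qed

lemma ess_boundedI:
  "f \<in> borel_measurable circle_measure \<Longrightarrow> (AE z in circle_measure. norm (f z) \<le> M) \<Longrightarrow> ess_bounded f"
  by (auto simp: ess_bounded_def)

lemma ess_bounded_const [simp, ess_bounded_intros]: "ess_bounded (\<lambda>_. c)"
  by (rule ess_boundedI[where M="norm c"]) auto

lemma ess_bounded_id [simp, ess_bounded_intros]: "ess_bounded (\<lambda>z. z)"
  by (rule ess_boundedI[where M=1]) (use AE_circle_norm in auto)

lemma ess_bounded_add [ess_bounded_intros]:
  assumes "ess_bounded f" "ess_bounded g"
  shows "ess_bounded (\<lambda>z. f z + g z)"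
proof -
  obtain M N where "AE z in circle_measure. norm (f z) \<le> M" "AE z in circle_measure. norm (g z) \<le> N"
    using assms by (auto simp: ess_bounded_def)
  then have "AE z in circle_measure. norm (f z + g z) \<le> M + N"
    by eventually_elim (rule norm_triangle_mono)
  then show ?thesis
    using assms by (intro ess_boundedI) auto
qed

lemma ess_bounded_mult [ess_bounded_intros]:
  assumes "ess_bounded f" "ess_bounded g"
  shows "ess_bounded (\<lambda>z. f z * g z)"
proof -
  obtain M N where "AE z in circle_measure. norm (f z) \<le> M" "AE z in circle_measure. norm (g z) \<le> N"
    using assms by (auto simp: ess_bounded_def)
  then have "AE z in circle_measure. norm (f z * g z) \<le> M * N"
    by eventually_elim (simp add: norm_mult mult_mono')
  then show ?thesis
    using assms by (intro ess_boundedI) auto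
qed

lemma ess_bounded_cnj [ess_bounded_intros]: "ess_bounded f \<Longrightarrow> ess_bounded (\<lambda>z. cnj (f z))"
  by (auto simp: ess_bounded_def)

lemma ess_bounded_uminus [ess_bounded_intros]: "ess_bounded f \<Longrightarrow> ess_bounded (\<lambda>z. - f z)"
  by (auto simp: ess_bounded_def)

lemma ess_bounded_diff [ess_bounded_intros]:
  "ess_bounded f \<Longrightarrow> ess_bounded g \<Longrightarrow> ess_bounded (\<lambda>z. f z - g z)"
  using ess_bounded_add[of f "\<lambda>z. - g z"] ess_bounded_uminus[of g] by simp

lemma ess_bounded_power [ess_bounded_intros]: "ess_bounded f \<Longrightarrow> ess_bounded (\<lambda>z. f z ^ n)"
  by (induction n) (auto intro: ess_bounded_mult)

lemma ess_bounded_continuous: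
  assumes "continuous_on (sphere 0 1) f"
  shows "ess_bounded f"
proof -
  have "compact (f ` sphere 0 1)"
    by (rule compact_continuous_image[OF assms]) simp
  then obtain M where "\<forall>x\<in>f ` sphere 0 1. norm x \<le> M"
    using compact_imp_bounded bounded_iff by metis
  then show ?thesis
    by (intro ess_boundedI[of f M] AE_I2) (auto intro: borel_measurable_circle[OF assms])
qed

lemma ess_bounded_poly [simp, ess_bounded_intros]: "ess_bounded (poly q)"
  by (rule ess_bounded_continuous) (intro continuous_intros)

lemma ess_bounded_integrable:
  assumes "ess_bounded f"
  shows "integrable circle_measure f"
proof -
  obtain M where "AE z in circle_measure. norm (f z) \<le> M"
    using assms by (auto simp: ess_bounded_def)
  then show ?thesis
    using assms by (intro circle.integrable_const_bound) auto
qed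

lemma ess_bounded_integrable_powr:
  assumes "ess_bounded f" "s > 0"
  shows "integrable circle_measure (\<lambda>z. norm (f z) powr s)"
proof -
  obtain M where M: "M > 0" "AE z in circle_measure. norm (f z) \<le> M"
    using assms by (auto elim: ess_boundedE)
  have "AE z in circle_measure. norm (norm (f z) powr s) \<le> M powr s"
    using M(2) by eventually_elim (use assms M in \<open>auto intro!: powr_mono2\<close>)
  then show ?thesis
    using assms by (intro circle.integrable_const_bound) auto
qed

lemma ess_bounded_integrable_norm:
  assumes "ess_bounded f"
  shows "integrable circle_measure (\<lambda>z. norm (f z) ^ n)"
  using ess_bounded_integrable[OF ess_bounded_power[OF assms, of n]] integrable_norm
  by (fastforce simp: norm_power)

section \<open>Density of trigonometric polynomials\<close>

lemma cnj_mult_self_sphere: "z \<in> sphere 0 1 \<Longrightarrow> cnj z * z = 1"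
  using complex_norm_square[of z] by (simp add: mult.commute)

lemma cnj_power_mult_power: "z \<in> sphere 0 1 \<Longrightarrow> cnj z ^ n * z ^ n = 1"
  by (simp add: cnj_mult_self_sphere flip: power_mult_distrib)

text \<open>On the circle \<open>cnj z\<close> is 1/z, so a trigonometric polynomial becomes a power
  of \<open>cnj z\<close> times an ordinary polynomial. Dividing that polynomial by z^N later
  separates nonnegative from negative frequencies.\<close>

definition trig_poly_on_circle :: "(complex \<Rightarrow> complex) \<Rightarrow> bool" where
  "trig_poly_on_circle f \<longleftrightarrow> (\<exists>N q. \<forall>z\<in>sphere 0 1. f z = cnj z ^ N * poly q z)"

lemma trig_poly_add:
  assumes "trig_poly_on_circle f" "trig_poly_on_circle g"
  shows "trig_poly_on_circle (\<lambda>z. f z + g z)"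
proof -
  obtain N q M r where *: "\<forall>z\<in>sphere 0 1. f z = cnj z ^ N * poly q z" "\<forall>z\<in>sphere 0 1. g z = cnj z ^ M * poly r z"
    using assms unfolding trig_poly_on_circle_def by blast
  have "f z + g z = cnj z ^ (N + M) * poly (monom 1 M * q + monom 1 N * r) z" if "z \<in> sphere 0 1" for z
  proof -
    have "cnj z ^ (N + M) * poly (monom 1 M * q + monom 1 N * r) z =
       (cnj z ^ M * z ^ M) * (cnj z ^ N * poly q z) + (cnj z ^ N * z ^ N) * (cnj z ^ M * poly r z)"
      by (simp add: poly_monom power_add algebra_simps)
    then show ?thesis using * that by (simp only: cnj_power_mult_power) simp
  qed
  then show ?thesis unfolding trig_poly_on_circle_def by blast
qed

lemma trig_poly_mult:
  assumes "trig_poly_on_circle f" "trig_poly_on_circle g"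
  shows "trig_poly_on_circle (\<lambda>z. f z * g z)"
proof -
  obtain N q M r where *: "\<forall>z\<in>sphere 0 1. f z = cnj z ^ N * poly q z" "\<forall>z\<in>sphere 0 1. g z = cnj z ^ M * poly r z"
    using assms unfolding trig_poly_on_circle_def by blast
  have "\<forall>z\<in>sphere 0 1. f z * g z = cnj z ^ (N + M) * poly (q * r) z"
    using * by (simp add: power_add algebra_simps)
  then show ?thesis unfolding trig_poly_on_circle_def by blast
qed

lemma trig_poly_const: "trig_poly_on_circle (\<lambda>_. c)"
  unfolding trig_poly_on_circle_def by (rule exI[of _ 0], rule exI[of _ "[:c:]"]) simp

lemma trig_poly_real_polynomial:
  assumes "real_polynomial_function f"
  shows "trig_poly_on_circle (\<lambda>z. complex_of_real (f z))"
  using assms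
proof induction
  case (linear f)
  interpret bounded_linear f by fact
  \<comment> \<open>A real-linear functional is x f(1) + y f(\<i>); inserting x = (z + cnj z)/2 and
    y = (z - cnj z)/(2 \<i>) gives a z + b cnj z. The polynomial b + a z^2 times
    \<open>cnj z\<close> equals this because \<open>cnj z * z = 1\<close>.\<close>
  define a b where "a = (of_real (f 1) - \<i> * of_real (f \<i>)) / 2" and "b = (of_real (f 1) + \<i> * of_real (f \<i>)) / 2"
  have "of_real (f z) = cnj z ^ 1 * poly [:b, 0, a:] z" if "z \<in> sphere 0 1" for z :: complex
  proof -
    have "f z = f (Re z *\<^sub>R 1 + Im z *\<^sub>R \<i>)"
      by (rule arg_cong[of _ _ f]) (simp add: complex_eq_iff)
    also have "\<dots> = Re z * f 1 + Im z * f \<i>"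
      by (simp only: add scaleR real_scaleR_def)
    finally have "of_real (f z) = a * z + b * cnj z"
      by (simp add: a_def b_def complex_eq_iff field_simps)
    also have "\<dots> = a * z * (cnj z * z) + b * cnj z"
      using cnj_mult_self_sphere[OF that] by simp
    finally show ?thesis by (simp add: algebra_simps)
  qed
  then show ?case unfolding trig_poly_on_circle_def by blast
next
  case (add f g) then show ?case using trig_poly_add by simp
next
  case (mult f g) then show ?case using trig_poly_mult by simp
next
  case (const c) then show ?case using trig_poly_const by simp
qed

lemma continuous_approx_trig_poly:
  fixes f :: "complex \<Rightarrow> complex"
  assumes "continuous_on (sphere 0 1) f" "e > 0"
  obtains N q where "\<And>z. z \<in> sphere 0 1 \<Longrightarrow> norm (f z - cnj z ^ N * poly q z) < e"
proof -
  obtain g where g: "polynomial_function g" "\<And>z. z \<in> sphere 0 1 \<Longrightarrow> norm (f z - g z) < e"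
    using Stone_Weierstrass_polynomial_function[OF _ assms] by auto
  have "real_polynomial_function (Re \<circ> g)" "real_polynomial_function (Im \<circ> g)"
    using g(1) bounded_linear_Re bounded_linear_Im unfolding polynomial_function_def by blast+
  then have "trig_poly_on_circle (\<lambda>z. of_real ((Re \<circ> g) z) + \<i> * of_real ((Im \<circ> g) z))"
    by (intro trig_poly_add trig_poly_mult trig_poly_const trig_poly_real_polynomial)
  then obtain N q where "\<forall>z\<in>sphere 0 1. of_real ((Re \<circ> g) z) + \<i> * of_real ((Im \<circ> g) z) = cnj z ^ N * poly q z"
    unfolding trig_poly_on_circle_def by blast
  then have "\<forall>z\<in>sphere 0 1. g z = cnj z ^ N * poly q z"
    by (simp flip: complex_eq)
  with g(2) show ?thesis by (intro that[of N q]) auto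
qed

text \<open>Regularity squeezes A between a compact K and an open U of almost the same measure; a
  Urysohn function for K and the complement of U differs from the indicator only on U - K.\<close>

lemma indicator_approx_continuous:
  assumes A: "A \<in> sets circle_measure" and e: "e > 0"
  obtains g :: "complex \<Rightarrow> real"
  where "continuous_on UNIV g" "(\<integral>z. \<bar>indicator A z - g z\<bar> \<partial>circle_measure) < e"
proof -
  \<comment> \<open>Regularity is a statement about measures on all Borel sets of the plane, so the
    measure is pushed forward along the inclusion of the circle.\<close>
  define \<mu> where "\<mu> = distr circle_measure borel (\<lambda>z. z)"
  have id: "(\<lambda>z. z) \<in> measurable circle_measure (borel :: complex measure)"
    by measurable
  interpret \<mu>: finite_measure \<mu>
    unfolding \<mu>_def by (rule circle.finite_measure_distr[OF id])
  have sets: "sets \<mu> = sets borel" by (simp add: \<mu>_def)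
  have A': "A \<subseteq> sphere 0 1" "A \<in> sets borel"
    using A sets.sets_into_space[OF A] by (auto simp: sets_circle_measure sets_restrict_space)
  have fin: "emeasure \<mu> (space \<mu>) \<noteq> \<infinity>" using \<mu>.emeasure_finite by auto
  have "(INF U \<in> {U. A \<subseteq> U \<and> open U}. emeasure \<mu> U) < ennreal (measure \<mu> A + e/4)"
    unfolding outer_regular[OF sets fin A'(2), symmetric]
    using e by (simp add: \<mu>.emeasure_eq_measure ennreal_less_iff)
  then obtain U where U: "A \<subseteq> U" "open U" "measure \<mu> U < measure \<mu> A + e/4"
    by (auto simp: INF_less_iff \<mu>.emeasure_eq_measure ennreal_less_iff)
  \<comment> \<open>If A is null, \<open>measure \<mu> A - e/4\<close> becomes 0 in
    \<open>ennreal\<close> and is not strictly below the supremum; the empty set serves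
    instead.\<close>
  obtain K where K: "K \<subseteq> A" "compact K" "measure \<mu> A < measure \<mu> K + e/4"
  proof (cases "measure \<mu> A = 0")
    case True
    then show ?thesis using e by (intro that[of "{}"]) auto
  next
    case False
    then have "measure \<mu> A > 0" by (simp add: zero_less_measure_iff)
    then have "ennreal (measure \<mu> A - e/4) < (SUP K \<in> {K. K \<subseteq> A \<and> compact K}. emeasure \<mu> K)"
      unfolding inner_regular[OF sets fin A'(2), symmetric]
      using e by (simp add: \<mu>.emeasure_eq_measure ennreal_lessI)
    then obtain K where "K \<subseteq> A" "compact K" "ennreal (measure \<mu> A - e/4) < ennreal (measure \<mu> K)"
      by (auto simp: less_SUP_iff \<mu>.emeasure_eq_measure)
    moreover have "measure \<mu> A - e/4 < measure \<mu> K"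
      using calculation(3) by (cases "measure \<mu> A - e/4 < 0") (auto simp: ennreal_less_iff intro: order_less_le_trans[OF _ measure_nonneg])
    ultimately show ?thesis
      by (intro that[of K]) auto
  qed
  have cl: "closed K" "closed (- U)" "K \<inter> - U = {}"
    using U K by (auto simp: compact_imp_closed)
  obtain g :: "complex \<Rightarrow> real" where g: "continuous_on UNIV g" "\<And>x. g x \<in> closed_segment 1 0"
      "\<And>x. x \<in> K \<Longrightarrow> g x = 1" "\<And>x. x \<in> - U \<Longrightarrow> g x = 0"
    using Urysohn[OF cl, of "1::real" 0] by blast
  have g01: "0 \<le> g x" "g x \<le> 1" for x
    using g(2)[of x] by (auto simp: closed_segment_eq_real_ivl split: if_splits)
  have [measurable]: "K \<in> sets borel" "U \<in> sets borel" "g \<in> borel_measurable borel" "A \<in> sets borel"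
    using K U g(1) A' by (auto intro: borel_compact borel_measurable_continuous_onI)
  have KU: "K \<subseteq> U" using K U by auto
  have "(\<integral>z. \<bar>indicator A z - g z\<bar> \<partial>circle_measure) = (\<integral>z. \<bar>indicator A z - g z\<bar> \<partial>\<mu>)"
    unfolding \<mu>_def by (rule integral_distr[OF id, symmetric]) simp
  also have "\<dots> \<le> (\<integral>z. indicator (U - K) z \<partial>\<mu>)"
  proof (rule integral_mono)
    show "integrable \<mu> (\<lambda>z. \<bar>indicator A z - g z\<bar>)"
      by (rule \<mu>.integrable_const_bound[where B=1])
         (use g01 in \<open>auto simp: indicator_def abs_le_iff \<mu>_def intro!: AE_I2 intro: order_trans[OF _ g01(1)] order_trans[OF g01(2)]\<close>)
    show "integrable \<mu> (indicator (U - K) :: _ \<Rightarrow> real)"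
      using sets by (intro integrable_real_indicator) (auto simp: less_top[symmetric])
    show "\<bar>indicator A x - g x\<bar> \<le> indicator (U - K) x" for x
      using g01[of x] g(3,4)[of x] U(1) K(1) by (auto simp: indicator_def)
  qed
  also have "\<dots> = measure \<mu> (U - K)" by (simp add: \<mu>_def)
  also have "\<dots> = measure \<mu> U - measure \<mu> K"
    by (rule \<mu>.finite_measure_Diff) (use sets KU in auto)
  also have "\<dots> < e" using U(3) K(3) e by simp
  finally show ?thesis using that g(1) by blast
qed

lemma integrable_approx_continuous:
  fixes f :: "complex \<Rightarrow> complex"
  assumes "integrable circle_measure f" "e > 0"
  shows "\<exists>g. continuous_on UNIV g \<and> (\<integral>z. norm (f z - g z) \<partial>circle_measure) < e"
  using assms
proof (induction arbitrary: e rule: integrable_induct)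
  case (base A c)
  obtain g where g: "continuous_on UNIV g" "(\<integral>z. \<bar>indicator A z - g z\<bar> \<partial>circle_measure) < e / (norm c + 1)"
    using indicator_approx_continuous[OF base(1), of "e / (norm c + 1)"] base(3)
    by (auto simp: divide_pos_pos add_nonneg_pos)
  have "norm (indicator A z *\<^sub>R c - of_real (g z) * c) = \<bar>indicator A z - g z\<bar> * norm c" for z
    by (simp add: scaleR_conv_of_real norm_mult flip: left_diff_distrib of_real_diff)
  then have "(\<integral>z. norm (indicator A z *\<^sub>R c - of_real (g z) * c) \<partial>circle_measure)
      = (\<integral>z. \<bar>indicator A z - g z\<bar> \<partial>circle_measure) * norm c"
    by simp
  also have "\<dots> \<le> e / (norm c + 1) * norm c"
    using g(2) by (intro mult_right_mono) auto
  also have "\<dots> < e" using base(3) by (simp add: field_simps add_pos_nonneg)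
  finally show ?case using g(1) by (intro exI[of _ "\<lambda>z. of_real (g z) * c"]) (auto intro!: continuous_intros)
next
  case (add f h)
  obtain g k where gk: "continuous_on UNIV g" "(\<integral>z. norm (f z - g z) \<partial>circle_measure) < e/2"
     "continuous_on UNIV k" "(\<integral>z. norm (h z - k z) \<partial>circle_measure) < e/2"
    using add.IH[of "e/2"] add.prems by auto
  have i: "integrable circle_measure g" "integrable circle_measure k"
    using gk by (auto intro!: ess_bounded_integrable ess_bounded_continuous intro: continuous_on_subset)
  have "(\<integral>z. norm (f z + h z - (g z + k z)) \<partial>circle_measure) \<le> (\<integral>z. norm (f z - g z) + norm (h z - k z) \<partial>circle_measure)"
    using add i by (intro integral_mono) (auto intro: norm_diff_triangle_ineq)
  also have "\<dots> = (\<integral>z. norm (f z - g z) \<partial>circle_measure) + (\<integral>z. norm (h z - k z) \<partial>circle_measure)"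
    using add i by (intro Bochner_Integration.integral_add) auto
  also have "\<dots> < e" using gk by simp
  finally show ?case using gk by (intro exI[of _ "\<lambda>z. g z + k z"]) (auto intro!: continuous_intros)
next
  case (lim f s)
  have "(\<lambda>i. \<integral>z. norm (f z - s i z) \<partial>circle_measure) \<longlonglongrightarrow> (\<integral>z. 0 \<partial>circle_measure)"
  proof (rule integral_dominated_convergence)
    show "integrable circle_measure (\<lambda>z. 3 * norm (f z))" using lim by simp
    show "AE z in circle_measure. (\<lambda>i. norm (f z - s i z)) \<longlonglongrightarrow> 0"
    proof (rule AE_I2)
      fix z assume "z \<in> space circle_measure"
      then have "(\<lambda>i. norm (f z - s i z)) \<longlonglongrightarrow> norm (f z - f z)"
        by (intro tendsto_intros lim.hyps(2))
      then show "(\<lambda>i. norm (f z - s i z)) \<longlonglongrightarrow> 0" by simp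
    qed
    show "AE z in circle_measure. norm (norm (f z - s i z)) \<le> 3 * norm (f z)" for i
    proof (rule AE_I2)
      fix z assume "z \<in> space circle_measure"
      then show "norm (norm (f z - s i z)) \<le> 3 * norm (f z)"
        using lim.hyps(3)[of z i] norm_triangle_ineq4[of "f z" "s i z"] by simp
    qed
  qed (use lim in auto)
  then have "eventually (\<lambda>i. (\<integral>z. norm (f z - s i z) \<partial>circle_measure) < e/2) sequentially"
    using lim.prems by (intro order_tendstoD) auto
  then obtain i where i: "(\<integral>z. norm (f z - s i z) \<partial>circle_measure) < e/2"
    by (auto simp: eventually_sequentially)
  obtain g where g: "continuous_on UNIV g" "(\<integral>z. norm (s i z - g z) \<partial>circle_measure) < e/2"
    using lim.IH[of "e/2" i] lim.prems by auto
  have "integrable circle_measure g"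
    using g by (auto intro!: ess_bounded_integrable ess_bounded_continuous intro: continuous_on_subset)
  then have "(\<integral>z. norm (f z - g z) \<partial>circle_measure) \<le> (\<integral>z. norm (f z - s i z) + norm (s i z - g z) \<partial>circle_measure)"
    using lim by (intro integral_mono) (auto intro: norm_diff_triangle_le)
  also have "\<dots> = (\<integral>z. norm (f z - s i z) \<partial>circle_measure) + (\<integral>z. norm (s i z - g z) \<partial>circle_measure)"
    using lim \<open>integrable circle_measure g\<close> by (intro Bochner_Integration.integral_add) auto
  also have "\<dots> < e" using g i by simp
  finally show ?case using g by blast
qed

text \<open>An L^1 approximation becomes an L^2 approximation once both functions are bounded by M,
  since then |f - k|^2 \<le> 2 M |f - g|. The two errors contribute e/2 and e/4.\<close>

lemma ess_bounded_approx_trig_poly: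
  assumes f: "ess_bounded f" and e: "e > 0"
  obtains N q where "(\<integral>z. norm (f z - cnj z ^ N * poly q z) ^ 2 \<partial>circle_measure) < e"
proof -
  obtain M where M: "M > 0" "AE z in circle_measure. norm (f z) \<le> M"
    using f by (auto elim: ess_boundedE)
  obtain g where g: "continuous_on UNIV g" "(\<integral>z. norm (f z - g z) \<partial>circle_measure) < e / (8 * M)"
    using integrable_approx_continuous[OF ess_bounded_integrable[OF f], of "e / (8*M)"] M e by auto
  \<comment> \<open>The nearest-point projection onto the disc of radius M is 1-Lipschitz and fixes
    the values of \<open>f\<close> almost everywhere, so cutting \<open>g\<close> down to size does
    not increase the distance to \<open>f\<close>.\<close>
  define k where "k = (\<lambda>z. closest_point (cball 0 M) (g z))"
  have cb: "convex (cball (0::complex) M)" "closed (cball (0::complex) M)" "cball (0::complex) M \<noteq> {}"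
    using M by auto
  have k: "continuous_on UNIV k"
    unfolding k_def by (rule continuous_on_compose2[OF continuous_on_closest_point[OF cb, of UNIV] g(1)]) simp
  have kM: "norm (k z) \<le> M" for z
    using closest_point_in_set[OF cb(2,3), of "g z"] by (simp add: k_def)
  have kf: "norm (f z - k z) \<le> norm (f z - g z)" if "norm (f z) \<le> M" for z
    using closest_point_lipschitz[OF cb, of "f z" "g z"] closest_point_self[of "f z" "cball 0 M"] that
    by (simp add: k_def dist_norm)
  obtain N q where q: "\<And>z. z \<in> sphere 0 1 \<Longrightarrow> norm (k z - cnj z ^ N * poly q z) < sqrt (e/8)"
    using continuous_approx_trig_poly[OF continuous_on_subset[OF k subset_UNIV], of "sqrt (e/8)"] e
    by (metis divide_pos_pos real_sqrt_gt_0_iff zero_less_numeral)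
  have eb: "ess_bounded g" "ess_bounded k"
    using g k by (auto intro!: ess_bounded_continuous intro: continuous_on_subset)
  have ebt: "ess_bounded (\<lambda>z. cnj z ^ N * poly q z)" by (intro ess_bounded_continuous continuous_intros)
  have i1: "integrable circle_measure (\<lambda>z. norm (f z - cnj z ^ N * poly q z) ^ 2)"
    using f ebt by (intro ess_bounded_integrable_norm ess_bounded_diff)
  have i2: "integrable circle_measure (\<lambda>z. norm (f z - g z))"
    using f eb by (intro integrable_norm ess_bounded_integrable ess_bounded_diff)
  have "(\<integral>z. norm (f z - cnj z ^ N * poly q z) ^ 2 \<partial>circle_measure)
     \<le> (\<integral>z. 4 * M * norm (f z - g z) + e/4 \<partial>circle_measure)"
  proof (rule integral_mono_AE)
    show "AE z in circle_measure. norm (f z - cnj z ^ N * poly q z) ^ 2 \<le> 4 * M * norm (f z - g z) + e/4"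
      using M(2) AE_space
    proof eventually_elim
      case (elim z)
      have "norm (f z - cnj z ^ N * poly q z) \<le> norm (f z - k z) + norm (k z - cnj z ^ N * poly q z)"
        by (rule norm_diff_triangle_le) auto
      then have "norm (f z - cnj z ^ N * poly q z) ^ 2 \<le> (norm (f z - k z) + norm (k z - cnj z ^ N * poly q z)) ^ 2"
        by (rule power_mono) simp
      also have "\<dots> \<le> 2 * norm (f z - k z) ^ 2 + 2 * norm (k z - cnj z ^ N * poly q z) ^ 2"
        using sum_squares_bound[of "norm (f z - k z)" "norm (k z - cnj z ^ N * poly q z)"]
        by (simp add: power2_sum)
      also have "norm (k z - cnj z ^ N * poly q z) ^ 2 \<le> sqrt (e/8) ^ 2"
        using q[of z] elim by (intro power_mono) auto
      also have "\<dots> = e / 8" using e by simp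
      also have "norm (f z - k z) ^ 2 \<le> (2 * M) * norm (f z - g z)"
        unfolding power2_eq_square
        using kf[OF elim(1)] kM[of z] elim(1) norm_triangle_ineq4[of "f z" "k z"] M(1)
        by (intro mult_mono) auto
      finally show ?case by simp
    qed
  qed (use i1 i2 in auto)
  also have "\<dots> = 4 * M * (\<integral>z. norm (f z - g z) \<partial>circle_measure) + e/4"
    using i2 by simp
  also have "\<dots> < e" using g(2) M e by (simp add: field_simps)
  finally show ?thesis using that by blast
qed

section \<open>Bounded functions with vanishing negative Fourier coefficients\<close>

text \<open>This is H^infinity seen from the circle: the integral against z^n is the Fourier
  coefficient of index -n. No extension to the disc occurs in it, so sums, products and limits are
  treated by integrals alone.\<close>

definition bounded_hardy :: "(complex \<Rightarrow> complex) \<Rightarrow> bool" where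
  "bounded_hardy f \<longleftrightarrow> ess_bounded f \<and> (\<forall>n\<ge>1. (\<integral>z. z ^ n * f z \<partial>circle_measure) = 0)"

lemma bounded_hardy_ess_bounded [dest, intro]: "bounded_hardy f \<Longrightarrow> ess_bounded f"
  by (simp add: bounded_hardy_def)

lemma bounded_hardyD: "bounded_hardy f \<Longrightarrow> n \<ge> 1 \<Longrightarrow> (\<integral>z. z ^ n * f z \<partial>circle_measure) = 0"
  by (simp add: bounded_hardy_def)

lemma bounded_hardy_poly [intro, simp]: "bounded_hardy (poly q)"
proof -
  have "(\<integral>z. z ^ n * poly q z \<partial>circle_measure) = 0" if "n \<ge> 1" for n
    using integral_poly_circle[of "monom 1 n * q"] that by (simp add: poly_monom)
  then show ?thesis by (auto simp: bounded_hardy_def)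
qed

lemma bounded_hardy_const [intro, simp]: "bounded_hardy (\<lambda>_. c)"
  using bounded_hardy_poly[of "[:c:]"] by (simp add: bounded_hardy_def)

lemma bounded_hardy_id [intro, simp]: "bounded_hardy (\<lambda>z. z)"
  using bounded_hardy_poly[of "[:0,1:]"] by (simp add: bounded_hardy_def)

lemma bounded_hardy_add [intro]:
  assumes "bounded_hardy f" "bounded_hardy g"
  shows "bounded_hardy (\<lambda>z. f z + g z)"
proof -
  have "(\<integral>z. z ^ n * (f z + g z) \<partial>circle_measure) = 0" if "n \<ge> 1" for n
  proof -
    have "integrable circle_measure (\<lambda>z. z ^ n * f z)" "integrable circle_measure (\<lambda>z. z ^ n * g z)"
      using assms by (auto intro!: ess_bounded_integrable ess_bounded_intros)
    then show ?thesis
      using bounded_hardyD[OF assms(1) that] bounded_hardyD[OF assms(2) that] by (simp add: distrib_left)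
  qed
  then show ?thesis using assms by (auto simp: bounded_hardy_def intro: ess_bounded_intros)
qed

lemma bounded_hardy_cmult [intro]:
  assumes "bounded_hardy f"
  shows "bounded_hardy (\<lambda>z. c * f z)"
proof -
  have "(\<integral>z. z ^ n * (c * f z) \<partial>circle_measure) = 0" if "n \<ge> 1" for n
    using bounded_hardyD[OF assms that] by (simp add: mult.left_commute)
  then show ?thesis using assms by (auto simp: bounded_hardy_def intro: ess_bounded_intros)
qed

lemma bounded_hardy_diff [intro]:
  assumes "bounded_hardy f" "bounded_hardy g"
  shows "bounded_hardy (\<lambda>z. f z - g z)"
  using bounded_hardy_add[OF assms(1) bounded_hardy_cmult[OF assms(2), of "-1"]] by simp

lemma bounded_hardy_AE_cong:
  assumes "bounded_hardy f" "AE z in circle_measure. f z = g z" "g \<in> borel_measurable circle_measure"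
  shows "bounded_hardy g"
proof -
  note [measurable] = assms(3)
  have [measurable]: "f \<in> borel_measurable circle_measure" using assms by auto
  obtain M where "AE z in circle_measure. norm (f z) \<le> M"
    using assms by (auto elim: ess_boundedE)
  then have "AE z in circle_measure. norm (g z) \<le> M"
    using assms(2) by eventually_elim auto
  moreover have "(\<integral>z. z ^ n * g z \<partial>circle_measure) = (\<integral>z. z ^ n * f z \<partial>circle_measure)" for n
  proof (rule integral_cong_AE)
    show "AE z in circle_measure. z ^ n * g z = z ^ n * f z"
      using assms(2) by eventually_elim simp
  qed auto
  ultimately show ?thesis
    using assms by (auto simp: bounded_hardy_def ess_bounded_def)
qed

lemma bounded_hardy_integral_mult_poly:
  assumes f: "bounded_hardy f" and "n \<ge> 1"
  shows "(\<integral>z. z ^ n * poly q z * f z \<partial>circle_measure) = 0"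
  using \<open>n \<ge> 1\<close>
proof (induction q arbitrary: n)
  case (pCons a q)
  have "(\<integral>z. z ^ n * poly (pCons a q) z * f z \<partial>circle_measure) =
      (\<integral>z. a * (z ^ n * f z) + z ^ Suc n * poly q z * f z \<partial>circle_measure)"
    by (rule Bochner_Integration.integral_cong) (auto simp: algebra_simps)
  also have "\<dots> = (\<integral>z. a * (z ^ n * f z) \<partial>circle_measure) + (\<integral>z. z ^ Suc n * poly q z * f z \<partial>circle_measure)"
    using f by (intro Bochner_Integration.integral_add) (auto intro!: ess_bounded_integrable ess_bounded_intros)
  also have "\<dots> = 0"
    using pCons.IH[of "Suc n"] bounded_hardyD[OF f pCons.prems] by simp
  finally show ?case .
qed auto

lemma bounded_hardy_integral_poly_mult:
  assumes f: "bounded_hardy f"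
  shows "(\<integral>z. poly q z * f z \<partial>circle_measure) = poly q 0 * (\<integral>z. f z \<partial>circle_measure)"
proof (cases q)
  case (pCons a r)
  have "(\<integral>z. poly q z * f z \<partial>circle_measure) =
      (\<integral>z. a * f z + z ^ 1 * poly r z * f z \<partial>circle_measure)"
    by (rule Bochner_Integration.integral_cong) (auto simp: pCons algebra_simps)
  also have "\<dots> = (\<integral>z. a * f z \<partial>circle_measure) + (\<integral>z. z ^ 1 * poly r z * f z \<partial>circle_measure)"
    using f by (intro Bochner_Integration.integral_add) (auto intro!: ess_bounded_integrable ess_bounded_intros)
  also have "\<dots> = poly q 0 * (\<integral>z. f z \<partial>circle_measure)"
    using bounded_hardy_integral_mult_poly[OF f order_refl, of r] by (simp add: pCons)
  finally show ?thesis .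
qed

section \<open>Polynomial approximation of bounded analytic functions\<close>

lemma norm_diff_square: "norm (a - b) ^ 2 = norm a ^ 2 + norm b ^ 2 - 2 * Re (a * cnj b)" for a b :: complex
  by (simp only: cmod_power2) (simp add: power2_eq_square algebra_simps)

text \<open>Take a trigonometric approximation and drop its negative frequencies: the dropped part
  \<open>t\<close> is orthogonal to \<open>f - s\<close>, so by Pythagoras the error can only
  decrease.\<close>

lemma bounded_hardy_approx_poly_L2:
  assumes f: "bounded_hardy f" and e: "e > 0"
  obtains s where "(\<integral>z. norm (f z - poly s z) ^ 2 \<partial>circle_measure) < e"
proof -
  obtain N q where q: "(\<integral>z. norm (f z - cnj z ^ N * poly q z) ^ 2 \<partial>circle_measure) < e"
    using ess_bounded_approx_trig_poly[of f e] f e by auto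
  \<comment> \<open>On the circle the approximation \<open>cnj z ^ N * q\<close> is
    \<open>s + t\<close>, with \<open>s\<close> the analytic part and \<open>t\<close> of negative
    frequencies only, since the remainder \<open>r\<close> has degree below N.\<close>
  define s r where "s = q div monom 1 N" and "r = q mod monom 1 N"
  define t where "t = (\<lambda>z. cnj z ^ N * poly r z)"
  \<comment> \<open>The conjugate of \<open>t\<close> has the frequencies N - i = 1 + (N - Suc i)
    with i < N; all are at least 1, so \<open>cnj t\<close> is z times the polynomial
    \<open>u\<close>, and the coefficient condition on \<open>f - s\<close> applies.\<close>
  define u where "u = (\<Sum>i<N. monom (cnj (coeff r i)) (N - Suc i))"
  have r: "coeff r i = 0" if "i \<ge> N" for i
  proof (cases "r = 0")
    case False
    then have "degree r < N"
      using degree_mod_less[of "monom 1 N" q] by (auto simp: r_def degree_monom_eq)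
    then show ?thesis using that by (intro coeff_eq_0) auto
  qed auto
  have r': "poly r z = (\<Sum>i<N. coeff r i * z ^ i)" for z
  proof -
    have "poly r z = (\<Sum>i\<le>degree r + N. coeff r i * z ^ i)"
      unfolding poly_altdef by (rule sum.mono_neutral_left) (auto intro: coeff_eq_0)
    also have "\<dots> = (\<Sum>i<N. coeff r i * z ^ i)"
      by (rule sum.mono_neutral_right) (auto intro: r)
    finally show ?thesis .
  qed
  have tu: "cnj (t z) = z * poly u z" if "z \<in> sphere 0 1" for z
  proof -
    have "cnj (t z) = (\<Sum>i<N. cnj (coeff r i) * (z ^ N * cnj z ^ i))"
      by (simp add: t_def r' sum_distrib_left mult_ac)
    also have "\<dots> = (\<Sum>i<N. cnj (coeff r i) * (z * z ^ (N - Suc i)))"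
    proof (rule sum.cong)
      fix i assume "i \<in> {..<N}"
      then have "z ^ N = z ^ i * (z * z ^ (N - Suc i))"
        by (simp flip: power_Suc power_add)
      then show "cnj (coeff r i) * (z ^ N * cnj z ^ i) = cnj (coeff r i) * (z * z ^ (N - Suc i))"
        using cnj_power_mult_power[OF that, of i] by (simp add: mult_ac)
    qed auto
    also have "\<dots> = z * poly u z"
      by (simp add: u_def poly_sum poly_monom sum_distrib_left mult_ac)
    finally show ?thesis .
  qed
  have g: "bounded_hardy (\<lambda>z. f z - poly s z)" using f by auto
  have t: "ess_bounded t" unfolding t_def by (intro ess_bounded_continuous continuous_intros)
  have ig: "integrable circle_measure (\<lambda>z. norm (f z - poly s z) ^ 2)"
    "integrable circle_measure (\<lambda>z. norm (t z) ^ 2)"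
    "integrable circle_measure (\<lambda>z. (f z - poly s z) * cnj (t z))"
    using f t by (auto intro!: ess_bounded_integrable_norm ess_bounded_integrable ess_bounded_intros)
  have "(\<integral>z. (f z - poly s z) * cnj (t z) \<partial>circle_measure) = (\<integral>z. z ^ 1 * poly u z * (f z - poly s z) \<partial>circle_measure)"
    by (rule Bochner_Integration.integral_cong) (use tu in auto)
  then have 0: "(\<integral>z. (f z - poly s z) * cnj (t z) \<partial>circle_measure) = 0"
    using bounded_hardy_integral_mult_poly[OF g order_refl] by simp
  have qq: "cnj z ^ N * poly q z = t z + poly s z" if "z \<in> sphere 0 1" for z
  proof -
    have "poly q z = poly s z * z ^ N + poly r z"
      by (metis div_mult_mod_eq poly_add poly_mult poly_monom mult_1 s_def r_def)
    then show ?thesis using cnj_power_mult_power[OF that, of N] by (simp add: t_def algebra_simps)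
  qed
  have "(\<integral>z. norm (f z - cnj z ^ N * poly q z) ^ 2 \<partial>circle_measure)
     = (\<integral>z. norm ((f z - poly s z) - t z) ^ 2 \<partial>circle_measure)"
    by (rule Bochner_Integration.integral_cong) (use qq in \<open>auto simp: algebra_simps\<close>)
  also have "\<dots> = (\<integral>z. norm (f z - poly s z) ^ 2 + norm (t z) ^ 2 - 2 * Re ((f z - poly s z) * cnj (t z)) \<partial>circle_measure)"
    by (simp only: norm_diff_square)
  also have "\<dots> = (\<integral>z. norm (f z - poly s z) ^ 2 \<partial>circle_measure) + (\<integral>z. norm (t z) ^ 2 \<partial>circle_measure)
      - 2 * Re (\<integral>z. (f z - poly s z) * cnj (t z) \<partial>circle_measure)"
    using ig by (simp only: Bochner_Integration.integral_add Bochner_Integration.integral_diff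
      integrable_Re integral_Re Bochner_Integration.integrable_add integrable_mult_right integral_mult_right_zero)
  also have "\<dots> \<ge> (\<integral>z. norm (f z - poly s z) ^ 2 \<partial>circle_measure)"
    by (simp add: 0)
  finally show ?thesis using q that[of s] by simp
qed

text \<open>Splitting at the threshold \<eta> replaces Hoelder's inequality: on a finite measure
  space it carries smallness from the exponent b down to a.\<close>

lemma powr_le_interpolate:
  fixes x :: real
  assumes "0 < a" "a < b" "0 < \<eta>" "x \<ge> 0"
  shows "x powr a \<le> \<eta> powr a + \<eta> powr (a - b) * x powr b"
proof (cases "x \<le> \<eta>")
  case True
  then have "x powr a \<le> \<eta> powr a" using assms by (intro powr_mono2) auto
  then show ?thesis by (simp add: add_increasing2)
next
  case False
  have "x powr a = x powr (a - b) * x powr b"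
    using False assms by (simp flip: powr_add)
  also have "\<dots> \<le> \<eta> powr (a - b) * x powr b"
    using False assms by (intro mult_right_mono powr_mono2') auto
  finally show ?thesis by (simp add: add_increasing)
qed

lemma integrable_powr_le:
  fixes g :: "complex \<Rightarrow> complex"
  assumes "0 < a" "a < b" "g \<in> borel_measurable circle_measure"
    and "integrable circle_measure (\<lambda>z. norm (g z) powr b)"
  shows "integrable circle_measure (\<lambda>z. norm (g z) powr a)"
proof (rule Bochner_Integration.integrable_bound)
  show "integrable circle_measure (\<lambda>z. 1 + norm (g z) powr b)"
    using assms by auto
  show "AE z in circle_measure. norm (norm (g z) powr a) \<le> norm (1 + norm (g z) powr b)"
    using powr_le_interpolate[OF assms(1,2) zero_less_one norm_ge_zero] by (intro AE_I2) simp
qed (use assms in auto)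

lemma integral_powr_small:
  assumes "0 < a" "a < b" "0 < e"
  obtains d where "d > 0" "\<And>g :: complex \<Rightarrow> complex. g \<in> borel_measurable circle_measure \<Longrightarrow>
    integrable circle_measure (\<lambda>z. norm (g z) powr b) \<Longrightarrow>
    (\<integral>z. norm (g z) powr b \<partial>circle_measure) < d \<Longrightarrow> (\<integral>z. norm (g z) powr a \<partial>circle_measure) < e"
proof
  \<comment> \<open>Half of e is spent on the values up to \<eta>, the other half on the b-th
    powers.\<close>
  define \<eta> where "\<eta> = (e/2) powr (1/a)"
  have \<eta>: "\<eta> > 0" "\<eta> powr a = e / 2" using assms by (auto simp: \<eta>_def powr_powr)
  show "e / (2 * \<eta> powr (a - b)) > 0" using assms \<eta> by simp
  fix g :: "complex \<Rightarrow> complex"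
  assume g: "g \<in> borel_measurable circle_measure" "integrable circle_measure (\<lambda>z. norm (g z) powr b)"
    "(\<integral>z. norm (g z) powr b \<partial>circle_measure) < e / (2 * \<eta> powr (a - b))"
  have "(\<integral>z. norm (g z) powr a \<partial>circle_measure) \<le> (\<integral>z. \<eta> powr a + \<eta> powr (a - b) * norm (g z) powr b \<partial>circle_measure)"
    using integrable_powr_le[OF assms(1,2) g(1,2)] g powr_le_interpolate[OF assms(1,2) \<eta>(1) norm_ge_zero]
    by (intro integral_mono) auto
  also have "\<dots> = e/2 + \<eta> powr (a - b) * (\<integral>z. norm (g z) powr b \<partial>circle_measure)"
    using g by (simp add: \<eta>)
  also have "\<dots> < e" using g(3) \<eta> by (simp add: field_simps)
  finally show "(\<integral>z. norm (g z) powr a \<partial>circle_measure) < e" .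
qed

text \<open>One polynomial serves three exponents at once, because on a finite measure space L^2
  smallness controls the lower exponents.\<close>

lemma bounded_hardy_approx_poly:
  assumes f: "bounded_hardy f" and "0 < a" "a \<le> 1" "0 < e"
  obtains s where "(\<integral>z. norm (f z - poly s z) ^ 2 \<partial>circle_measure) < e"
    "(\<integral>z. norm (f z - poly s z) \<partial>circle_measure) < e"
    "(\<integral>z. norm (f z - poly s z) powr a \<partial>circle_measure) < e"
proof -
  have two: "norm x powr 2 = norm x ^ 2" for x :: complex
    by (cases "x = 0") auto
  obtain d1 where d1: "d1 > 0" "\<And>g :: complex \<Rightarrow> complex. g \<in> borel_measurable circle_measure \<Longrightarrow>
    integrable circle_measure (\<lambda>z. norm (g z) powr 2) \<Longrightarrow>
    (\<integral>z. norm (g z) powr 2 \<partial>circle_measure) < d1 \<Longrightarrow> (\<integral>z. norm (g z) powr 1 \<partial>circle_measure) < e"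
    using integral_powr_small[of 1 2 e] assms by auto
  obtain d2 where d2: "d2 > 0" "\<And>g :: complex \<Rightarrow> complex. g \<in> borel_measurable circle_measure \<Longrightarrow>
    integrable circle_measure (\<lambda>z. norm (g z) powr 2) \<Longrightarrow>
    (\<integral>z. norm (g z) powr 2 \<partial>circle_measure) < d2 \<Longrightarrow> (\<integral>z. norm (g z) powr a \<partial>circle_measure) < e"
    using integral_powr_small[of a 2 e] assms by auto
  obtain s where s: "(\<integral>z. norm (f z - poly s z) ^ 2 \<partial>circle_measure) < Min {e, d1, d2}"
    using bounded_hardy_approx_poly_L2[OF f, of "Min {e, d1, d2}"] assms d1 d2 by auto
  have g: "ess_bounded (\<lambda>z. f z - poly s z)" using f by (auto intro!: ess_bounded_intros)
  show ?thesis
    using that[of s] s d1(2)[of "\<lambda>z. f z - poly s z"] d2(2)[of "\<lambda>z. f z - poly s z"]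
      ess_bounded_integrable_norm[OF g, of 2] ess_bounded_measurable[OF g] by (simp add: two)
qed

lemma norm_integral_mult_le:
  fixes g b :: "complex \<Rightarrow> complex"
  assumes "integrable circle_measure g" "ess_bounded b" "AE z in circle_measure. norm (b z) \<le> M"
  shows "norm (\<integral>z. g z * b z \<partial>circle_measure) \<le> M * (\<integral>z. norm (g z) \<partial>circle_measure)"
proof -
  have [measurable]: "g \<in> borel_measurable circle_measure" "b \<in> borel_measurable circle_measure"
    using assms by auto
  have le: "AE z in circle_measure. norm (g z * b z) \<le> M * norm (g z)"
    using assms(3) by eventually_elim (simp add: norm_mult mult.commute mult_right_mono)
  have "integrable circle_measure (\<lambda>z. M * norm (g z))" using assms by auto
  then have "integrable circle_measure (\<lambda>z. g z * b z)"
    by (rule Bochner_Integration.integrable_bound) (use le in \<open>auto elim!: eventually_mono\<close>)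
  then have "(\<integral>z. norm (g z * b z) \<partial>circle_measure) \<le> (\<integral>z. M * norm (g z) \<partial>circle_measure)"
    using assms by (intro integral_mono_AE le) auto
  then have "norm (\<integral>z. g z * b z \<partial>circle_measure) \<le> (\<integral>z. M * norm (g z) \<partial>circle_measure)"
    by (rule order_trans[OF integral_norm_bound])
  then show ?thesis by simp
qed

section \<open>Multiplicativity of the mean, and absence of zero divisors\<close>

text \<open>The mean is evaluation at 0, which is multiplicative on analytic functions. For a
  polynomial factor this is read off from the coefficients, and L^1 approximation of
  \<open>a\<close> gives the rest as \<open>b\<close> is bounded.\<close>

lemma bounded_hardy_integral_mult:
  assumes a: "bounded_hardy a" and b: "bounded_hardy b"
  shows "(\<integral>z. a z * b z \<partial>circle_measure) = (\<integral>z. a z \<partial>circle_measure) * (\<integral>z. b z \<partial>circle_measure)"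
    (is "?l = ?a * ?b")
proof -
  obtain M where M: "M > 0" "AE z in circle_measure. norm (b z) \<le> M"
    using b by (auto elim: ess_boundedE)
  have "norm (?l - ?a * ?b) \<le> e" if "e > 0" for e
  proof -
    define d where "d = e / (M + norm ?b)"
    have Mb: "M + norm ?b > 0" using M by (simp add: add_pos_nonneg)
    then have d: "d > 0" "d * (M + norm ?b) = e" using that by (auto simp: d_def)
    obtain s where s: "(\<integral>z. norm (a z - poly s z) \<partial>circle_measure) < d"
      using bounded_hardy_approx_poly[OF a zero_less_one order_refl d(1)] by metis
    have int: "integrable circle_measure (\<lambda>z. a z - poly s z)" "integrable circle_measure (\<lambda>z. a z * b z)"
       "integrable circle_measure (\<lambda>z. poly s z * b z)" "integrable circle_measure a" "integrable circle_measure (poly s)"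
      using a b by (auto intro!: ess_bounded_integrable ess_bounded_intros)
    have "?l - ?a * ?b = (?l - poly s 0 * ?b) - (?a - poly s 0) * ?b"
      by (simp add: algebra_simps)
    also have "?l - poly s 0 * ?b = (\<integral>z. (a z - poly s z) * b z \<partial>circle_measure)"
      using int bounded_hardy_integral_poly_mult[OF b, of s] by (simp add: left_diff_distrib)
    also have "?a - poly s 0 = (\<integral>z. a z - poly s z \<partial>circle_measure)"
      using int by (simp add: integral_poly_circle)
    finally have "norm (?l - ?a * ?b) \<le> norm (\<integral>z. (a z - poly s z) * b z \<partial>circle_measure)
       + norm (\<integral>z. a z - poly s z \<partial>circle_measure) * norm ?b"
      by (metis norm_mult norm_triangle_ineq4)
    also have "\<dots> \<le> M * (\<integral>z. norm (a z - poly s z) \<partial>circle_measure) + (\<integral>z. norm (a z - poly s z) \<partial>circle_measure) * norm ?b"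
      using int b M by (intro add_mono mult_right_mono norm_integral_mult_le integral_norm_bound) auto
    also have "\<dots> = (\<integral>z. norm (a z - poly s z) \<partial>circle_measure) * (M + norm ?b)"
      by (simp add: algebra_simps)
    also have "\<dots> \<le> d * (M + norm ?b)" using s Mb by (intro mult_right_mono) auto
    finally show ?thesis using d by simp
  qed
  then have "norm (?l - ?a * ?b) \<le> 0" by (rule field_le_epsilon[of _ 0, simplified])
  then show ?thesis by simp
qed

text \<open>Multiplicativity of the mean is applied to \<open>a\<close> and
  \<open>z ^ n * b\<close>; the latter has mean 0.\<close>

lemma bounded_hardy_mult [intro]:
  assumes a: "bounded_hardy a" and b: "bounded_hardy b"
  shows "bounded_hardy (\<lambda>z. a z * b z)"
proof -
  have z: "bounded_hardy (\<lambda>z. z ^ n * b z)" for n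
  proof (unfold bounded_hardy_def, intro conjI allI impI)
    show "(\<integral>z. z ^ m * (z ^ n * b z) \<partial>circle_measure) = 0" if "m \<ge> 1" for m
      using bounded_hardyD[OF b, of "m + n"] that by (simp add: power_add mult_ac)
  qed (use b in \<open>auto intro!: ess_bounded_intros\<close>)
  have "(\<integral>z. z ^ n * (a z * b z) \<partial>circle_measure) = 0" if "n \<ge> 1" for n
    using bounded_hardy_integral_mult[OF a z[of n]] bounded_hardyD[OF b that] by (simp add: mult_ac)
  then show ?thesis using a b by (auto simp: bounded_hardy_def intro: ess_bounded_intros)
qed

text \<open>Such an f is orthogonal to every polynomial s, so the squared distance from f to s is
  the sum of the two squared norms and never falls below that of f; but polynomials come arbitrarily
  close.\<close>

lemma bounded_hardy_eq_0:
  assumes f: "bounded_hardy f" and 0: "\<And>n. (\<integral>z. cnj z ^ n * f z \<partial>circle_measure) = 0"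
  shows "AE z in circle_measure. f z = 0"
proof -
  have orth: "(\<integral>z. cnj (poly s z) * f z \<partial>circle_measure) = 0" for s
  proof -
    have "(\<integral>z. cnj (poly s z) * f z \<partial>circle_measure) =
       (\<integral>z. (\<Sum>i\<le>degree s. cnj (coeff s i) * (cnj z ^ i * f z)) \<partial>circle_measure)"
      by (rule Bochner_Integration.integral_cong) (simp_all add: poly_altdef sum_distrib_right mult.assoc)
    also have "\<dots> = (\<Sum>i\<le>degree s. cnj (coeff s i) * (\<integral>z. cnj z ^ i * f z \<partial>circle_measure))"
      using f by (subst Bochner_Integration.integral_sum)
        (auto intro!: integrable_mult_right ess_bounded_integrable ess_bounded_intros)
    finally show ?thesis by (simp add: 0)
  qed
  have i2: "integrable circle_measure (\<lambda>z. norm (f z) ^ 2)" using f by (auto intro!: ess_bounded_integrable_norm)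
  have "(\<integral>z. norm (f z) ^ 2 \<partial>circle_measure) \<le> e" if "e > 0" for e
  proof -
    obtain s where s: "(\<integral>z. norm (f z - poly s z) ^ 2 \<partial>circle_measure) < e"
      using bounded_hardy_approx_poly_L2[OF f \<open>e > 0\<close>] .
    have int: "integrable circle_measure (\<lambda>z. norm (poly s z) ^ 2)"
       "integrable circle_measure (\<lambda>z. f z * cnj (poly s z))"
      using f by (auto intro!: ess_bounded_integrable_norm ess_bounded_integrable ess_bounded_intros)
    have "(\<integral>z. norm (f z - poly s z) ^ 2 \<partial>circle_measure) =
       (\<integral>z. norm (f z) ^ 2 + norm (poly s z) ^ 2 - 2 * Re (f z * cnj (poly s z)) \<partial>circle_measure)"
      by (simp only: norm_diff_square)
    also have "\<dots> = (\<integral>z. norm (f z) ^ 2 \<partial>circle_measure) + (\<integral>z. norm (poly s z) ^ 2 \<partial>circle_measure)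
       - 2 * Re (\<integral>z. f z * cnj (poly s z) \<partial>circle_measure)"
      using int i2 by (simp only: Bochner_Integration.integral_add Bochner_Integration.integral_diff
        integrable_Re integral_Re Bochner_Integration.integrable_add integrable_mult_right integral_mult_right_zero)
    also have "\<dots> \<ge> (\<integral>z. norm (f z) ^ 2 \<partial>circle_measure)"
      using orth[of s] by (simp add: mult.commute)
    finally show ?thesis using s by simp
  qed
  then have "(\<integral>z. norm (f z) ^ 2 \<partial>circle_measure) \<le> 0" by (rule field_le_epsilon[of _ 0, simplified])
  then have "(\<integral>z. norm (f z) ^ 2 \<partial>circle_measure) = 0" by (intro antisym integral_nonneg) auto
  then have "AE z in circle_measure. norm (f z) ^ 2 = 0"
    using integral_nonneg_eq_0_iff_AE[OF i2] by simp
  then show ?thesis by simp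
qed

text \<open>The zero at the origin is divided out: n is its order, found as the index of the first
  nonzero Fourier coefficient.\<close>

lemma bounded_hardy_leading:
  assumes f: "bounded_hardy f" and nz: "\<not> (AE z in circle_measure. f z = 0)"
  obtains n where "bounded_hardy (\<lambda>z. cnj z ^ n * f z)" "(\<integral>z. cnj z ^ n * f z \<partial>circle_measure) \<noteq> 0"
proof -
  define n where "n = (LEAST n. (\<integral>z. cnj z ^ n * f z \<partial>circle_measure) \<noteq> 0)"
  have "\<exists>n. (\<integral>z. cnj z ^ n * f z \<partial>circle_measure) \<noteq> 0"
    using bounded_hardy_eq_0[OF f] nz by blast
  then have n: "(\<integral>z. cnj z ^ n * f z \<partial>circle_measure) \<noteq> 0"
    unfolding n_def by (rule LeastI_ex)
  have less: "(\<integral>z. cnj z ^ k * f z \<partial>circle_measure) = 0" if "k < n" for k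
    using not_less_Least that unfolding n_def by blast
  have "bounded_hardy (\<lambda>z. cnj z ^ n * f z)"
    unfolding bounded_hardy_def
  proof (intro conjI allI impI)
    fix m :: nat assume m: "m \<ge> 1"
    show "(\<integral>z. z ^ m * (cnj z ^ n * f z) \<partial>circle_measure) = 0"
    proof (cases "m \<le> n")
      case True
      have "(\<integral>z. z ^ m * (cnj z ^ n * f z) \<partial>circle_measure) = (\<integral>z. cnj z ^ (n - m) * f z \<partial>circle_measure)"
      proof (rule Bochner_Integration.integral_cong)
        fix z assume "z \<in> space circle_measure"
        then have "cnj z ^ m * z ^ m = 1" by (intro cnj_power_mult_power) simp
        moreover have "cnj z ^ n = cnj z ^ m * cnj z ^ (n - m)" using True by (simp flip: power_add)
        ultimately show "z ^ m * (cnj z ^ n * f z) = cnj z ^ (n - m) * f z" by (simp add: mult_ac)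
      qed auto
      then show ?thesis using less[of "n - m"] True m by simp
    next
      case False
      have "(\<integral>z. z ^ m * (cnj z ^ n * f z) \<partial>circle_measure) = (\<integral>z. z ^ (m - n) * f z \<partial>circle_measure)"
      proof (rule Bochner_Integration.integral_cong)
        fix z assume "z \<in> space circle_measure"
        then have "cnj z ^ n * z ^ n = 1" by (intro cnj_power_mult_power) simp
        moreover have "z ^ m = z ^ n * z ^ (m - n)" using False by (simp flip: power_add)
        ultimately show "z ^ m * (cnj z ^ n * f z) = z ^ (m - n) * f z" by (simp add: mult_ac)
      qed auto
      then show ?thesis using bounded_hardyD[OF f, of "m - n"] False by simp
    qed
  qed (use f in \<open>auto intro!: ess_bounded_intros\<close>)
  then show ?thesis using that n by blast
qed

text \<open>After removal of the zeros at the origin both factors have nonzero mean, and so has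
  their product, which contradicts its vanishing.\<close>

lemma bounded_hardy_mult_eq_0:
  assumes f: "bounded_hardy f" and g: "bounded_hardy g"
    and fg: "AE z in circle_measure. f z * g z = 0" and nz: "\<not> (AE z in circle_measure. f z = 0)"
  shows "AE z in circle_measure. g z = 0"
proof (rule ccontr)
  assume "\<not> (AE z in circle_measure. g z = 0)"
  then obtain m where m: "bounded_hardy (\<lambda>z. cnj z ^ m * g z)" "(\<integral>z. cnj z ^ m * g z \<partial>circle_measure) \<noteq> 0"
    using bounded_hardy_leading[OF g] by blast
  obtain n where n: "bounded_hardy (\<lambda>z. cnj z ^ n * f z)" "(\<integral>z. cnj z ^ n * f z \<partial>circle_measure) \<noteq> 0"
    using bounded_hardy_leading[OF f nz] by blast
  have "(\<integral>z. (cnj z ^ n * f z) * (cnj z ^ m * g z) \<partial>circle_measure) = 0"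
    using fg by (intro integral_eq_zero_AE) (auto elim!: eventually_mono)
  then show False using bounded_hardy_integral_mult[OF n(1) m(1)] n m by simp
qed

section \<open>Elementary inequalities and expansions\<close>

text \<open>This is the strict weighted inequality between geometric and arithmetic mean of y and 1.
  It follows from ln x \<le> x - 1 at y/A and 1/A, where A is the arithmetic mean; strictness comes
  from y \<noteq> A.\<close>

lemma powr_less_affine:
  fixes y p :: real
  assumes "0 < p" "p < 1" "0 < y" "y \<noteq> 1"
  shows "y powr p < 1 + p * (y - 1)"
proof -
  define A where "A = 1 + p * (y - 1)"
  have Ay: "A = (1 - p) + p * y" by (simp add: A_def algebra_simps)
  moreover have "p * y > 0" using assms by simp
  ultimately have A: "A > 0" using assms by linarith
  have ne: "y \<noteq> A"
  proof
    assume "y = A"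
    then have "(1 - p) * (y - 1) = 0" by (simp add: A_def algebra_simps)
    then show False using assms by simp
  qed
  have "ln (y / A) < y / A - 1"
  proof -
    have "y / A > 0" "y / A \<noteq> 1" using assms A ne by auto
    then have "ln (y / A) \<noteq> y / A - 1" using ln_eq_minus_one by blast
    with ln_le_minus_one[OF \<open>y / A > 0\<close>] show ?thesis by linarith
  qed
  then have "p * ln (y / A) < p * (y / A - 1)" using assms by simp
  moreover have "(1 - p) * ln (1 / A) \<le> (1 - p) * (1 / A - 1)"
    using ln_le_minus_one[of "1 / A"] A assms by (intro mult_left_mono) auto
  moreover have "p * (y / A - 1) + (1 - p) * (1 / A - 1) = 0"
  proof -
    have "p * (y / A - 1) + (1 - p) * (1 / A - 1) = ((1 - p) + p * y) / A - 1"
      by (simp add: add_divide_distrib diff_divide_distrib algebra_simps)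
    also have "\<dots> = 0" using A by (simp flip: Ay)
    finally show ?thesis .
  qed
  ultimately have "p * ln (y / A) + (1 - p) * ln (1 / A) < 0" by linarith
  then have "p * ln y < ln A" using assms A by (simp add: ln_div right_diff_distrib left_diff_distrib)
  then have "exp (p * ln y) < exp (ln A)" by simp
  then have "y powr p < A" using assms(3) A by (simp add: powr_def)
  then show ?thesis by (simp only: A_def)
qed

lemma powr_le_affine:
  fixes y p :: real
  assumes "0 < p" "p < 1" "0 \<le> y"
  shows "y powr p \<le> 1 + p * (y - 1)"
proof (cases "y = 0 \<or> y = 1")
  case False
  then show ?thesis using powr_less_affine[of p y] assms by simp
qed (use assms in auto)

lemma powr_add_powr_le_two:
  fixes x p :: real
  assumes "0 < p" "p < 1" "\<bar>x\<bar> < 1"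
  shows "(1 + x) powr p + (1 - x) powr p \<le> 2"
    and "(1 + x) powr p + (1 - x) powr p = 2 \<Longrightarrow> x = 0"
proof -
  have *: "(1 + x) powr p + (1 - x) powr p < 2" if "x \<noteq> 0"
  proof -
    have "0 < 1 + x" "0 < 1 - x" using assms(3) by linarith+
    then show ?thesis
      using powr_less_affine[of p "1 + x"] powr_less_affine[of p "1 - x"] assms(1,2) that by simp
  qed
  then show "(1 + x) powr p + (1 - x) powr p \<le> 2" by (cases "x = 0") auto
  show "x = 0" if "(1 + x) powr p + (1 - x) powr p = 2" using * that by force
qed

text \<open>Since p/2 < 1, concavity of x^(p/2) applies to x = |1 + w|^2, which is a quadratic
  expression in w. The bound holds for every w, so it can be integrated without any restriction on
  \<delta>.\<close>

lemma norm_one_plus_powr_le: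
  fixes w :: complex
  assumes "0 < p" "p < 2"
  shows "norm (1 + w) powr p \<le> 1 + p * Re w + p / 2 * norm w ^ 2"
proof -
  have "norm (1 + w) powr p = (norm (1 + w) ^ 2) powr (p / 2)"
    using powr_powr[of "norm (1 + w)" 2 "p / 2"] by simp
  also have "(norm (1 + w) ^ 2) powr (p / 2) \<le> 1 + p / 2 * (norm (1 + w) ^ 2 - 1)"
    using assms by (intro powr_le_affine) auto
  also have "norm (1 + w) ^ 2 = 1 + 2 * Re w + norm w ^ 2"
    unfolding cmod_power2 by (simp add: power2_eq_square algebra_simps)
  also have "1 + p / 2 * (1 + 2 * Re w + norm w ^ 2 - 1) = 1 + p * Re w + p / 2 * norm w ^ 2"
    by (simp add: algebra_simps)
  finally show ?thesis .
qed

text \<open>\<open>f i\<close> is the i-th derivative of (1 + w)^c. On the disc of radius 1/2 the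
  point 1 + w stays off the branch cut and the third derivative is bounded by compactness.\<close>

lemma powr_Taylor2:
  fixes c :: complex
  obtains C where "C \<ge> 0"
    "\<And>w. norm w \<le> 1/2 \<Longrightarrow> norm ((1 + w) powr c - (1 + c * w + c * (c - 1) / 2 * w ^ 2)) \<le> C * norm w ^ 3"
proof -
  define S where "S = cball (0::complex) (1/2)"
  define f where "f = (\<lambda>i w. (\<Prod>j<i. c - of_nat j) * (1 + w) powr (c - of_nat i))"
  have nr: "1 + w \<notin> \<real>\<^sub>\<le>\<^sub>0" if "w \<in> S" for w
  proof -
    have "\<bar>Re w\<bar> \<le> 1/2" using that abs_Re_le_cmod[of w] by (simp add: S_def)
    then show ?thesis by (auto simp: complex_nonpos_Reals_iff)
  qed
  have der: "(f i has_field_derivative f (Suc i) w) (at w within S)" if "w \<in> S" for i w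
    unfolding f_def using nr[OF that]
    by (auto intro!: derivative_eq_intros simp: algebra_simps)
  have "continuous_on S (f 3)"
    by (rule DERIV_continuous_on[OF der])
  then have "compact (f 3 ` S)" by (rule compact_continuous_image) (simp add: S_def)
  then obtain B where B: "\<forall>x\<in>f 3 ` S. norm x \<le> B"
    using compact_imp_bounded bounded_iff by metis
  have "norm ((1 + w) powr c - (1 + c * w + c * (c - 1) / 2 * w ^ 2)) \<le> (B / 2) * norm w ^ 3"
    if "norm w \<le> 1/2" for w
  proof -
    have "norm (f 0 w - (\<Sum>i\<le>2. f i 0 * (w - 0) ^ i / fact i)) \<le> B * norm (w - 0) ^ Suc 2 / fact 2"
      by (rule complex_Taylor[where S = S]) (use der B that in \<open>auto simp: S_def numeral_3_eq_3\<close>)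
    then show ?thesis
      by (simp add: f_def eval_nat_numeral algebra_simps)
  qed
  moreover have "norm (f 3 0) \<le> B"
    using B by (simp add: S_def)
  then have "B \<ge> 0"
    using norm_ge_zero order_trans by blast
  ultimately show ?thesis using that[of "B/2"] by simp
qed

text \<open>With s = p/2 real, |1 + w|^p / (1 + w) factors as (1 + w)^(s-1) times the conjugate of
  (1 + w)^s; the quadratic form is the product of the two Taylor polynomials up to order 2. The
  function itself is the weight met in \<open>first_variation\<close>.\<close>

lemma norm_powr_div_Taylor2:
  fixes p :: real
  defines "s \<equiv> complex_of_real (p / 2)"
  obtains C where "C \<ge> 0" "\<And>w. norm w \<le> 1/2 \<Longrightarrow>
    norm (complex_of_real (norm (1 + w) powr p) / (1 + w) - (1 + (s - 1) * w + s * cnj w + (s - 1) * (s - 2) / 2 * w ^ 2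
      + (s - 1) * s * (w * cnj w) + s * (s - 1) / 2 * cnj w ^ 2)) \<le> C * norm w ^ 3"
proof -
  obtain C where C: "C \<ge> 0" "\<And>w. norm w \<le> 1/2 \<Longrightarrow>
     norm ((1 + w) powr (s - 1) - (1 + (s - 1) * w + (s - 1) * (s - 1 - 1) / 2 * w ^ 2)) \<le> C * norm w ^ 3"
    using powr_Taylor2[of "s - 1"] by blast
  obtain D where D: "D \<ge> 0" "\<And>w. norm w \<le> 1/2 \<Longrightarrow>
     norm ((1 + w) powr s - (1 + s * w + s * (s - 1) / 2 * w ^ 2)) \<le> D * norm w ^ 3"
    using powr_Taylor2[of s] by blast
  define \<alpha> \<gamma> where "\<alpha> = (s - 1) * (s - 2) / 2" and "\<gamma> = s * (s - 1) / 2"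
  \<comment> \<open>E bounds the Taylor polynomial of the first factor, F the second factor itself,
    and G collects the terms of order 3 and 4 in the product of the two polynomials.\<close>
  define E where "E = 1 + norm (s - 1) + norm \<alpha>"
  define F where "F = D + 1 + norm s + norm \<gamma>"
  define G where "G = norm ((s - 1) * \<gamma>) + norm (\<alpha> * s) + norm (\<alpha> * \<gamma>)"
  show ?thesis
  proof
    show "C * F + E * D + G \<ge> 0"
      using C D by (simp add: E_def F_def G_def)
    fix w :: complex assume w: "norm w \<le> 1/2"
    define r where "r = norm w"
    have r: "0 \<le> r" "r \<le> 1" using w by (auto simp: r_def)
    have rr: "r ^ 2 \<le> 1" "r ^ 3 \<le> 1" "r ^ 4 \<le> r ^ 3"
      using r by (auto intro!: power_le_one power_decreasing)
    define a a2 b b2 where "a = (1 + w) powr (s - 1)" and "a2 = 1 + (s - 1) * w + \<alpha> * w ^ 2"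
      and "b = cnj ((1 + w) powr s)" and "b2 = 1 + s * cnj w + \<gamma> * cnj w ^ 2"
    have cs: "cnj s = s" "cnj \<gamma> = \<gamma>" by (auto simp: s_def \<gamma>_def)
    have ne: "1 + w \<noteq> 0"
      using w by (auto simp: add_eq_0_iff)
    have aa: "norm (a - a2) \<le> C * r ^ 3" using C(2)[OF w] by (simp add: a_def a2_def \<alpha>_def r_def)
    have "norm (cnj (b - b2)) \<le> D * r ^ 3"
      using D(2)[OF w] cs by (simp add: b_def b2_def \<gamma>_def r_def)
    then have bb: "norm (b - b2) \<le> D * r ^ 3" by (simp only: complex_mod_cnj)
    have "norm a2 \<le> 1 + norm (s - 1) * r + norm \<alpha> * r ^ 2"
      unfolding a2_def r_def
      by (intro norm_triangle_le add_mono) (auto simp: norm_mult norm_power)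
    also have "\<dots> \<le> E" using r rr by (simp add: E_def add_mono mult_left_le)
    finally have nE: "norm a2 \<le> E" .
    have "norm b2 \<le> 1 + norm s * r + norm \<gamma> * r ^ 2"
      unfolding b2_def r_def
      by (intro norm_triangle_le add_mono) (auto simp: norm_mult norm_power)
    also have "\<dots> \<le> 1 + norm s + norm \<gamma>" using r rr by (simp add: add_mono mult_left_le)
    finally have "norm b2 \<le> 1 + norm s + norm \<gamma>" .
    moreover have "norm b \<le> norm b2 + norm (b - b2)" by (metis norm_triangle_sub)
    moreover have "D * r ^ 3 \<le> D" using rr D by (simp add: mult_left_le)
    ultimately have nF: "norm b \<le> F" using bb by (simp add: F_def)
    have "a * b = ((1 + w) powr s * cnj ((1 + w) powr s)) / (1 + w)"
      using ne by (simp add: a_def b_def powr_diff)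
    also have "(1 + w) powr s * cnj ((1 + w) powr s) = of_real (norm ((1 + w) powr s) ^ 2)"
      by (simp only: complex_norm_square)
    also have "norm ((1 + w) powr s) = norm (1 + w) powr (p / 2)"
      by (subst norm_powr_real_powr') (auto simp: s_def)
    also have "\<dots> ^ 2 = norm (1 + w) powr p"
      using ne by (simp flip: powr_numeral add: powr_powr)
    finally have ab: "a * b = complex_of_real (norm (1 + w) powr p) / (1 + w)" .
    define Q where "Q = 1 + (s - 1) * w + s * cnj w + \<alpha> * w ^ 2 + (s - 1) * s * (w * cnj w) + \<gamma> * cnj w ^ 2"
    have "a * b - Q = (a - a2) * b + a2 * (b - b2) + (a2 * b2 - Q)" by (simp add: algebra_simps)
    also have "a2 * b2 - Q = ((s - 1) * \<gamma>) * (w * cnj w ^ 2) + (\<alpha> * s) * (w ^ 2 * cnj w) + (\<alpha> * \<gamma>) * (w ^ 2 * cnj w ^ 2)"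
      by (simp add: a2_def b2_def Q_def algebra_simps power2_eq_square)
    finally have "norm (a * b - Q) = norm ((a - a2) * b + a2 * (b - b2) + (((s - 1) * \<gamma>) * (w * cnj w ^ 2) + (\<alpha> * s) * (w ^ 2 * cnj w) + (\<alpha> * \<gamma>) * (w ^ 2 * cnj w ^ 2)))"
      by (rule arg_cong)
    also have "\<dots> \<le> (norm ((a - a2) * b) + norm (a2 * (b - b2))) + (norm (((s - 1) * \<gamma>) * (w * cnj w ^ 2))
       + norm ((\<alpha> * s) * (w ^ 2 * cnj w)) + norm ((\<alpha> * \<gamma>) * (w ^ 2 * cnj w ^ 2)))"
      by (intro norm_triangle_mono order_refl)
    also have "\<dots> = (norm (a - a2) * norm b + norm a2 * norm (b - b2))
        + (norm ((s - 1) * \<gamma>) * r ^ 3 + norm (\<alpha> * s) * r ^ 3 + norm (\<alpha> * \<gamma>) * r ^ 4)"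
      by (simp add: norm_mult norm_power r_def eval_nat_numeral)
    also have "\<dots> \<le> (C * r ^ 3 * F + E * (D * r ^ 3)) + (norm ((s - 1) * \<gamma>) * r ^ 3 + norm (\<alpha> * s) * r ^ 3 + norm (\<alpha> * \<gamma>) * r ^ 3)"
      using aa bb nE nF rr C D r by (intro add_mono mult_mono mult_left_mono) (auto simp: E_def)
    also have "\<dots> = (C * F + E * D + G) * r ^ 3" by (simp add: G_def algebra_simps)
    finally show "norm (complex_of_real (norm (1 + w) powr p) / (1 + w) - (1 + (s - 1) * w + s * cnj w + (s - 1) * (s - 2) / 2 * w ^ 2
      + (s - 1) * s * (w * cnj w) + s * (s - 1) / 2 * cnj w ^ 2)) \<le> (C * F + E * D + G) * norm w ^ 3"
      by (simp add: ab Q_def \<alpha>_def \<gamma>_def r_def)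
  qed
qed

lemma quadratic_coeffs_eq_0:
  fixes a b c :: complex
  assumes "\<delta> > 0" and le: "\<And>t. 0 < t \<Longrightarrow> t < \<delta> \<Longrightarrow> norm (a + of_real t * b + of_real t ^ 2 * c) \<le> C * t ^ 3"
  shows "a = 0" "b = 0" "c = 0"
proof -
  have ev: "eventually (\<lambda>t. 0 < t \<and> t < \<delta>) (at_right 0)"
    using eventually_at_right_less[of 0] eventually_at_right_real[OF assms(1)] by eventually_elim auto
  have lim0: "a = 0" if "eventually (\<lambda>t. norm (a + of_real t * b) \<le> C * t ^ Suc n) (at_right 0)"
    for a b :: complex and n
  proof -
    have "((\<lambda>t. C * t ^ Suc n) \<longlongrightarrow> C * 0 ^ Suc n) (at_right (0::real))" by (intro tendsto_intros)
    then have "((\<lambda>t. a + of_real t * b) \<longlongrightarrow> 0) (at_right 0)"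
      by (intro Lim_null_comparison[OF that]) simp
    moreover have "((\<lambda>t. a + of_real t * b) \<longlongrightarrow> a + of_real 0 * b) (at_right 0)" by (intro tendsto_intros)
    ultimately have "0 = a + of_real 0 * b"
      by (rule tendsto_unique[OF trivial_limit_at_right_real])
    then show ?thesis by simp
  qed
  show a: "a = 0"
  proof -
    have "((\<lambda>t. C * t ^ 3) \<longlongrightarrow> C * 0 ^ 3) (at_right (0::real))" by (intro tendsto_intros)
    then have "((\<lambda>t. a + of_real t * b + of_real t ^ 2 * c) \<longlongrightarrow> 0) (at_right 0)"
      by (intro Lim_null_comparison[OF eventually_mono[OF ev le]]) simp_all
    moreover have "((\<lambda>t. a + of_real t * b + of_real t ^ 2 * c) \<longlongrightarrow> a + of_real 0 * b + of_real 0 ^ 2 * c) (at_right 0)"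
      by (intro tendsto_intros)
    ultimately have "0 = a + of_real 0 * b + of_real 0 ^ 2 * c"
      by (rule tendsto_unique[OF trivial_limit_at_right_real])
    then show ?thesis by simp
  qed
  show b: "b = 0"
  proof (rule lim0[of b c 1])
    show "eventually (\<lambda>t. norm (b + of_real t * c) \<le> C * t ^ Suc 1) (at_right 0)"
      using ev
    proof eventually_elim
      case (elim t)
      have "a + of_real t * b + of_real t ^ 2 * c = of_real t * (b + of_real t * c)"
        by (simp add: a power2_eq_square distrib_left mult.assoc)
      then have "t * norm (b + of_real t * c) \<le> C * t ^ 3"
        using le[of t] elim by (simp add: norm_mult)
      also have "C * t ^ 3 = t * (C * t ^ Suc 1)"
        by (simp add: power3_eq_cube)
      finally show ?case using elim by (simp only: mult_le_cancel_left_pos)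
    qed
  qed
  show "c = 0"
  proof (rule lim0[of c 0 0])
    show "eventually (\<lambda>t. norm (c + of_real t * 0) \<le> C * t ^ Suc 0) (at_right 0)"
      using ev
    proof eventually_elim
      case (elim t)
      have "t ^ 2 * norm c \<le> C * t ^ 3"
        using le[of t] elim a b by (simp add: norm_mult norm_power)
      also have "C * t ^ 3 = t ^ 2 * (C * t)"
        by (simp add: power3_eq_cube power2_eq_square)
      finally show ?case using elim by simp
    qed
  qed
qed

section \<open>Subharmonicity and boundary values\<close>

text \<open>Each factor z - a with |a| < 1 is replaced by 1 - cnj a z. Their quotient is a Blaschke
  factor, so the modulus on the circle is kept, while the modulus at 0 rises from |a| to 1.\<close>

lemma reflect_roots:
  fixes q :: "complex poly"
  assumes "q \<noteq> 0"
  shows "\<exists>q'. (\<forall>z\<in>sphere 0 1. norm (poly q' z) = norm (poly q z)) \<and>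
     norm (poly q 0) \<le> norm (poly q' 0) \<and> (\<forall>z\<in>ball 0 1. poly q' z \<noteq> 0)"
  using assms
proof (induction "degree q" arbitrary: q)
  case 0
  then obtain c where "q = [:c:]" using degree_eq_zeroE by metis
  then show ?case using 0 by (intro exI[of _ q]) auto
next
  case (Suc n)
  then have "\<not> constant (poly q)" by (simp add: constant_degree)
  then obtain a where "poly q a = 0" using fundamental_theorem_of_algebra by blast
  then obtain r where r: "q = [:-a, 1:] * r" by (auto simp: poly_eq_0_iff_dvd elim: dvdE)
  then have r0: "r \<noteq> 0" using Suc by auto
  then have "degree r = n" using Suc.hyps(2) unfolding r by (subst (asm) degree_mult_eq) auto
  then obtain r' where r': "\<forall>z\<in>sphere 0 1. norm (poly r' z) = norm (poly r z)"
     "norm (poly r 0) \<le> norm (poly r' 0)" "\<forall>z\<in>ball 0 1. poly r' z \<noteq> 0"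
    using Suc.hyps(1) r0 by blast
  show ?case
  proof (cases "norm a \<ge> 1")
    case True
    then have "\<forall>z\<in>ball 0 1. z \<noteq> a" by auto
    moreover have "poly ([:-a, 1:] * r') z = (z - a) * poly r' z" "poly q z = (z - a) * poly r z" for z
      by (simp_all add: r algebra_simps)
    ultimately show ?thesis using r'
      by (intro exI[of _ "[:-a, 1:] * r'"]) (auto simp add: norm_mult mult_left_mono simp del: mult_pCons_left)
  next
    case False
    have "norm (1 - cnj a * z) = norm (z - a)" if "z \<in> sphere 0 1" for z
    proof -
      have "1 - cnj a * z = cnj (z - a) * z"
        using cnj_mult_self_sphere[OF that] by (simp add: algebra_simps)
      then have "norm (1 - cnj a * z) = norm (cnj (z - a)) * norm z" by (simp only: norm_mult)
      then show ?thesis using that by (simp only: complex_mod_cnj) simp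
    qed
    moreover have "1 - cnj a * z \<noteq> 0" if "z \<in> ball 0 1" for z
    proof
      assume "1 - cnj a * z = 0"
      then have "norm a * norm z = 1" by (metis complex_mod_cnj eq_iff_diff_eq_0 norm_mult norm_one)
      moreover have "norm a * norm z \<le> norm a" using that by (intro mult_left_le) auto
      ultimately show False using False by simp
    qed
    moreover have "norm a * norm (poly r 0) \<le> 1 * norm (poly r' 0)"
      using False r' by (intro mult_mono) auto
    moreover have "poly ([:1, - cnj a:] * r') z = (1 - cnj a * z) * poly r' z"
      "poly q z = (z - a) * poly r z" for z
      by (simp_all add: r algebra_simps)
    ultimately show ?thesis using r'
      by (intro exI[of _ "[:1, - cnj a:] * r'"]) (simp add: norm_mult mult.commute[of _ "cnj a"] del: mult_pCons_left)
  qed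
qed

text \<open>A fixed sequence of radii, as dominated convergence is applied along sequences. The
  second \<open>Suc\<close> makes the first radius 1/2 instead of 0, so that 1 /
  \<open>radius k\<close> is always available.\<close>

definition radius :: "nat \<Rightarrow> real" where
  "radius k = 1 + - inverse (real (Suc (Suc k)))"

lemma radius:
  shows "0 < radius k" and "radius k < 1"
    and "radius \<longlonglongrightarrow> 1" and "filterlim radius (at_left 1) sequentially"
proof -
  show b: "0 < radius k" "radius k < 1" for k
    by (auto simp: radius_def field_simps)
  show lim: "radius \<longlonglongrightarrow> 1"
    unfolding radius_def by (rule LIMSEQ_Suc[OF LIMSEQ_inverse_real_of_nat_add_minus])
  show "filterlim radius (at_left 1) sequentially"
    using lim b by (auto intro!: tendsto_imp_filterlim_at_left)
qed

lemma holomorphic_on_dilate: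
  assumes F: "F holomorphic_on ball 0 1" and r: "0 < r" "r < 1"
  shows "(\<lambda>z. F (complex_of_real r * z)) holomorphic_on ball 0 (1 / r)"
    and "(\<lambda>z. F (complex_of_real r * z)) holomorphic_on cball 0 1"
proof -
  have "(F \<circ> (\<lambda>z. complex_of_real r * z)) holomorphic_on ball 0 (1 / r)"
    using r by (intro holomorphic_on_compose_gen[OF _ F] holomorphic_intros)
      (auto simp: norm_mult field_simps)
  then show 1: "(\<lambda>z. F (complex_of_real r * z)) holomorphic_on ball 0 (1 / r)" by (simp add: o_def)
  show "(\<lambda>z. F (complex_of_real r * z)) holomorphic_on cball 0 1"
  proof (rule holomorphic_on_subset[OF 1])
    have "1 < 1 / r" using r by simp
    then show "cball 0 1 \<subseteq> ball (0::complex) (1 / r)" by auto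
  qed
qed

lemma bounded_hardy_holomorphic:
  assumes F: "F holomorphic_on cball 0 1"
  shows "bounded_hardy F"
proof -
  have "continuous_on (sphere 0 1) F"
    using holomorphic_on_imp_continuous_on[OF F] by (rule continuous_on_subset) auto
  moreover have "(\<integral>z. z ^ n * F z \<partial>circle_measure) = 0" if "n \<ge> 1" for n
  proof -
    have "(\<integral>z. z ^ n * F z \<partial>circle_measure) = 0 ^ n * F 0"
      by (rule mean_value_circle) (intro holomorphic_intros F)
    then show ?thesis using that by (simp add: power_0_left)
  qed
  ultimately show ?thesis by (auto simp: bounded_hardy_def intro: ess_bounded_continuous)
qed

lemma poly_bounded_cball:
  fixes q :: "complex poly"
  obtains B where "\<And>z. z \<in> cball 0 1 \<Longrightarrow> norm (poly q z) \<le> B"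
proof -
  have "compact (poly q ` cball 0 1)" by (intro compact_continuous_image continuous_intros) auto
  then obtain B where "\<forall>x\<in>poly q ` cball 0 1. norm x \<le> B"
    using compact_imp_bounded bounded_iff by metis
  then show ?thesis by (intro that[of B]) blast
qed

text \<open>Once the roots are reflected out of the disc, a logarithm g of the polynomial exists and
  the mean value property of exp (s g) gives the estimate for every exponent s > 0.\<close>

lemma norm_powr_poly_0_le:
  assumes s: "s > 0"
  shows "norm (poly q 0) powr s \<le> (\<integral>z. norm (poly q z) powr s \<partial>circle_measure)"
proof (cases "q = 0")
  case False
  then obtain q' where q'_1: "\<forall>z\<in>sphere 0 1. norm (poly q' z) = norm (poly q z)"
     and q'_0: "norm (poly q 0) \<le> norm (poly q' 0)" and q'_nz: "\<forall>z\<in>ball 0 1. poly q' z \<noteq> 0"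
    using reflect_roots[OF False] by (elim exE conjE)
  \<comment> \<open>Roots of \<open>q'\<close> may lie on the circle itself. Dilating by a radius
    below 1 moves them outside the closed disc; the radius tends to 1 afterwards.\<close>
  have le: "norm (poly q' 0) powr s \<le> (\<integral>z. norm (poly q' (complex_of_real (radius k) * z)) powr s \<partial>circle_measure)" for k
  proof -
    define f where "f = (\<lambda>z. poly q' (complex_of_real (radius k) * z))"
    have f: "f holomorphic_on ball 0 (1 / radius k)" unfolding f_def by (intro holomorphic_intros)
    have f0: "f z \<noteq> 0" if "z \<in> ball 0 (1 / radius k)" for z
    proof -
      have "radius k * norm z < 1" using radius(1)[of k] that by (simp add: field_simps)
      then have "complex_of_real (radius k) * z \<in> ball 0 1" using radius(1)[of k] by (simp add: norm_mult)
      then show ?thesis using bspec[OF q'_nz] unfolding f_def by blast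
    qed
    obtain g where g: "g holomorphic_on ball 0 (1 / radius k)" "\<And>z. z \<in> ball 0 (1 / radius k) \<Longrightarrow> exp (g z) = f z"
    proof (rule holomorphic_logarithm_exists[OF convex_ball open_ball f f0])
      show "0 \<in> ball 0 (1 / radius k)" using radius(1)[of k] by simp
      fix g assume "g holomorphic_on ball 0 (1 / radius k)" "\<And>z. z \<in> ball 0 (1 / radius k) \<Longrightarrow> exp (g z) = f z"
      then show thesis by (rule that)
    qed
    have "1 < 1 / radius k" using radius(1,2)[of k] by simp
    then have sub: "cball 0 1 \<subseteq> ball (0::complex) (1 / radius k)" by auto
    have ex: "norm (exp (s * w)) = norm (exp w) powr s" for w :: complex
      by (simp add: powr_def norm_exp_eq_Re)
    have "(\<lambda>z. exp (s * g z)) holomorphic_on cball 0 1"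
      using holomorphic_on_subset[OF g(1) sub] by (intro holomorphic_intros)
    then have "(\<integral>z. exp (s * g z) \<partial>circle_measure) = exp (s * g 0)"
      by (rule mean_value_circle)
    then have "norm (exp (s * g 0)) \<le> (\<integral>z. norm (exp (s * g z)) \<partial>circle_measure)"
      using integral_norm_bound[of circle_measure "\<lambda>z. exp (s * g z)"] by simp
    also have "\<dots> = (\<integral>z. norm (f z) powr s \<partial>circle_measure)"
    proof (rule Bochner_Integration.integral_cong)
      fix z assume "z \<in> space circle_measure"
      then have "z \<in> ball 0 (1 / radius k)" using \<open>1 < 1 / radius k\<close> by simp
      then show "norm (exp (s * g z)) = norm (f z) powr s" using ex[of "g z"] g(2) by simp
    qed auto
    also have "norm (exp (s * g 0)) = norm (f 0) powr s"
      using ex[of "g 0"] g(2)[of 0] radius(1)[of k] by simp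
    finally show ?thesis by (simp add: f_def)
  qed
  obtain B where B: "\<And>z. z \<in> cball 0 1 \<Longrightarrow> norm (poly q' z) \<le> B"
  proof (rule poly_bounded_cball[of q'])
    fix B assume "\<And>z. z \<in> cball 0 1 \<Longrightarrow> norm (poly q' z) \<le> B"
    then show thesis by (rule that)
  qed
  have [measurable]: "poly q' \<in> borel_measurable circle_measure"
    "(\<lambda>z. poly q' (complex_of_real (radius k) * z)) \<in> borel_measurable circle_measure" for k
    by (intro borel_measurable_circle continuous_intros)+
  have "(\<lambda>k. \<integral>z. norm (poly q' (complex_of_real (radius k) * z)) powr s \<partial>circle_measure)
     \<longlonglongrightarrow> (\<integral>z. norm (poly q' z) powr s \<partial>circle_measure)"
  proof (rule integral_dominated_convergence)
    show "AE z in circle_measure. (\<lambda>k. norm (poly q' (complex_of_real (radius k) * z)) powr s) \<longlonglongrightarrow> norm (poly q' z) powr s"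
    proof (rule AE_I2)
      fix z
      have "isCont (\<lambda>r. norm (poly q' (complex_of_real r * z))) 1" by (intro continuous_intros)
      then have "(\<lambda>k. norm (poly q' (complex_of_real (radius k) * z))) \<longlonglongrightarrow> norm (poly q' (complex_of_real 1 * z))"
        by (rule isCont_tendsto_compose[OF _ radius(3)])
      then show "(\<lambda>k. norm (poly q' (complex_of_real (radius k) * z)) powr s) \<longlonglongrightarrow> norm (poly q' z) powr s"
        using s by (intro tendsto_powr' tendsto_const) auto
    qed
    show "AE z in circle_measure. norm (norm (poly q' (complex_of_real (radius k) * z)) powr s) \<le> B powr s" for k
    proof (rule AE_I2)
      fix z assume "z \<in> space circle_measure"
      then have "norm (poly q' (complex_of_real (radius k) * z)) \<le> B"
        using radius(1,2)[of k] by (intro B) (auto simp: norm_mult)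
      then show "norm (norm (poly q' (complex_of_real (radius k) * z)) powr s) \<le> B powr s"
        using s by (auto intro!: powr_mono2)
    qed
  qed auto
  then have "norm (poly q' 0) powr s \<le> (\<integral>z. norm (poly q' z) powr s \<partial>circle_measure)"
    by (rule LIMSEQ_le_const) (intro exI allI impI le)
  also have "\<dots> = (\<integral>z. norm (poly q z) powr s \<partial>circle_measure)"
    by (rule Bochner_Integration.integral_cong) (simp_all add: bspec[OF q'_1])
  finally show ?thesis
    using powr_mono2[OF less_imp_le[OF s] norm_ge_zero q'_0] by (rule order_trans[rotated])
qed simp

text \<open>After scaling to x + y = 1 this is t \<le> t^s on [0, 1].\<close>

lemma powr_add_le_real:
  fixes x y s :: real
  assumes "0 < s" "s \<le> 1" "0 \<le> x" "0 \<le> y"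
  shows "(x + y) powr s \<le> x powr s + y powr s"
proof (cases "x + y = 0")
  case False
  then have pos: "x + y > 0" using assms by simp
  have *: "t \<le> t powr s" if "0 \<le> t" "t \<le> 1" for t :: real
    using powr_mono'[of s 1 t] assms that by simp
  have "1 = x / (x + y) + y / (x + y)" using False by (simp flip: add_divide_distrib)
  also have "\<dots> \<le> (x / (x + y)) powr s + (y / (x + y)) powr s"
    using assms pos by (intro add_mono *) auto
  also have "\<dots> = (x powr s + y powr s) / (x + y) powr s"
    using assms pos by (simp add: powr_divide add_divide_distrib)
  finally show ?thesis using pos by (simp add: field_simps)
qed (use assms in auto)

lemma norm_add_powr_le:
  fixes a b :: complex
  assumes "0 < s" "s \<le> 1"
  shows "norm (a + b) powr s \<le> norm a powr s + norm b powr s"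
proof -
  have "norm (a + b) powr s \<le> (norm a + norm b) powr s"
    using assms by (intro powr_mono2 norm_triangle_ineq) auto
  also have "\<dots> \<le> norm a powr s + norm b powr s"
    using assms by (intro powr_add_le_real) auto
  finally show ?thesis .
qed

lemma norm_diff_powr_le:
  fixes a b :: complex
  assumes "0 < s" "s \<le> 1"
  shows "norm (a - b) powr s \<le> norm a powr s + norm b powr s"
  using norm_add_powr_le[OF assms, of a "-b"] by simp

lemma bounded_hardy_norm_powr_integral_le:
  assumes f: "bounded_hardy f" and s: "0 < s" "s < 1"
  shows "norm (\<integral>z. f z \<partial>circle_measure) powr s \<le> (\<integral>z. norm (f z) powr s \<partial>circle_measure)"
proof (rule field_le_epsilon)
  fix e :: real assume e: "e > 0"
  \<comment> \<open>The L^1 error controls the difference of the means and enters as d^s, the L^s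
    error enters as d; both are to be at most e/2.\<close>
  define d where "d = min (e/2) ((e/2) powr (1/s))"
  have d: "d > 0" "d \<le> e/2" "d powr s \<le> e/2"
  proof -
    have "d powr s \<le> ((e/2) powr (1/s)) powr s" using e s by (intro powr_mono2) (auto simp: d_def)
    then show "d powr s \<le> e/2" using e s by (simp add: powr_powr)
  qed (use e in \<open>auto simp: d_def\<close>)
  obtain q where q: "(\<integral>z. norm (f z - poly q z) \<partial>circle_measure) < d"
    "(\<integral>z. norm (f z - poly q z) powr s \<partial>circle_measure) < d"
    using bounded_hardy_approx_poly[OF f, of s d] s d by auto
  have int: "integrable circle_measure f" "integrable circle_measure (poly q)"
     "integrable circle_measure (\<lambda>z. norm (f z) powr s)" "integrable circle_measure (\<lambda>z. norm (f z - poly q z) powr s)"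
     "integrable circle_measure (\<lambda>z. norm (poly q z) powr s)"
    using f s by (auto intro!: ess_bounded_integrable ess_bounded_integrable_powr ess_bounded_intros)
  have "norm ((\<integral>z. f z \<partial>circle_measure) - poly q 0) = norm (\<integral>z. f z - poly q z \<partial>circle_measure)"
    using int by (simp add: integral_poly_circle)
  also have "\<dots> \<le> (\<integral>z. norm (f z - poly q z) \<partial>circle_measure)" by (rule integral_norm_bound)
  finally have "norm ((\<integral>z. f z \<partial>circle_measure) - poly q 0) powr s \<le> d powr s"
    using q s by (intro powr_mono2) auto
  then have "norm (\<integral>z. f z \<partial>circle_measure) powr s \<le> norm (poly q 0) powr s + d powr s"
    using norm_add_powr_le[of s "poly q 0" "(\<integral>z. f z \<partial>circle_measure) - poly q 0"] s by simp
  also have "norm (poly q 0) powr s \<le> (\<integral>z. norm (poly q z) powr s \<partial>circle_measure)"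
    by (rule norm_powr_poly_0_le[OF s(1)])
  also have "\<dots> \<le> (\<integral>z. norm (f z) powr s + norm (f z - poly q z) powr s \<partial>circle_measure)"
  proof (rule integral_mono)
    show "norm (poly q z) powr s \<le> norm (f z) powr s + norm (f z - poly q z) powr s" for z
      using norm_diff_powr_le[of s "f z" "f z - poly q z"] s by simp
  qed (use int in auto)
  also have "\<dots> = (\<integral>z. norm (f z) powr s \<partial>circle_measure) + (\<integral>z. norm (f z - poly q z) powr s \<partial>circle_measure)"
    using int by simp
  finally show "norm (\<integral>z. f z \<partial>circle_measure) powr s \<le> (\<integral>z. norm (f z) powr s \<partial>circle_measure) + e"
    using q d by linarith
qed

section \<open>From analytic functions on the disc to their boundary values\<close>

text \<open>The dilates are analytic across the circle and have vanishing negative coefficients;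
  these pass to the radial limit by dominated convergence, with the bound on the disc as
  majorant.\<close>

lemma Hinf_circle_bounded_hardy:
  assumes "f \<in> Hinf_circle"
  shows "bounded_hardy f"
proof -
  obtain F where m: "f \<in> borel_measurable circle_measure" and F: "F holomorphic_on ball 0 1"
     "bounded (F ` ball 0 1)" "has_radial_limits F f"
    using assms by (auto simp: Hinf_circle_def)
  obtain B where B: "\<And>z. z \<in> ball 0 1 \<Longrightarrow> norm (F z) \<le> B"
    using F(2) unfolding bounded_iff by blast
  define G where "G = (\<lambda>k z. F (complex_of_real (radius k) * z))"
  have lim: "AE z in circle_measure. (\<lambda>k. G k z) \<longlonglongrightarrow> f z"
    using F(3) unfolding has_radial_limits_def G_def
    by eventually_elim (rule filterlim_compose[OF _ radius(4)])
  have GB: "norm (G k z) \<le> B" if "norm z = 1" for k z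
    unfolding G_def using radius(1,2)[of k] that by (intro B) (auto simp: norm_mult)
  have G: "bounded_hardy (G k)" for k
    unfolding G_def by (intro bounded_hardy_holomorphic holomorphic_on_dilate F radius)
  have "AE z in circle_measure. norm (f z) \<le> B"
    using lim AE_circle_norm
  proof eventually_elim
    case (elim z)
    then have "(\<lambda>k. norm (G k z)) \<longlonglongrightarrow> norm (f z)" by (intro tendsto_norm)
    then show ?case by (rule LIMSEQ_le_const2) (use GB elim in auto)
  qed
  then have "ess_bounded f" using m by (auto simp: ess_bounded_def)
  moreover have "(\<integral>z. z ^ n * f z \<partial>circle_measure) = 0" if "n \<ge> 1" for n
  proof -
    have "(\<lambda>k. \<integral>z. z ^ n * G k z \<partial>circle_measure) \<longlonglongrightarrow> (\<integral>z. z ^ n * f z \<partial>circle_measure)"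
    proof (rule integral_dominated_convergence[where w = "\<lambda>_. B"])
      show "AE z in circle_measure. (\<lambda>k. z ^ n * G k z) \<longlonglongrightarrow> z ^ n * f z"
        using lim by eventually_elim (intro tendsto_intros)
      show "AE z in circle_measure. norm (z ^ n * G k z) \<le> B" for k
        using GB by (intro AE_I2) (auto simp: norm_mult norm_power)
      show "(\<lambda>z. z ^ n * G k z) \<in> borel_measurable circle_measure" for k
        using G[of k] by (auto intro!: ess_bounded_measurable ess_bounded_intros)
    qed (use m in auto)
    then show ?thesis using bounded_hardyD[OF G that] by (simp add: LIMSEQ_const_iff)
  qed
  ultimately show ?thesis by (auto simp: bounded_hardy_def)
qed

text \<open>Mere boundedness of the p-th means does not let the limit pass under the integral of
  p-th powers. It does make the powers of exponent p/2 uniformly integrable, which explains the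
  exponent here.\<close>

lemma analytic_extension_value_le:
  assumes p: "0 < p" "p < 1" and f: "f \<in> Lp_circle p" and F: "analytic_extension p f F"
  shows "norm (F 0 - poly q 0) powr (p/2) \<le> (\<integral>z. norm (f z - poly q z) powr (p/2) \<partial>circle_measure)"
proof -
  define s where "s = p/2"
  have s: "0 < s" "s < p" "s < 1" using p by (auto simp: s_def)
  have hol: "F holomorphic_on ball 0 1" and rad: "has_radial_limits F f"
    using F by (auto simp: analytic_extension_def)
  obtain C where C: "\<And>r. 0 \<le> r \<Longrightarrow> r < 1 \<Longrightarrow> (\<integral>z. norm (F (complex_of_real r * z)) powr p \<partial>circle_measure) \<le> C"
    using F unfolding analytic_extension_def by (meson atLeastLessThan_iff)
  have [measurable]: "poly q \<in> borel_measurable circle_measure"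
    by (intro borel_measurable_circle continuous_intros)
  have fm [measurable]: "f \<in> borel_measurable circle_measure" and fi: "integrable circle_measure (\<lambda>z. norm (f z) powr p)"
    using f by (auto simp: Lp_circle_def)
  obtain B where B: "\<And>z. z \<in> cball 0 1 \<Longrightarrow> norm (poly q z) \<le> B"
  proof (rule poly_bounded_cball[of q])
    fix B assume "\<And>z. z \<in> cball 0 1 \<Longrightarrow> norm (poly q z) \<le> B"
    then show thesis by (rule that)
  qed
  define H where "H = (\<lambda>k z. F (complex_of_real (radius k) * z))"
  define Q where "Q = (\<lambda>k z. poly q (complex_of_real (radius k) * z))"
  have H: "bounded_hardy (H k)" for k
    unfolding H_def by (intro bounded_hardy_holomorphic holomorphic_on_dilate hol radius)
  have Q: "bounded_hardy (Q k)" for k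
    unfolding Q_def by (intro bounded_hardy_holomorphic holomorphic_on_dilate radius holomorphic_intros)
  have HQ: "bounded_hardy (\<lambda>z. H k z - Q k z)" for k
    using H Q by auto
  have [measurable]: "(\<lambda>z. H k z - Q k z) \<in> borel_measurable circle_measure" for k
    using HQ by (auto intro: ess_bounded_measurable)
  have int: "integrable circle_measure (\<lambda>z. norm (H k z) powr p)" "integrable circle_measure (\<lambda>z. norm (Q k z) powr p)"
     "integrable circle_measure (\<lambda>z. norm (H k z - Q k z) powr p)" "integrable circle_measure (\<lambda>z. norm (H k z - Q k z) powr s)" for k
    using H Q p s by (auto intro!: ess_bounded_integrable_powr ess_bounded_intros)
  define D where "D = C + B powr p"
  have means: "(\<integral>z. norm (H k z - Q k z) powr p \<partial>circle_measure) \<le> D" for k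
  proof -
    have "(\<integral>z. norm (H k z - Q k z) powr p \<partial>circle_measure) \<le> (\<integral>z. norm (H k z) powr p + norm (Q k z) powr p \<partial>circle_measure)"
      using int p norm_diff_powr_le[of p] by (intro integral_mono) auto
    also have "\<dots> = (\<integral>z. norm (H k z) powr p \<partial>circle_measure) + (\<integral>z. norm (Q k z) powr p \<partial>circle_measure)"
      using int by simp
    also have "(\<integral>z. norm (H k z) powr p \<partial>circle_measure) \<le> C"
      unfolding H_def using radius(1,2)[of k] by (intro C) auto
    also have "(\<integral>z. norm (Q k z) powr p \<partial>circle_measure) \<le> (\<integral>z. B powr p \<partial>circle_measure)"
    proof (rule integral_mono)
      fix z assume "z \<in> space circle_measure"
      then show "norm (Q k z) powr p \<le> B powr p"
        unfolding Q_def using radius(1,2)[of k] p by (intro powr_mono2 B) (auto simp: norm_mult)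
    qed (use int in auto)
    finally show ?thesis by (simp add: D_def)
  qed
  have lim: "AE z in circle_measure. (\<lambda>k. H k z - Q k z) \<longlonglongrightarrow> f z - poly q z"
    using rad unfolding has_radial_limits_def
  proof eventually_elim
    case (elim z)
    have "isCont (\<lambda>r. poly q (complex_of_real r * z)) 1" by (intro continuous_intros)
    then have "(\<lambda>k. Q k z) \<longlonglongrightarrow> poly q (complex_of_real 1 * z)"
      unfolding Q_def by (rule isCont_tendsto_compose[OF _ radius(3)])
    moreover have "(\<lambda>k. H k z) \<longlonglongrightarrow> f z"
      unfolding H_def by (rule filterlim_compose[OF elim radius(4)])
    ultimately show ?case by (auto intro: tendsto_diff)
  qed
  have ifq: "integrable circle_measure (\<lambda>z. norm (f z - poly q z) powr s)"
  proof (rule integrable_powr_le[OF s(1,2)])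
    show "integrable circle_measure (\<lambda>z. norm (f z - poly q z) powr p)"
    proof (rule Bochner_Integration.integrable_bound)
      show "integrable circle_measure (\<lambda>z. norm (f z) powr p + norm (poly q z) powr p)"
        using fi p by (auto intro!: ess_bounded_integrable_powr)
      show "AE z in circle_measure. norm (norm (f z - poly q z) powr p) \<le> norm (norm (f z) powr p + norm (poly q z) powr p)"
        using norm_diff_powr_le[of p] p by (intro AE_I2) auto
    qed auto
  qed auto
  \<comment> \<open>Truncated at M the integrand is bounded, so dominated convergence applies along
    the radii. The part cut off is at most D / M for every k, since x \<le> min x M + x^2 / M and
    x^2 is the p-th power.\<close>
  have trunc: "norm (F 0 - poly q 0) powr s \<le> (\<integral>z. norm (f z - poly q z) powr s \<partial>circle_measure) + D / M" if M: "M > 0" for M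
  proof -
    have int_min: "integrable circle_measure (\<lambda>z. min (norm (g z) powr s) M)" if "g \<in> borel_measurable circle_measure" for g :: "complex \<Rightarrow> complex"
      using that M by (intro circle.integrable_const_bound[where B = M] AE_I2) auto
    have "norm (F 0 - poly q 0) powr s \<le> (\<integral>z. min (norm (H k z - Q k z) powr s) M \<partial>circle_measure) + D / M" for k
    proof -
      have "(\<integral>z. H k z - Q k z \<partial>circle_measure) = H k 0 - Q k 0"
        unfolding H_def Q_def by (rule mean_value_circle) (intro holomorphic_on_diff holomorphic_on_dilate hol radius holomorphic_intros)
      then have "norm (F 0 - poly q 0) powr s \<le> (\<integral>z. norm (H k z - Q k z) powr s \<partial>circle_measure)"
        using bounded_hardy_norm_powr_integral_le[OF HQ s(1,3), of k] by (simp add: H_def Q_def)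
      also have "\<dots> \<le> (\<integral>z. min (norm (H k z - Q k z) powr s) M + norm (H k z - Q k z) powr p / M \<partial>circle_measure)"
      proof (rule integral_mono)
        fix z
        define x where "x = norm (H k z - Q k z) powr s"
        have "x ^ 2 = norm (H k z - Q k z) powr p"
          by (simp add: x_def s_def powr_powr flip: powr_numeral)
        moreover have "x \<le> min x M + x ^ 2 / M"
        proof (cases "x \<le> M")
          case False
          then have "x * M \<le> x * x" using M by (intro mult_left_mono) auto
          then have "x \<le> x ^ 2 / M" using M by (simp add: pos_le_divide_eq power2_eq_square)
          moreover have "min x M \<ge> 0" using False M by simp
          ultimately show ?thesis by linarith
        qed (use M in auto)
        ultimately show "norm (H k z - Q k z) powr s \<le> min (norm (H k z - Q k z) powr s) M + norm (H k z - Q k z) powr p / M"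
          by (simp add: x_def)
      qed (use int int_min in auto)
      also have "\<dots> = (\<integral>z. min (norm (H k z - Q k z) powr s) M \<partial>circle_measure) + (\<integral>z. norm (H k z - Q k z) powr p \<partial>circle_measure) / M"
        using int int_min by simp
      also have "(\<integral>z. norm (H k z - Q k z) powr p \<partial>circle_measure) / M \<le> D / M"
        using means M by (intro divide_right_mono) auto
      finally show ?thesis by simp
    qed
    moreover have "(\<lambda>k. (\<integral>z. min (norm (H k z - Q k z) powr s) M \<partial>circle_measure) + D / M)
       \<longlonglongrightarrow> (\<integral>z. min (norm (f z - poly q z) powr s) M \<partial>circle_measure) + D / M"
    proof (intro tendsto_add tendsto_const integral_dominated_convergence[where w = "\<lambda>_. M"])
      show "AE z in circle_measure. (\<lambda>k. min (norm (H k z - Q k z) powr s) M) \<longlonglongrightarrow> min (norm (f z - poly q z) powr s) M"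
        using lim
      proof eventually_elim
        case (elim z)
        then have "(\<lambda>k. norm (H k z - Q k z) powr s) \<longlonglongrightarrow> norm (f z - poly q z) powr s"
          using s by (intro tendsto_powr' tendsto_norm tendsto_const) auto
        then show ?case by (intro tendsto_min tendsto_const)
      qed
    qed (use M in auto)
    ultimately have "norm (F 0 - poly q 0) powr s \<le> (\<integral>z. min (norm (f z - poly q z) powr s) M \<partial>circle_measure) + D / M"
      by (intro LIMSEQ_le_const) auto
    also have "(\<integral>z. min (norm (f z - poly q z) powr s) M \<partial>circle_measure) \<le> (\<integral>z. norm (f z - poly q z) powr s \<partial>circle_measure)"
      using ifq int_min by (intro integral_mono) auto
    finally show ?thesis by simp
  qed
  show ?thesis unfolding s_def[symmetric]
  proof (rule field_le_epsilon)
    fix e :: real assume e: "e > 0"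
    \<comment> \<open>The truncation level M = (|D| + 1) / e is positive whatever the sign of
      D.\<close>
    have "D / ((\<bar>D\<bar> + 1) / e) \<le> e"
      using e by (simp add: field_simps) (use e in \<open>auto simp: abs_if algebra_simps intro: add_increasing\<close>)
    then show "norm (F 0 - poly q 0) powr s \<le> (\<integral>z. norm (f z - poly q z) powr s \<partial>circle_measure) + e"
      using trunc[of "(\<bar>D\<bar> + 1) / e"] e by (simp add: add_nonneg_pos)
  qed
qed

section \<open>The spaces \<open>L\<^sup>p\<close> and \<open>H\<^sup>p\<close> for \<open>p \<le> 1\<close>\<close>

text \<open>The s-th power of the quasi-norm. For s \<le> 1 it is subadditive, so approximation
  arguments can use it like a norm.\<close>

definition powr_integral :: "real \<Rightarrow> (complex \<Rightarrow> complex) \<Rightarrow> real" where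
  "powr_integral s f = (\<integral>z. norm (f z) powr s \<partial>circle_measure)"

lemma powr_integral_nonneg [simp]: "powr_integral s f \<ge> 0"
  by (simp add: powr_integral_def)

lemma powr_integral_cong_AE:
  assumes "AE z in circle_measure. f z = g z" "f \<in> borel_measurable circle_measure" "g \<in> borel_measurable circle_measure"
  shows "powr_integral s f = powr_integral s g"
  unfolding powr_integral_def using assms by (intro integral_cong_AE) auto

lemma powr_integral_cmult: "powr_integral s (\<lambda>z. c * f z) = norm c powr s * powr_integral s f"
  by (simp add: powr_integral_def norm_mult powr_mult)

lemma Lp_circle_cmult:
  assumes "f \<in> Lp_circle p"
  shows "(\<lambda>z. c * f z) \<in> Lp_circle p"
  using assms by (auto simp: Lp_circle_def norm_mult powr_mult)

lemma Lp_circle_ess_bounded: "ess_bounded f \<Longrightarrow> 0 < p \<Longrightarrow> f \<in> Lp_circle p"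
  by (auto simp: Lp_circle_def intro: ess_bounded_measurable ess_bounded_integrable_powr)

lemma Lp_circle_add:
  assumes p: "0 < p" "p \<le> 1" and f: "f \<in> Lp_circle p" and g: "g \<in> Lp_circle p"
  shows "(\<lambda>z. f z + g z) \<in> Lp_circle p"
    and "powr_integral p (\<lambda>z. f z + g z) \<le> powr_integral p f + powr_integral p g"
proof -
  have [measurable]: "f \<in> borel_measurable circle_measure" "g \<in> borel_measurable circle_measure"
    and fi: "integrable circle_measure (\<lambda>z. norm (f z) powr p)"
    and gi: "integrable circle_measure (\<lambda>z. norm (g z) powr p)"
    using f g by (auto simp: Lp_circle_def)
  have i: "integrable circle_measure (\<lambda>z. norm (f z + g z) powr p)"
  proof (rule Bochner_Integration.integrable_bound)
    show "integrable circle_measure (\<lambda>z. norm (f z) powr p + norm (g z) powr p)"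
      using fi gi by simp
    show "AE z in circle_measure. norm (norm (f z + g z) powr p) \<le> norm (norm (f z) powr p + norm (g z) powr p)"
      using norm_add_powr_le[OF p] by (intro AE_I2) simp
  qed measurable
  then show "(\<lambda>z. f z + g z) \<in> Lp_circle p" by (simp add: Lp_circle_def)
  have "powr_integral p (\<lambda>z. f z + g z) \<le> (\<integral>z. norm (f z) powr p + norm (g z) powr p \<partial>circle_measure)"
    unfolding powr_integral_def by (rule integral_mono) (use i fi gi norm_add_powr_le[OF p] in auto)
  then show "powr_integral p (\<lambda>z. f z + g z) \<le> powr_integral p f + powr_integral p g"
    using fi gi by (simp add: powr_integral_def)
qed

lemma Lp_circle_diff:
  assumes p: "0 < p" "p \<le> 1" and f: "f \<in> Lp_circle p" and g: "g \<in> Lp_circle p"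
  shows "(\<lambda>z. f z - g z) \<in> Lp_circle p"
    and "powr_integral p (\<lambda>z. f z - g z) \<le> powr_integral p f + powr_integral p g"
  using Lp_circle_add[OF p f Lp_circle_cmult[OF g, of "-1"]] powr_integral_cmult[of p "-1" g] by simp_all

lemma Lp_circle_antimono:
  assumes "0 < s" "s < p" "f \<in> Lp_circle p"
  shows "f \<in> Lp_circle s"
  using assms integrable_powr_le[of s p f] by (simp add: Lp_circle_def)

lemma Lp_circle_small:
  assumes "0 < a" "a < b" "0 < e"
  shows "\<exists>d>0. \<forall>g\<in>Lp_circle b. powr_integral b g < d \<longrightarrow> powr_integral a g < e"
proof (rule integral_powr_small[OF assms])
  fix d :: real assume d: "d > 0" "\<And>g :: complex \<Rightarrow> complex. g \<in> borel_measurable circle_measure \<Longrightarrow>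
    integrable circle_measure (\<lambda>z. norm (g z) powr b) \<Longrightarrow>
    (\<integral>z. norm (g z) powr b \<partial>circle_measure) < d \<Longrightarrow> (\<integral>z. norm (g z) powr a \<partial>circle_measure) < e"
  have "\<forall>g\<in>Lp_circle b. powr_integral b g < d \<longrightarrow> powr_integral a g < e"
    using d(2) by (auto simp: Lp_circle_def powr_integral_def)
  with d(1) show ?thesis by blast
qed

lemma AE_eq_0_if_powr_integral:
  assumes "f \<in> Lp_circle s" and "\<And>e. e > 0 \<Longrightarrow> powr_integral s f \<le> e"
  shows "AE z in circle_measure. f z = 0"
proof -
  have "powr_integral s f \<le> 0"
    using assms(2) by (rule field_le_epsilon[of _ 0, simplified])
  then have "(\<integral>z. norm (f z) powr s \<partial>circle_measure) = 0"
    by (metis antisym powr_integral_def powr_integral_nonneg)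
  then have "AE z in circle_measure. norm (f z) powr s = 0"
    using assms(1) by (subst (asm) integral_nonneg_eq_0_iff_AE) (auto simp: Lp_circle_def)
  then show ?thesis by eventually_elim simp
qed

lemma Lp_norm_eq: "Lp_norm p f = powr_integral p f powr (1 / p)"
  by (simp add: Lp_norm_def powr_integral_def)

lemma Lp_norm_less_iff:
  assumes "p > 0" "e > 0"
  shows "Lp_norm p f < e \<longleftrightarrow> powr_integral p f < e powr p"
proof -
  have "e = (e powr p) powr (1 / p)" using assms by (simp add: powr_powr)
  then have "Lp_norm p f < e \<longleftrightarrow> powr_integral p f powr (1 / p) < (e powr p) powr (1 / p)"
    by (simp add: Lp_norm_eq)
  also have "\<dots> \<longleftrightarrow> powr_integral p f < e powr p"
    using assms powr_less_mono2[of "1/p" "powr_integral p f" "e powr p"]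
      powr_mono2[of "1/p" "e powr p" "powr_integral p f"] by (force simp: not_le[symmetric])
  finally show ?thesis .
qed

lemma Hp_circle_iff:
  assumes p: "p > 0"
  shows "f \<in> Hp_circle p \<longleftrightarrow> f \<in> Lp_circle p \<and> (\<forall>e>0. \<exists>q. powr_integral p (\<lambda>z. f z - poly q z) < e)"
proof -
  have "(\<forall>e>0. \<exists>q. powr_integral p (\<lambda>z. f z - poly q z) < e) \<longleftrightarrow>
    (\<forall>e>0. \<exists>q :: complex poly. Lp_norm p (\<lambda>z. f z - poly q z) < e)" (is "?l \<longleftrightarrow> ?r")
  proof
    assume ?l
    then show ?r using p by (simp add: Lp_norm_less_iff)
  next
    assume r: ?r
    show ?l
    proof (intro allI impI)
      fix e :: real assume e: "e > 0"
      then obtain q :: "complex poly" where "Lp_norm p (\<lambda>z. f z - poly q z) < e powr (1 / p)"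
        using r by fastforce
      then have "powr_integral p (\<lambda>z. f z - poly q z) < (e powr (1/p)) powr p"
        using p e by (subst (asm) Lp_norm_less_iff) auto
      then show "\<exists>q. powr_integral p (\<lambda>z. f z - poly q z) < e" using p e by (auto simp: powr_powr)
    qed
  qed
  then show ?thesis by (simp add: Hp_circle_def)
qed

lemma Hp_circle_Lp: "f \<in> Hp_circle p \<Longrightarrow> f \<in> Lp_circle p"
  by (simp add: Hp_circle_def)

lemma Hp_circle_measurable [measurable_dest]: "f \<in> Hp_circle p \<Longrightarrow> f \<in> borel_measurable circle_measure"
  by (simp add: Hp_circle_def Lp_circle_def)

lemma bounded_hardy_Hp:
  assumes f: "bounded_hardy f" and p: "0 < p" "p \<le> 1"
  shows "f \<in> Hp_circle p"
proof -
  have "\<exists>q. powr_integral p (\<lambda>z. f z - poly q z) < e" if "e > 0" for e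
    using bounded_hardy_approx_poly[OF f p that] unfolding powr_integral_def by metis
  then show ?thesis
    using f p by (auto simp: Hp_circle_iff intro: Lp_circle_ess_bounded)
qed

lemma Hp_circle_add:
  assumes p: "0 < p" "p \<le> 1" and f: "f \<in> Hp_circle p" and g: "g \<in> Hp_circle p"
  shows "(\<lambda>z. f z + g z) \<in> Hp_circle p"
proof -
  have "\<exists>q. powr_integral p (\<lambda>z. f z + g z - poly q z) < e" if "e > 0" for e
  proof -
    have "\<exists>q. powr_integral p (\<lambda>z. f z - poly q z) < e/2" "\<exists>q. powr_integral p (\<lambda>z. g z - poly q z) < e/2"
      using f g half_gt_zero[OF that] Hp_circle_iff[OF p(1)] by blast+
    then obtain q r where q: "powr_integral p (\<lambda>z. f z - poly q z) < e/2"
      and r: "powr_integral p (\<lambda>z. g z - poly r z) < e/2" by blast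
    have "(\<lambda>z. f z - poly q z) \<in> Lp_circle p" "(\<lambda>z. g z - poly r z) \<in> Lp_circle p"
      using p f g by (auto intro!: Lp_circle_diff(1) intro: Hp_circle_Lp Lp_circle_ess_bounded)
    then have "powr_integral p (\<lambda>z. (f z - poly q z) + (g z - poly r z))
       \<le> powr_integral p (\<lambda>z. f z - poly q z) + powr_integral p (\<lambda>z. g z - poly r z)"
      by (rule Lp_circle_add(2)[OF p])
    also have "(\<lambda>z. (f z - poly q z) + (g z - poly r z)) = (\<lambda>z. f z + g z - poly (q + r) z)"
      by (simp add: fun_eq_iff)
    finally show ?thesis using q r by (intro exI[of _ "q + r"]) linarith
  qed
  then show ?thesis
    using f g p Lp_circle_add(1)[OF p Hp_circle_Lp[OF f] Hp_circle_Lp[OF g]] by (simp add: Hp_circle_iff)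
qed

lemma Hp_circle_cmult:
  assumes p: "0 < p" and f: "f \<in> Hp_circle p"
  shows "(\<lambda>z. c * f z) \<in> Hp_circle p"
proof -
  have "\<exists>q. powr_integral p (\<lambda>z. c * f z - poly q z) < e" if "e > 0" for e
  proof -
    have pos: "norm c powr p + 1 > 0" by (simp add: add_nonneg_pos)
    then have "\<exists>q. powr_integral p (\<lambda>z. f z - poly q z) < e / (norm c powr p + 1)"
      using f p that by (simp add: Hp_circle_iff)
    then obtain q where q: "powr_integral p (\<lambda>z. f z - poly q z) < e / (norm c powr p + 1)" by blast
    have "powr_integral p (\<lambda>z. c * f z - poly (smult c q) z) = powr_integral p (\<lambda>z. c * (f z - poly q z))"
      by (simp add: algebra_simps)
    also have "\<dots> \<le> (norm c powr p + 1) * powr_integral p (\<lambda>z. f z - poly q z)"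
      by (simp add: powr_integral_cmult mult_right_mono)
    also have "\<dots> < e" using q pos by (simp add: pos_less_divide_eq mult.commute)
    finally show ?thesis by blast
  qed
  then show ?thesis
    using f p Lp_circle_cmult[OF Hp_circle_Lp[OF f]] by (simp add: Hp_circle_iff)
qed

lemma Hp_circle_diff:
  assumes p: "0 < p" "p \<le> 1" and f: "f \<in> Hp_circle p" and g: "g \<in> Hp_circle p"
  shows "(\<lambda>z. f z - g z) \<in> Hp_circle p"
  using Hp_circle_add[OF p f Hp_circle_cmult[OF p(1) g, of "-1"]] by simp

lemma contractive_projection_contracts:
  assumes p: "0 < p" "p \<le> 1" and P: "contractive_projection p P" and f: "f \<in> Hp_circle p"
  shows "powr_integral p (P f) \<le> powr_integral p f"
proof -
  have lin: "Hp_linear p P" and op: "Hp_opnorm p P = 1" and "Hp_bounded p P"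
    using P by (auto simp: contractive_projection_def)
  then obtain C where C: "\<And>f. f \<in> Hp_circle p \<Longrightarrow> Lp_norm p (P f) \<le> C * Lp_norm p f"
    unfolding Hp_bounded_def by blast
  have Pf: "P g \<in> Hp_circle p" if "g \<in> Hp_circle p" for g using lin that by (simp add: Hp_linear_def)
  have "Lp_norm p (P f) \<le> Lp_norm p f"
  \<comment> \<open>The operator norm is a supremum over the unit sphere and says nothing about
    functions of norm 0; boundedness of P covers those, and also bounds the set whose supremum is
    taken.\<close>
  proof (cases "Lp_norm p f = 0")
    case True
    then show ?thesis using C[OF f] by simp
  next
    case False
    define N where "N = Lp_norm p f"
    have N: "N > 0" using False by (simp add: N_def Lp_norm_eq less_le)
    define g where "g = (\<lambda>z. of_real (1 / N) * f z)"
    have g: "g \<in> Hp_circle p" unfolding g_def by (rule Hp_circle_cmult[OF p(1) f])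
    have sc: "Lp_norm p (\<lambda>z. of_real (1 / N) * h z) = Lp_norm p h / N" for h
    proof -
      have "powr_integral p (\<lambda>z. of_real (1 / N) * h z) = (1 / N) powr p * powr_integral p h"
        by (subst powr_integral_cmult) (use N in \<open>simp add: norm_divide\<close>)
      then show ?thesis using N p by (simp add: Lp_norm_eq powr_mult powr_powr)
    qed
    have "Lp_norm p g = N / N" unfolding g_def by (rule sc[of f, folded N_def])
    then have g1: "Lp_norm p g = 1" using N by simp
    have "AE z in circle_measure. P g z = of_real (1 / N) * P f z"
      using lin f unfolding Hp_linear_def g_def by blast
    then have "Lp_norm p (P g) = Lp_norm p (\<lambda>z. of_real (1 / N) * P f z)"
      unfolding Lp_norm_eq by (subst powr_integral_cong_AE) (use Pf[OF f] Pf[OF g] in auto)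
    then have "Lp_norm p (P f) / N = Lp_norm p (P g)" by (simp only: sc)
    also have "\<dots> \<le> Hp_opnorm p P"
      unfolding Hp_opnorm_def
    proof (rule cSUP_upper)
      show "bdd_above ((\<lambda>f. Lp_norm p (P f)) ` {f \<in> Hp_circle p. Lp_norm p f = 1})"
        using C by (intro bdd_aboveI2[where M = C]) force
    qed (use g g1 in auto)
    finally show ?thesis using op N by (simp add: N_def)
  qed
  then show ?thesis
    using p powr_less_mono2[of "1/p" "powr_integral p f" "powr_integral p (P f)"] unfolding Lp_norm_eq
    by force
qed

section \<open>Variation of the quasi-norm\<close>

locale unital_contractive_projection =
  fixes p :: real and P :: "(complex \<Rightarrow> complex) \<Rightarrow> complex \<Rightarrow> complex"
  assumes p: "0 < p" "p < 1"
    and P: "contractive_projection p P"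
    and P_one: "AE z in circle_measure. P (\<lambda>_. 1) z = 1"
    and P_monom: "\<And>n::nat. n \<ge> 1 \<Longrightarrow> P (\<lambda>z. z ^ n) \<in> Hinf_circle"
begin

lemma bounded_hardy_Hp_p: "bounded_hardy f \<Longrightarrow> f \<in> Hp_circle p"
  using bounded_hardy_Hp p by simp

lemma P_Hp: "f \<in> Hp_circle p \<Longrightarrow> P f \<in> Hp_circle p"
  using P by (auto simp: contractive_projection_def Hp_linear_def)

lemma P_add: "f \<in> Hp_circle p \<Longrightarrow> g \<in> Hp_circle p \<Longrightarrow>
    AE z in circle_measure. P (\<lambda>w. f w + g w) z = P f z + P g z"
  using P by (auto simp: contractive_projection_def Hp_linear_def)

lemma P_cmult: "f \<in> Hp_circle p \<Longrightarrow> AE z in circle_measure. P (\<lambda>w. c * f w) z = c * P f z"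
  using P by (auto simp: contractive_projection_def Hp_linear_def)

lemma P_diff:
  assumes f: "f \<in> Hp_circle p" and g: "g \<in> Hp_circle p"
  shows "AE z in circle_measure. P (\<lambda>w. f w - g w) z = P f z - P g z"
  using P_add[OF f Hp_circle_cmult[OF p(1) g, of "-1"]] P_cmult[OF g, of "-1"]
  by eventually_elim simp

lemma P_idem: "f \<in> Hp_circle p \<Longrightarrow> AE z in circle_measure. P (P f) z = P f z"
  using P by (auto simp: contractive_projection_def)

lemma P_contracts: "f \<in> Hp_circle p \<Longrightarrow> powr_integral p (P f) \<le> powr_integral p f"
  using contractive_projection_contracts P p by simp

text \<open>\<open>fixed\<close> and \<open>killed\<close> are the bounded parts of the range and of
  the kernel of P. Boundedness makes all the integrals of products below finite, which membership in
  H^p alone would not.\<close>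

definition fixed :: "(complex \<Rightarrow> complex) \<Rightarrow> bool" where
  "fixed h \<longleftrightarrow> bounded_hardy h \<and> (AE z in circle_measure. P h z = h z)"

definition killed :: "(complex \<Rightarrow> complex) \<Rightarrow> bool" where
  "killed k \<longleftrightarrow> bounded_hardy k \<and> (AE z in circle_measure. P k z = 0)"

lemma fixed_hardy: "fixed h \<Longrightarrow> bounded_hardy h" and killed_hardy: "killed h \<Longrightarrow> bounded_hardy h"
  by (simp_all add: fixed_def killed_def)

lemma fixed_add:
  assumes "fixed g" "fixed h"
  shows "fixed (\<lambda>z. g z + h z)"
proof -
  have "AE z in circle_measure. P (\<lambda>z. g z + h z) z = P g z + P h z"
    using assms by (intro P_add bounded_hardy_Hp_p fixed_hardy)
  moreover have "AE z in circle_measure. P g z = g z" "AE z in circle_measure. P h z = h z"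
    using assms by (simp_all add: fixed_def)
  ultimately have "AE z in circle_measure. P (\<lambda>z. g z + h z) z = g z + h z"
    by eventually_elim simp
  then show ?thesis using assms by (auto simp: fixed_def)
qed

lemma fixed_cmult:
  assumes "fixed h"
  shows "fixed (\<lambda>z. c * h z)"
proof -
  have "AE z in circle_measure. P (\<lambda>z. c * h z) z = c * P h z"
    using assms by (intro P_cmult bounded_hardy_Hp_p fixed_hardy)
  moreover have "AE z in circle_measure. P h z = h z"
    using assms by (simp add: fixed_def)
  ultimately have "AE z in circle_measure. P (\<lambda>z. c * h z) z = c * h z"
    by eventually_elim simp
  then show ?thesis using assms by (auto simp: fixed_def)
qed

lemma fixed_one: "fixed (\<lambda>_. 1)"
  using P_one by (simp add: fixed_def)

lemma killed_add:
  assumes "killed g" "killed h"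
  shows "killed (\<lambda>z. g z + h z)"
proof -
  have "AE z in circle_measure. P (\<lambda>z. g z + h z) z = P g z + P h z"
    using assms by (intro P_add bounded_hardy_Hp_p killed_hardy)
  moreover have "AE z in circle_measure. P g z = 0" "AE z in circle_measure. P h z = 0"
    using assms by (simp_all add: killed_def)
  ultimately have "AE z in circle_measure. P (\<lambda>z. g z + h z) z = 0"
    by eventually_elim simp
  then show ?thesis using assms by (auto simp: killed_def)
qed

lemma killed_cmult:
  assumes "killed h"
  shows "killed (\<lambda>z. c * h z)"
proof -
  have "AE z in circle_measure. P (\<lambda>z. c * h z) z = c * P h z"
    using assms by (intro P_cmult bounded_hardy_Hp_p killed_hardy)
  moreover have "AE z in circle_measure. P h z = 0"
    using assms by (simp add: killed_def)
  ultimately have "AE z in circle_measure. P (\<lambda>z. c * h z) z = 0"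
    by eventually_elim simp
  then show ?thesis using assms by (auto simp: killed_def)
qed

text \<open>P maps \<open>g + \<delta> * k\<close> to \<open>g\<close>, so contractivity says that a
  range function has minimal quasi-norm in its coset modulo the kernel.\<close>

lemma powr_integral_le_add_killed:
  assumes g: "fixed g" and k: "killed k"
  shows "powr_integral p g \<le> powr_integral p (\<lambda>z. g z + \<delta> * k z)"
proof -
  have dk: "killed (\<lambda>z. \<delta> * k z)" by (rule killed_cmult[OF k])
  have Hp: "g \<in> Hp_circle p" "(\<lambda>z. \<delta> * k z) \<in> Hp_circle p"
    using g dk by (auto intro: bounded_hardy_Hp_p fixed_hardy killed_hardy)
  then have Hp': "(\<lambda>z. g z + \<delta> * k z) \<in> Hp_circle p" using p by (intro Hp_circle_add) auto
  have "AE z in circle_measure. P g z = g z" "AE z in circle_measure. P (\<lambda>z. \<delta> * k z) z = 0"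
    using g dk by (simp_all add: fixed_def killed_def)
  then have "AE z in circle_measure. g z = P (\<lambda>z. g z + \<delta> * k z) z"
    using P_add[OF Hp] by eventually_elim simp
  then have "powr_integral p g = powr_integral p (P (\<lambda>z. g z + \<delta> * k z))"
    by (rule powr_integral_cong_AE) (use P_Hp[OF Hp'] Hp in auto)
  also have "\<dots> \<le> powr_integral p (\<lambda>z. g z + \<delta> * k z)" by (rule P_contracts[OF Hp'])
  finally show ?thesis .
qed

text \<open>By minimality Re (\<delta> X) + |\<delta>|^2 Y / 2 \<ge> 0 for all complex \<delta>,
  where X is the integral in question, and this forces X = 0. The lower bound c keeps k / g bounded,
  hence Y finite.\<close>

lemma first_variation:
  assumes g: "fixed g" and k: "killed k" and c: "c > 0" "AE z in circle_measure. c \<le> norm (g z)"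
  shows "(\<integral>z. of_real (norm (g z) powr p) / g z * k z \<partial>circle_measure) = 0"
proof -
  define u where "u = (\<lambda>z. of_real (norm (g z) powr p) / g z * k z)"
  define v where "v = (\<lambda>z. norm (g z) powr p * norm (k z / g z) ^ 2)"
  have eb: "ess_bounded g" "ess_bounded k"
    using g k by (auto dest: fixed_hardy killed_hardy)
  have [measurable]: "g \<in> borel_measurable circle_measure" "k \<in> borel_measurable circle_measure"
    using eb by auto
  obtain G where G: "G > 0" "AE z in circle_measure. norm (g z) \<le> G" using eb by (auto elim: ess_boundedE)
  obtain K where K: "K > 0" "AE z in circle_measure. norm (k z) \<le> K" using eb by (auto elim: ess_boundedE)
  have kg: "AE z in circle_measure. norm (k z / g z) \<le> K / c \<and> norm (g z) powr p \<le> G powr p"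
    using c(2) G(2) K(2)
  proof eventually_elim
    case (elim z)
    then show ?case using c(1) K(1) p by (auto simp: norm_divide intro!: frac_le powr_mono2)
  qed
  have "ess_bounded u"
  proof (rule ess_boundedI)
    show "AE z in circle_measure. norm (u z) \<le> G powr p * (K / c)"
      using kg
    proof eventually_elim
      case (elim z)
      have "norm (u z) = norm (g z) powr p * norm (k z / g z)" by (simp add: u_def norm_mult norm_divide)
      also have "\<dots> \<le> G powr p * (K / c)" using elim by (intro mult_mono) auto
      finally show ?case .
    qed
  qed (simp add: u_def)
  then have ui: "integrable circle_measure u" by (rule ess_bounded_integrable)
  have vi: "integrable circle_measure v"
  proof (rule circle.integrable_const_bound)
    show "AE z in circle_measure. norm (v z) \<le> G powr p * (K / c) ^ 2"
      using kg
    proof eventually_elim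
      case (elim z)
      have "norm (v z) = norm (g z) powr p * norm (k z / g z) ^ 2" by (simp add: v_def)
      also have "\<dots> \<le> G powr p * (K / c) ^ 2" using elim by (intro mult_mono power_mono) auto
      finally show ?case .
    qed
  qed (simp add: v_def)
  have gi: "integrable circle_measure (\<lambda>z. norm (g z) powr p)"
    using eb p by (intro ess_bounded_integrable_powr)
  define X where "X = (\<integral>z. u z \<partial>circle_measure)"
  define Y where "Y = (\<integral>z. v z \<partial>circle_measure)"
  have Y: "Y \<ge> 0" unfolding Y_def v_def by (intro integral_nonneg_AE AE_I2) auto
  have var: "0 \<le> Re (\<delta> * X) + norm \<delta> ^ 2 * Y / 2" for \<delta>
  proof -
    have "powr_integral p g \<le> powr_integral p (\<lambda>z. g z + \<delta> * k z)"
      by (rule powr_integral_le_add_killed[OF g k])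
    also have "\<dots> \<le> (\<integral>z. norm (g z) powr p + p * Re (\<delta> * u z) + p / 2 * norm \<delta> ^ 2 * v z \<partial>circle_measure)"
      unfolding powr_integral_def
    proof (rule integral_mono_AE)
      show "integrable circle_measure (\<lambda>z. norm (g z + \<delta> * k z) powr p)"
        using eb p by (auto intro!: ess_bounded_integrable_powr ess_bounded_intros)
      show "integrable circle_measure (\<lambda>z. norm (g z) powr p + p * Re (\<delta> * u z) + p / 2 * norm \<delta> ^ 2 * v z)"
        using gi ui vi by auto
      show "AE z in circle_measure. norm (g z + \<delta> * k z) powr p \<le> norm (g z) powr p + p * Re (\<delta> * u z) + p / 2 * norm \<delta> ^ 2 * v z"
        using c(2)
      proof eventually_elim
        case (elim z)
        define w where "w = \<delta> * k z / g z"
        have g0: "g z \<noteq> 0" using elim c by auto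
        then have "g z + \<delta> * k z = g z * (1 + w)" by (simp add: w_def field_simps)
        then have "norm (g z + \<delta> * k z) powr p = norm (g z) powr p * norm (1 + w) powr p"
          by (simp add: norm_mult powr_mult)
        also have "\<dots> \<le> norm (g z) powr p * (1 + p * Re w + p / 2 * norm w ^ 2)"
          using p by (intro mult_left_mono norm_one_plus_powr_le) auto
        also have "\<dots> = norm (g z) powr p + p * (norm (g z) powr p * Re w) + p / 2 * (norm (g z) powr p * norm w ^ 2)"
          by (simp add: algebra_simps)
        also have "norm (g z) powr p * Re w = Re (\<delta> * u z)"
        proof -
          have "\<delta> * u z = of_real (norm (g z) powr p) * w" by (simp add: u_def w_def)
          then show ?thesis by simp
        qed
        also have "norm (g z) powr p * norm w ^ 2 = norm \<delta> ^ 2 * v z"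
          by (simp add: w_def v_def norm_mult norm_divide power_mult_distrib power_divide)
        finally show ?case by (simp add: mult.assoc)
      qed
    qed
    also have "\<dots> = powr_integral p g + p * Re (\<delta> * X) + p / 2 * norm \<delta> ^ 2 * Y"
    proof -
      have "integrable circle_measure (\<lambda>z. \<delta> * u z)" using ui by simp
      then have "(\<integral>z. Re (\<delta> * u z) \<partial>circle_measure) = Re (\<delta> * X)" "integrable circle_measure (\<lambda>z. Re (\<delta> * u z))"
        using ui by (simp_all only: integral_Re integrable_Re X_def integral_mult_right_zero)
      then show ?thesis
        using gi vi by (simp add: powr_integral_def Y_def)
    qed
    finally have "0 \<le> p * (Re (\<delta> * X) + norm \<delta> ^ 2 * Y / 2)" by (simp add: algebra_simps)
    then show ?thesis using p by (simp add: zero_le_mult_iff)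
  qed
  \<comment> \<open>For \<delta> = - t cnj X the linear term is -t |X|^2, and t Y \<le> 1 keeps the
    quadratic term at half of that size or less.\<close>
  define t where "t = 1 / (Y + 1)"
  have t: "t > 0" "t * Y \<le> 1" using Y by (auto simp: t_def field_simps)
  have "(- of_real t * cnj X) * X = of_real (- (t * norm X ^ 2))"
    using complex_norm_square[of X] by (simp add: mult_ac)
  then have re: "Re ((- of_real t * cnj X) * X) = - (t * norm X ^ 2)"
    by (simp only: Re_complex_of_real)
  have nm: "norm (- of_real t * cnj X) = t * norm X" using t by (simp add: norm_mult)
  have "0 \<le> - (t * norm X ^ 2) + (t * norm X) ^ 2 * Y / 2"
    using var[of "- of_real t * cnj X"] unfolding re nm .
  also have "(t * norm X) ^ 2 * Y / 2 = t * norm X ^ 2 * (t * Y) / 2" by (simp add: power2_eq_square)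
  also have "t * norm X ^ 2 * (t * Y) / 2 \<le> t * norm X ^ 2 / 2"
    using t by (simp add: mult_left_le)
  finally have "t * norm X ^ 2 \<le> 0" by simp
  then have "X = 0" using t by (simp add: mult_le_0_iff)
  then show ?thesis by (simp add: X_def u_def)
qed

text \<open>\<open>first_variation\<close> holds for g = 1 + t h at every small t > 0. Expanding its
  weight in powers of t leaves a polynomial in t of size O(t^3), so the coefficients up to t^2
  vanish.\<close>

lemma variation_expansion:
  assumes h: "fixed h" and k: "killed k"
  defines "s \<equiv> complex_of_real (p / 2)"
  shows "(\<integral>z. k z \<partial>circle_measure) = 0"
    and "(\<integral>z. ((s - 1) * h z + s * cnj (h z)) * k z \<partial>circle_measure) = 0"
    and "(\<integral>z. ((s - 1) * (s - 2) / 2 * h z ^ 2 + (s - 1) * s * (h z * cnj (h z))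
           + s * (s - 1) / 2 * cnj (h z) ^ 2) * k z \<partial>circle_measure) = 0"
proof -
  have eb: "ess_bounded h" "ess_bounded k"
    using h k by (auto dest: fixed_hardy killed_hardy)
  have [measurable]: "h \<in> borel_measurable circle_measure" "k \<in> borel_measurable circle_measure"
    using eb by auto
  obtain M where M: "M > 0" "AE z in circle_measure. norm (h z) \<le> M" using eb by (auto elim: ess_boundedE)
  obtain K where K: "K > 0" "AE z in circle_measure. norm (k z) \<le> K" using eb by (auto elim: ess_boundedE)
  obtain C where C: "C \<ge> 0" "\<And>w. norm w \<le> 1/2 \<Longrightarrow>
    norm (complex_of_real (norm (1 + w) powr p) / (1 + w) - (1 + (s - 1) * w + s * cnj w + (s - 1) * (s - 2) / 2 * w ^ 2
      + (s - 1) * s * (w * cnj w) + s * (s - 1) / 2 * cnj w ^ 2)) \<le> C * norm w ^ 3"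
    using norm_powr_div_Taylor2[of p] unfolding s_def by blast
  define b c where "b = (\<lambda>z. (s - 1) * h z + s * cnj (h z))"
    and "c = (\<lambda>z. (s - 1) * (s - 2) / 2 * h z ^ 2 + (s - 1) * s * (h z * cnj (h z)) + s * (s - 1) / 2 * cnj (h z) ^ 2)"
  have ebc: "ess_bounded b" "ess_bounded c"
    unfolding b_def c_def by (intro ess_bounded_intros eb)+
  have int: "integrable circle_measure k" "integrable circle_measure (\<lambda>z. b z * k z)" "integrable circle_measure (\<lambda>z. c z * k z)"
    using eb ebc by (auto intro!: ess_bounded_integrable ess_bounded_intros)
  \<comment> \<open>For t < \<delta> the perturbation t h is at most 1/2 in modulus: 1 + t h stays
    away from 0 and the Taylor estimate applies.\<close>
  define \<delta> where "\<delta> = 1 / (2 * M)"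
  have \<delta>: "\<delta> > 0" using M by (simp add: \<delta>_def)
  have bound: "norm ((\<integral>z. k z \<partial>circle_measure) + of_real t * (\<integral>z. b z * k z \<partial>circle_measure)
     + of_real t ^ 2 * (\<integral>z. c z * k z \<partial>circle_measure)) \<le> (C * M ^ 3 * K) * t ^ 3" if t: "0 < t" "t < \<delta>" for t
  proof -
    have th: "AE z in circle_measure. norm (of_real t * h z) \<le> t * M \<and> norm (of_real t * h z) \<le> 1/2"
      using M(2)
    proof eventually_elim
      case (elim z)
      have "t * norm (h z) \<le> t * M" using t elim by (intro mult_left_mono) auto
      moreover have "t * M \<le> \<delta> * M" using t M by (intro mult_right_mono) auto
      moreover have "\<delta> * M = 1/2" using M by (simp add: \<delta>_def)
      moreover have "norm (of_real t * h z) = t * norm (h z)" using t by (simp add: norm_mult)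
      ultimately show ?case by simp
    qed
    define g where "g = (\<lambda>z. 1 + of_real t * h z)"
    have g: "fixed g" unfolding g_def by (intro fixed_add fixed_one fixed_cmult h)
    have "AE z in circle_measure. 1/2 \<le> norm (g z)"
      using th
    proof eventually_elim
      case (elim z)
      then show ?case
        using norm_diff_ineq[of 1 "of_real t * h z"] by (simp add: g_def)
    qed
    then have 0: "(\<integral>z. of_real (norm (g z) powr p) / g z * k z \<partial>circle_measure) = 0"
      by (intro first_variation[OF g k, of "1/2"]) auto
    define q where "q = (\<lambda>z. k z + of_real t * (b z * k z) + of_real t ^ 2 * (c z * k z))"
    define u where "u = (\<lambda>z. of_real (norm (g z) powr p) / g z * k z)"
    have le: "AE z in circle_measure. norm (q z - u z) \<le> (C * M ^ 3 * K) * t ^ 3"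
      using th K(2)
    proof eventually_elim
      case (elim z)
      define w where "w = of_real t * h z"
      define Q where "Q = 1 + (s - 1) * w + s * cnj w + (s - 1) * (s - 2) / 2 * w ^ 2
          + (s - 1) * s * (w * cnj w) + s * (s - 1) / 2 * cnj w ^ 2"
      have "norm (complex_of_real (norm (1 + w) powr p) / (1 + w) - Q) \<le> C * norm w ^ 3"
        unfolding Q_def by (rule C(2)) (use elim in \<open>simp add: w_def\<close>)
      also have "\<dots> \<le> C * (t * M) ^ 3"
        using elim C(1) by (intro mult_left_mono power_mono) (auto simp: w_def)
      finally have 1: "norm (complex_of_real (norm (1 + w) powr p) / (1 + w) - Q) \<le> C * (t * M) ^ 3" .
      have "q z = Q * k z"
        by (simp add: q_def b_def c_def Q_def w_def power2_eq_square algebra_simps)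
      then have "q z - u z = - ((complex_of_real (norm (1 + w) powr p) / (1 + w) - Q) * k z)"
        by (simp add: u_def g_def w_def algebra_simps)
      then have "norm (q z - u z) = norm (complex_of_real (norm (1 + w) powr p) / (1 + w) - Q) * norm (k z)"
        by (simp only: norm_minus_cancel norm_mult)
      also have "\<dots> \<le> C * (t * M) ^ 3 * K"
        using 1 elim C(1) t M by (intro mult_mono) auto
      finally show ?case by (simp add: power_mult_distrib mult_ac)
    qed
    have qi: "integrable circle_measure q"
      unfolding q_def using int by auto
    have qm: "q \<in> borel_measurable circle_measure" using qi by auto
    have um: "u \<in> borel_measurable circle_measure" unfolding u_def g_def by measurable
    have qui: "integrable circle_measure (\<lambda>z. q z - u z)"
      by (rule circle.integrable_const_bound[OF le]) (use qm um in auto)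
    have ui: "integrable circle_measure u"
      using Bochner_Integration.integrable_diff[OF qi qui] by simp
    have "(\<integral>z. k z \<partial>circle_measure) + of_real t * (\<integral>z. b z * k z \<partial>circle_measure)
        + of_real t ^ 2 * (\<integral>z. c z * k z \<partial>circle_measure) = (\<integral>z. q z \<partial>circle_measure)"
      unfolding q_def using int by simp
    also have "\<dots> = (\<integral>z. q z - u z \<partial>circle_measure)"
      using qi ui 0 by (simp add: u_def)
    finally have "norm ((\<integral>z. k z \<partial>circle_measure) + of_real t * (\<integral>z. b z * k z \<partial>circle_measure)
        + of_real t ^ 2 * (\<integral>z. c z * k z \<partial>circle_measure)) \<le> (\<integral>z. norm (q z - u z) \<partial>circle_measure)"
      by (simp only: integral_norm_bound)
    also have "\<dots> \<le> (\<integral>z. (C * M ^ 3 * K) * t ^ 3 \<partial>circle_measure)"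
      by (rule integral_mono_AE[OF integrable_norm[OF qui] _ le]) simp
    finally show ?thesis by simp
  qed
  note z = quadratic_coeffs_eq_0[OF \<delta> bound]
  show "(\<integral>z. k z \<partial>circle_measure) = 0" using z(1) .
  show "(\<integral>z. ((s - 1) * h z + s * cnj (h z)) * k z \<partial>circle_measure) = 0" using z(2) unfolding b_def .
  show "(\<integral>z. ((s - 1) * (s - 2) / 2 * h z ^ 2 + (s - 1) * s * (h z * cnj (h z))
           + s * (s - 1) / 2 * cnj (h z) ^ 2) * k z \<partial>circle_measure) = 0" using z(3) unfolding c_def .
qed

lemma killed_integral: "killed k \<Longrightarrow> (\<integral>z. k z \<partial>circle_measure) = 0"
  using variation_expansion(1)[OF fixed_one] .

text \<open>Replacing \<^term>\<open>h\<close> by \<open>\<i> * h\<close> and \<open>(1 + \<i>) * h\<close> separates the coefficients of the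
  expansion.\<close>

lemma killed_orth_fixed:
  assumes h: "fixed h" and k: "killed k"
  shows "(\<integral>z. cnj (h z) * k z \<partial>circle_measure) = 0"
proof -
  define s where "s = complex_of_real (p / 2)"
  have s: "s \<noteq> 0" using p by (simp add: s_def)
  have eb: "ess_bounded h" "ess_bounded k"
    using h k by (auto dest: fixed_hardy killed_hardy)
  have int: "integrable circle_measure (\<lambda>z. h z * k z)" "integrable circle_measure (\<lambda>z. cnj (h z) * k z)"
    using eb by (auto intro!: ess_bounded_integrable ess_bounded_intros)
  define X Y where "X = (\<integral>z. h z * k z \<partial>circle_measure)" and "Y = (\<integral>z. cnj (h z) * k z \<partial>circle_measure)"
  have e: "(s - 1) * (u * X) + s * (cnj u * Y) = 0" for u
  proof -
    have "(\<integral>z. ((s - 1) * (u * h z) + s * cnj (u * h z)) * k z \<partial>circle_measure) = 0"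
      unfolding s_def by (rule variation_expansion(2)[OF fixed_cmult[OF h] k])
    also have "(\<lambda>z. ((s - 1) * (u * h z) + s * cnj (u * h z)) * k z)
       = (\<lambda>z. ((s - 1) * u) * (h z * k z) + (s * cnj u) * (cnj (h z) * k z))"
      by (simp add: fun_eq_iff algebra_simps)
    also have "(\<integral>z. ((s - 1) * u) * (h z * k z) + (s * cnj u) * (cnj (h z) * k z) \<partial>circle_measure)
       = (s - 1) * u * X + s * cnj u * Y"
      using int by (simp add: X_def Y_def)
    finally show ?thesis by (simp add: mult.assoc)
  qed
  have "(s - 1) * X + s * Y = 0" using e[of 1] by simp
  moreover have "\<i> * ((s - 1) * X - s * Y) = 0" using e[of \<i>] by (simp add: algebra_simps)
  then have "(s - 1) * X - s * Y = 0" by simp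
  ultimately have "2 * (s * Y) = 0" by (simp add: algebra_simps)
  then show ?thesis using s by (simp add: Y_def)
qed

lemma killed_orth_square:
  assumes h: "fixed h" and k: "killed k"
  shows "(\<integral>z. h z * cnj (h z) * k z \<partial>circle_measure) = 0"
    and "(\<integral>z. cnj (h z) ^ 2 * k z \<partial>circle_measure) = 0"
proof -
  define s where "s = complex_of_real (p / 2)"
  \<comment> \<open>Since 0 < p/2 < 1, the factor s (s - 1) can be divided out of Y and Z at the
    end.\<close>
  have "s \<noteq> of_real 0" "s \<noteq> of_real 1" using p unfolding s_def of_real_eq_iff by simp_all
  then have s: "s \<noteq> 0" "s - 1 \<noteq> 0" by simp_all
  have eb: "ess_bounded h" "ess_bounded k"
    using h k by (auto dest: fixed_hardy killed_hardy)
  have int: "integrable circle_measure (\<lambda>z. h z ^ 2 * k z)" "integrable circle_measure (\<lambda>z. h z * cnj (h z) * k z)"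
    "integrable circle_measure (\<lambda>z. cnj (h z) ^ 2 * k z)"
    using eb by (auto intro!: ess_bounded_integrable ess_bounded_intros)
  define X Y Z where "X = (s - 1) * (s - 2) / 2 * (\<integral>z. h z ^ 2 * k z \<partial>circle_measure)"
    and "Y = (s - 1) * s * (\<integral>z. h z * cnj (h z) * k z \<partial>circle_measure)"
    and "Z = s * (s - 1) / 2 * (\<integral>z. cnj (h z) ^ 2 * k z \<partial>circle_measure)"
  have alg: "(a * (u * x) ^ 2 + b * ((u * x) * cnj (u * x)) + c * cnj (u * x) ^ 2) * y
     = (a * u ^ 2) * (x ^ 2 * y) + (b * (u * cnj u)) * (x * cnj x * y) + (c * cnj u ^ 2) * (cnj x ^ 2 * y)"
    for a b c u x y :: complex
    by (simp add: power_mult_distrib algebra_simps)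
  have e: "u ^ 2 * X + (u * cnj u) * Y + cnj u ^ 2 * Z = 0" for u
  proof -
    have "(\<integral>z. ((s - 1) * (s - 2) / 2 * (u * h z) ^ 2 + (s - 1) * s * ((u * h z) * cnj (u * h z))
           + s * (s - 1) / 2 * cnj (u * h z) ^ 2) * k z \<partial>circle_measure) = 0"
      unfolding s_def by (rule variation_expansion(3)[OF fixed_cmult[OF h] k])
    also have "(\<lambda>z. ((s - 1) * (s - 2) / 2 * (u * h z) ^ 2 + (s - 1) * s * ((u * h z) * cnj (u * h z))
           + s * (s - 1) / 2 * cnj (u * h z) ^ 2) * k z)
       = (\<lambda>z. ((s - 1) * (s - 2) / 2 * u ^ 2) * (h z ^ 2 * k z) + ((s - 1) * s * (u * cnj u)) * (h z * cnj (h z) * k z)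
          + (s * (s - 1) / 2 * cnj u ^ 2) * (cnj (h z) ^ 2 * k z))"
      by (rule ext) (rule alg)
    also have "(\<integral>z. ((s - 1) * (s - 2) / 2 * u ^ 2) * (h z ^ 2 * k z) + ((s - 1) * s * (u * cnj u)) * (h z * cnj (h z) * k z)
          + (s * (s - 1) / 2 * cnj u ^ 2) * (cnj (h z) ^ 2 * k z) \<partial>circle_measure)
       = ((s - 1) * (s - 2) / 2 * u ^ 2) * (\<integral>z. h z ^ 2 * k z \<partial>circle_measure)
         + ((s - 1) * s * (u * cnj u)) * (\<integral>z. h z * cnj (h z) * k z \<partial>circle_measure)
         + (s * (s - 1) / 2 * cnj u ^ 2) * (\<integral>z. cnj (h z) ^ 2 * k z \<partial>circle_measure)"
      using int by (simp only: Bochner_Integration.integral_add Bochner_Integration.integrable_add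
        integrable_mult_right integral_mult_right_zero)
    finally show ?thesis by (simp add: X_def Y_def Z_def mult_ac)
  qed
  \<comment> \<open>The multipliers 1, \<i> and 1 + \<i> have squares 1, -1 and 2 \<i>. The first
    two isolate Y, the third gives X = Z, and the first then gives Z = 0.\<close>
  have e1: "X + Y + Z = 0" using e[of 1] by simp
  have e2: "- X + Y - Z = 0" using e[of \<i>] by simp
  have "2 * Y = (X + Y + Z) + (- X + Y - Z)" by simp
  then have Y: "Y = 0" unfolding e1 e2 by simp
  have "(1 + \<i>) ^ 2 = 2 * \<i>" "cnj (1 + \<i>) ^ 2 = - 2 * \<i>" by (simp_all add: power2_eq_square algebra_simps)
  then have "2 * \<i> * (X - Z) = 0" using e[of "1 + \<i>"] Y by (simp add: algebra_simps)
  then have "X = Z" by simp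
  then have "2 * Z = 0" using e1 Y by simp
  then have Z: "Z = 0" by simp
  show "(\<integral>z. h z * cnj (h z) * k z \<partial>circle_measure) = 0" using Y s by (simp add: Y_def)
  show "(\<integral>z. cnj (h z) ^ 2 * k z \<partial>circle_measure) = 0" using Z s by (simp add: Z_def)
qed

text \<open>Polarization of the sesquilinear form \<open>B\<close>, whose diagonal vanishes by
  \<open>killed_orth_square\<close>: evaluation at g + u h for u = 1 and u = \<i> separates the two
  mixed terms.\<close>

lemma killed_orth_mult_cnj:
  assumes g: "fixed g" and h: "fixed h" and k: "killed k"
  shows "(\<integral>z. g z * cnj (h z) * k z \<partial>circle_measure) = 0"
proof -
  define B where "B = (\<lambda>f f'. \<integral>z. f z * cnj (f' z) * k z \<partial>circle_measure)"
  have eb: "ess_bounded g" "ess_bounded h" "ess_bounded k"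
    using g h k by (auto dest: fixed_hardy killed_hardy)
  have int: "integrable circle_measure (\<lambda>z. f z * cnj (f' z) * k z)" if "f \<in> {g, h}" "f' \<in> {g, h}" for f f'
    using eb that by (auto intro!: ess_bounded_integrable ess_bounded_intros)
  have e: "cnj u * B g h + u * B h g = 0" for u
  proof -
    have "fixed (\<lambda>z. g z + u * h z)" by (intro fixed_add fixed_cmult g h)
    then have "0 = (\<integral>z. (g z + u * h z) * cnj (g z + u * h z) * k z \<partial>circle_measure)"
      by (rule killed_orth_square(1)[OF _ k, symmetric])
    also have "\<dots> = (\<integral>z. g z * cnj (g z) * k z + cnj u * (g z * cnj (h z) * k z) + u * (h z * cnj (g z) * k z)
        + (u * cnj u) * (h z * cnj (h z) * k z) \<partial>circle_measure)"
      by (rule Bochner_Integration.integral_cong) (simp_all add: algebra_simps)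
    also have "\<dots> = B g g + cnj u * B g h + u * B h g + (u * cnj u) * B h h"
      unfolding B_def using int by (simp only: insertI1 insertI2 singletonI Bochner_Integration.integral_add Bochner_Integration.integrable_add
        integrable_mult_right integral_mult_right_zero)
    also have "B g g = 0" unfolding B_def by (rule killed_orth_square(1)[OF g k])
    also have "B h h = 0" unfolding B_def by (rule killed_orth_square(1)[OF h k])
    finally show ?thesis by simp
  qed
  have 1: "B g h + B h g = 0" using e[of 1] by simp
  have "\<i> * (B h g - B g h) = 0" using e[of \<i>] by (simp add: right_diff_distrib)
  then have "B h g = B g h" by simp
  with 1 have "2 * B g h = 0" by simp
  then show ?thesis by (simp add: B_def)
qed

text \<open>Here the form is symmetric, so polarization with the single sum g + h is enough.\<close>

lemma killed_orth_cnj_mult: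
  assumes g: "fixed g" and h: "fixed h" and k: "killed k"
  shows "(\<integral>z. cnj (g z) * cnj (h z) * k z \<partial>circle_measure) = 0"
proof -
  have eb: "ess_bounded g" "ess_bounded h" "ess_bounded k"
    using g h k by (auto dest: fixed_hardy killed_hardy)
  have int: "integrable circle_measure (\<lambda>z. cnj (g z) ^ 2 * k z)" "integrable circle_measure (\<lambda>z. cnj (h z) ^ 2 * k z)"
    "integrable circle_measure (\<lambda>z. cnj (g z) * cnj (h z) * k z)"
    using eb by (auto intro!: ess_bounded_integrable ess_bounded_intros)
  have "0 = (\<integral>z. cnj (g z + h z) ^ 2 * k z \<partial>circle_measure)"
    using killed_orth_square(2)[OF fixed_add[OF g h] k] by simp
  also have "\<dots> = (\<integral>z. cnj (g z) ^ 2 * k z + cnj (h z) ^ 2 * k z + 2 * (cnj (g z) * cnj (h z) * k z) \<partial>circle_measure)"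
    by (rule Bochner_Integration.integral_cong) (simp_all add: power2_eq_square algebra_simps)
  also have "\<dots> = (\<integral>z. cnj (g z) ^ 2 * k z \<partial>circle_measure) + (\<integral>z. cnj (h z) ^ 2 * k z \<partial>circle_measure)
      + 2 * (\<integral>z. cnj (g z) * cnj (h z) * k z \<partial>circle_measure)"
    using int by (simp only: Bochner_Integration.integral_add Bochner_Integration.integrable_add
        integrable_mult_right integral_mult_right_zero)
  finally show ?thesis
    using killed_orth_square(2) g h k by simp
qed

subsection \<open>The kernel of the projection\<close>

definition monom_image :: "nat \<Rightarrow> complex \<Rightarrow> complex" where
  "monom_image n = P (\<lambda>z. z ^ n)"

lemma bounded_hardy_monom: "bounded_hardy (\<lambda>z. z ^ n)"
  using bounded_hardy_poly[of "monom 1 n"] by (simp add: poly_monom[abs_def])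

lemma fixed_monom_image: "fixed (monom_image n)"
proof -
  have Hp: "(\<lambda>z. z ^ n) \<in> Hp_circle p" by (rule bounded_hardy_Hp_p[OF bounded_hardy_monom])
  have "bounded_hardy (monom_image n)"
  \<comment> \<open>The boundedness hypothesis starts at n = 1; for n = 0 the image agrees almost
    everywhere with the constant 1.\<close>
  proof (cases "n = 0")
    case True
    have "AE z in circle_measure. 1 = monom_image n z"
      using P_one by eventually_elim (simp add: monom_image_def True)
    then show ?thesis
      by (rule bounded_hardy_AE_cong[OF bounded_hardy_const])
         (use P_Hp[OF Hp] in \<open>auto simp: monom_image_def\<close>)
  next
    case False
    then show ?thesis using P_monom[of n] by (auto simp: monom_image_def intro: Hinf_circle_bounded_hardy)
  qed
  then show ?thesis using P_idem[OF Hp] by (simp add: fixed_def monom_image_def)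
qed

lemma fixed_sum: "(\<And>i. i \<in> A \<Longrightarrow> fixed (f i)) \<Longrightarrow> fixed (\<lambda>z. \<Sum>i\<in>A. f i z)"
proof (induction A rule: infinite_finite_induct)
  case (insert x A)
  then show ?case by (simp add: fixed_add)
qed (use fixed_cmult[OF fixed_one, of 0] in auto)

lemma killed_diff_P:
  assumes f: "bounded_hardy f" and g: "fixed g" and fg: "AE z in circle_measure. P f z = g z"
  shows "killed (\<lambda>z. f z - g z)"
proof -
  have gh: "bounded_hardy g" by (rule fixed_hardy[OF g])
  have "AE z in circle_measure. P g z = g z" using g by (simp add: fixed_def)
  with fg P_diff[OF bounded_hardy_Hp_p[OF f] bounded_hardy_Hp_p[OF gh]]
  have "AE z in circle_measure. P (\<lambda>z. f z - g z) z = 0"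
    by eventually_elim simp
  then show ?thesis using f gh by (auto simp: killed_def)
qed

lemma killed_monom: "killed (\<lambda>z. z ^ n - monom_image n z)"
  using killed_diff_P[OF bounded_hardy_monom fixed_monom_image] by (simp add: monom_image_def)

text \<open>An explicit bounded representative of \<open>P (poly q)\<close>. Linearity of P holds
  only almost everywhere, so the value chosen by P need not be this sum at every point.\<close>

definition poly_image :: "complex poly \<Rightarrow> complex \<Rightarrow> complex" where
  "poly_image q = (\<lambda>z. \<Sum>i\<le>degree q. coeff q i * monom_image i z)"

lemma fixed_poly_image: "fixed (poly_image q)"
  unfolding poly_image_def by (intro fixed_sum fixed_cmult fixed_monom_image)

lemma P_poly: "AE z in circle_measure. P (poly q) z = poly_image q z"
proof -
  \<comment> \<open>The induction runs over the number of terms: an induction on \<open>q\<close> by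
    \<open>pCons\<close> would involve multiplication by z, with which P is not known to
    commute.\<close>
  have "bounded_hardy (\<lambda>z. \<Sum>i<n. c i * z ^ i) \<and>
     (AE z in circle_measure. P (\<lambda>z. \<Sum>i<n. c i * z ^ i) z = (\<Sum>i<n. c i * monom_image i z))"
    for c :: "nat \<Rightarrow> complex" and n
  proof (induction n)
    case 0
    \<comment> \<open>The image of the zero function is obtained from homogeneity with the scalar
      0.\<close>
    have "AE z in circle_measure. P (\<lambda>w. 0 * 1) z = 0 * P (\<lambda>_. 1) z"
      using fixed_one by (intro P_cmult bounded_hardy_Hp_p fixed_hardy)
    then show ?case by simp
  next
    case (Suc n)
    have m: "bounded_hardy (\<lambda>z. c n * z ^ n)" by (intro bounded_hardy_cmult bounded_hardy_monom)
    have "AE z in circle_measure. P (\<lambda>z. (\<Sum>i<n. c i * z ^ i) + c n * z ^ n) z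
        = P (\<lambda>z. \<Sum>i<n. c i * z ^ i) z + P (\<lambda>z. c n * z ^ n) z"
      using Suc m by (intro P_add bounded_hardy_Hp_p) auto
    moreover have "AE z in circle_measure. P (\<lambda>z. c n * z ^ n) z = c n * monom_image n z"
      unfolding monom_image_def by (intro P_cmult bounded_hardy_Hp_p bounded_hardy_monom)
    moreover have "AE z in circle_measure. P (\<lambda>z. \<Sum>i<n. c i * z ^ i) z = (\<Sum>i<n. c i * monom_image i z)"
      using Suc by blast
    ultimately have "AE z in circle_measure. P (\<lambda>z. (\<Sum>i<n. c i * z ^ i) + c n * z ^ n) z
        = (\<Sum>i<n. c i * monom_image i z) + c n * monom_image n z"
      by eventually_elim simp
    then show ?case using Suc m by auto
  qed
  from this[where n = "Suc (degree q)" and c = "coeff q"] show ?thesis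
    by (simp add: poly_altdef[abs_def] poly_image_def lessThan_Suc_atMost)
qed

text \<open>For a polynomial \<^term>\<open>q\<close> close to \<^term>\<open>f\<close>, orthogonality bounds the \<open>L\<^sup>2\<close> norm of
  \<^term>\<open>P (poly q)\<close> by that of \<^term>\<open>\<lambda>z. poly q z - f z\<close>.\<close>

lemma killed_if_orth_monom_images:
  assumes f: "bounded_hardy f" and orth: "\<And>n. (\<integral>z. f z * cnj (monom_image n z) \<partial>circle_measure) = 0"
  shows "killed f"
proof -
  have Hp: "f \<in> Hp_circle p" by (rule bounded_hardy_Hp_p[OF f])
  have Pf: "P f \<in> Lp_circle p" by (rule Hp_circle_Lp[OF P_Hp[OF Hp]])
  have two: "norm x powr 2 = norm x ^ 2" for x :: complex by simp
  have "AE z in circle_measure. P f z = 0"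
  proof (rule AE_eq_0_if_powr_integral[OF Pf])
    fix e :: real assume e: "e > 0"
    obtain d where d: "d > 0" "\<forall>g\<in>Lp_circle 2. powr_integral 2 g < d \<longrightarrow> powr_integral p g < e / 2"
      using Lp_circle_small[of p 2 "e/2"] p e by auto
    obtain q where q: "(\<integral>z. norm (f z - poly q z) ^ 2 \<partial>circle_measure) < min d (e/2)"
       "(\<integral>z. norm (f z - poly q z) powr p \<partial>circle_measure) < min d (e/2)"
      using bounded_hardy_approx_poly[OF f, of p "min d (e/2)"] p d e by auto
    define T where "T = poly_image q"
    have T: "fixed T" unfolding T_def by (rule fixed_poly_image)
    have k: "killed (\<lambda>z. poly q z - T z)"
      unfolding T_def by (rule killed_diff_P[OF bounded_hardy_poly fixed_poly_image P_poly])
    have eb: "ess_bounded f" "ess_bounded T"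
      using f T by (auto dest: fixed_hardy)
    have int: "integrable circle_measure (\<lambda>z. norm (f z - poly q z) ^ 2)" "integrable circle_measure (\<lambda>z. norm (T z) ^ 2)"
      "integrable circle_measure (\<lambda>z. f z * cnj (T z))" "integrable circle_measure (\<lambda>z. (f z - poly q z) * cnj (T z))"
      "integrable circle_measure (\<lambda>z. cnj (T z) * (poly q z - T z))"
      using eb by (auto intro!: ess_bounded_integrable_norm ess_bounded_integrable ess_bounded_intros)
    have fT: "(\<integral>z. f z * cnj (T z) \<partial>circle_measure) = 0"
    proof -
      have "ess_bounded (monom_image i)" for i
        using fixed_hardy[OF fixed_monom_image] by auto
      then have "integrable circle_measure (\<lambda>z. cnj (coeff q i) * (f z * cnj (monom_image i z)))" for i
        using eb by (auto intro!: ess_bounded_integrable ess_bounded_intros)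
      moreover have "(\<integral>z. f z * cnj (T z) \<partial>circle_measure) =
         (\<integral>z. (\<Sum>i\<le>degree q. cnj (coeff q i) * (f z * cnj (monom_image i z))) \<partial>circle_measure)"
        by (rule Bochner_Integration.integral_cong) (simp_all add: T_def poly_image_def sum_distrib_left mult_ac)
      ultimately show ?thesis
        by (simp add: Bochner_Integration.integral_sum orth)
    qed
    have "(\<integral>z. norm (T z) ^ 2 \<partial>circle_measure) \<le> (\<integral>z. norm (f z - poly q z) ^ 2 \<partial>circle_measure)"
    proof -
      \<comment> \<open>Writing T = f - (f - q) - (q - T), the first term is orthogonal to T by
        assumption and the last because q - T is in the kernel. Only the middle term survives, and
        half of the square of T is absorbed on the left.\<close>
      have "norm (T z) ^ 2 = Re (f z * cnj (T z)) - Re ((f z - poly q z) * cnj (T z)) - Re (cnj (T z) * (poly q z - T z))" for z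
        unfolding cmod_power2 by (simp add: power2_eq_square algebra_simps)
      then have "(\<integral>z. norm (T z) ^ 2 \<partial>circle_measure) =
         (\<integral>z. Re (f z * cnj (T z)) - Re ((f z - poly q z) * cnj (T z)) - Re (cnj (T z) * (poly q z - T z)) \<partial>circle_measure)"
        by simp
      also have "\<dots> = Re (\<integral>z. f z * cnj (T z) \<partial>circle_measure) - (\<integral>z. Re ((f z - poly q z) * cnj (T z)) \<partial>circle_measure)
         - Re (\<integral>z. cnj (T z) * (poly q z - T z) \<partial>circle_measure)"
        using int by (simp only: Bochner_Integration.integral_diff Bochner_Integration.integrable_diff integrable_Re integral_Re)
      also have "\<dots> = (\<integral>z. - Re ((f z - poly q z) * cnj (T z)) \<partial>circle_measure)"
        by (simp only: fT killed_orth_fixed[OF T k] zero_complex.sel Bochner_Integration.integral_minus diff_0 diff_0_right)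
      also have "\<dots> \<le> (\<integral>z. (norm (f z - poly q z) ^ 2 + norm (T z) ^ 2) / 2 \<partial>circle_measure)"
      proof (rule integral_mono)
        show "integrable circle_measure (\<lambda>z. - Re ((f z - poly q z) * cnj (T z)))"
          by (intro Bochner_Integration.integrable_minus integrable_Re int)
        fix z
        have "- Re ((f z - poly q z) * cnj (T z)) \<le> norm ((f z - poly q z) * cnj (T z))"
          using abs_Re_le_cmod[of "(f z - poly q z) * cnj (T z)"] by linarith
        also have "\<dots> = norm (f z - poly q z) * norm (T z)" by (simp add: norm_mult)
        also have "\<dots> \<le> (norm (f z - poly q z) ^ 2 + norm (T z) ^ 2) / 2"
          using sum_squares_bound[of "norm (f z - poly q z)" "norm (T z)"] by simp
        finally show "- Re ((f z - poly q z) * cnj (T z)) \<le> (norm (f z - poly q z) ^ 2 + norm (T z) ^ 2) / 2" .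
      qed (use int in auto)
      also have "\<dots> = ((\<integral>z. norm (f z - poly q z) ^ 2 \<partial>circle_measure) + (\<integral>z. norm (T z) ^ 2 \<partial>circle_measure)) / 2"
        using int by simp
      finally show ?thesis by simp
    qed
    then have "powr_integral 2 T < d"
      using q(1) by (simp add: powr_integral_def two)
    then have Te: "powr_integral p T < e / 2"
      using d(2) Lp_circle_ess_bounded[OF eb(2)] by simp
    have "AE z in circle_measure. P (\<lambda>z. f z - poly q z) z = P f z - P (poly q) z"
      by (rule P_diff[OF Hp bounded_hardy_Hp_p[OF bounded_hardy_poly]])
    \<comment> \<open>The first summand is small in L^p by contractivity, the second because its L^2
      norm is.\<close>
    with P_poly[of q] have ae: "AE z in circle_measure. P f z = P (\<lambda>z. f z - poly q z) z + T z"
      unfolding T_def by eventually_elim simp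
    have fq: "(\<lambda>z. f z - poly q z) \<in> Hp_circle p" using f by (intro bounded_hardy_Hp_p) auto
    have L: "P (\<lambda>z. f z - poly q z) \<in> Lp_circle p" "T \<in> Lp_circle p"
      using Hp_circle_Lp[OF P_Hp[OF fq]] Lp_circle_ess_bounded[OF eb(2)] p by auto
    have "powr_integral p (P f) = powr_integral p (\<lambda>z. P (\<lambda>z. f z - poly q z) z + T z)"
      by (rule powr_integral_cong_AE[OF ae]) (use Pf L in \<open>auto simp: Lp_circle_def\<close>)
    also have "\<dots> \<le> powr_integral p (P (\<lambda>z. f z - poly q z)) + powr_integral p T"
      using p L by (intro Lp_circle_add(2)) auto
    also have "powr_integral p (P (\<lambda>z. f z - poly q z)) \<le> powr_integral p (\<lambda>z. f z - poly q z)"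
      by (rule P_contracts[OF fq])
    finally show "powr_integral p (P f) \<le> e"
      using q(2) Te by (simp add: powr_integral_def)
  qed
  then show ?thesis using f by (simp add: killed_def)
qed

text \<open>This is where \<open>p < 1\<close> is essential: for \<open>p \<ge> 1\<close> the map \<open>t \<mapsto> t powr p\<close> is convex, and
  \<open>f \<mapsto> (f z + f (- z)) / 2\<close> is a contractive projection.\<close>

lemma fixed_times_real_killed:
  fixes r :: "complex \<Rightarrow> real"
  assumes h: "fixed h" and k: "killed (\<lambda>z. h z * of_real (r z))" and r: "AE z in circle_measure. \<bar>r z\<bar> \<le> B"
    and rm [measurable]: "r \<in> borel_measurable circle_measure"
  shows "AE z in circle_measure. h z * of_real (r z) = 0"
proof -
  have eb: "ess_bounded h" using h by (auto dest: fixed_hardy)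
  have [measurable]: "h \<in> borel_measurable circle_measure" using eb by auto
  \<comment> \<open>With this choice 1 + \<delta> r and 1 - \<delta> r are positive almost
    everywhere, so |h (1 \<plusminus> \<delta> r)|^p splits into a product of powers.\<close>
  define \<delta> where "\<delta> = 1 / (2 * (\<bar>B\<bar> + 1))"
  have \<delta>: "\<delta> > 0" by (simp add: \<delta>_def add_nonneg_pos)
  have \<delta>r: "AE z in circle_measure. \<bar>\<delta> * r z\<bar> < 1"
    using r
  proof eventually_elim
    case (elim z)
    also have "B < 2 * (\<bar>B\<bar> + 1)" by (simp add: abs_if)
    finally have "\<bar>r z\<bar> < 2 * (\<bar>B\<bar> + 1)" .
    then have "\<delta> * \<bar>r z\<bar> < \<delta> * (2 * (\<bar>B\<bar> + 1))" using \<delta> by (rule mult_strict_left_mono)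
    also have "\<delta> * (2 * (\<bar>B\<bar> + 1)) = 1" by (simp add: \<delta>_def)
    finally show ?case using \<delta> by (simp add: abs_mult)
  qed
  have le: "powr_integral p h \<le> (\<integral>z. norm (h z) powr p * (1 + c * r z) powr p \<partial>circle_measure)"
    and int: "integrable circle_measure (\<lambda>z. norm (h z) powr p * (1 + c * r z) powr p)"
    if c: "c = \<delta> \<or> c = - \<delta>" for c
  proof -
    have ae: "AE z in circle_measure. norm (h z) powr p * (1 + c * r z) powr p = norm (h z + of_real c * (h z * of_real (r z))) powr p"
      using \<delta>r
    proof eventually_elim
      case (elim z)
      have "h z + of_real c * (h z * of_real (r z)) = h z * of_real (1 + c * r z)" by (simp add: algebra_simps)
      then have "norm (h z + of_real c * (h z * of_real (r z))) = norm (h z) * \<bar>1 + c * r z\<bar>"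
        by (simp only: norm_mult norm_of_real)
      moreover have "1 + c * r z > 0" using elim c by auto
      ultimately show ?case by (simp add: powr_mult)
    qed
    have k2: "ess_bounded (\<lambda>z. h z * of_real (r z))" using k by (auto dest: killed_hardy)
    then have i: "integrable circle_measure (\<lambda>z. norm (h z + of_real c * (h z * of_real (r z))) powr p)"
      using eb p by (auto intro!: ess_bounded_integrable_powr ess_bounded_add ess_bounded_mult[OF ess_bounded_const])
    show "integrable circle_measure (\<lambda>z. norm (h z) powr p * (1 + c * r z) powr p)"
      by (rule integrable_cong_AE_imp[OF i]) (use ae in auto)
    have "powr_integral p h \<le> powr_integral p (\<lambda>z. h z + of_real c * (h z * of_real (r z)))"
      by (rule powr_integral_le_add_killed[OF h k])
    also have "\<dots> = (\<integral>z. norm (h z) powr p * (1 + c * r z) powr p \<partial>circle_measure)"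
      unfolding powr_integral_def using ae by (intro integral_cong_AE) auto
    finally show "powr_integral p h \<le> (\<integral>z. norm (h z) powr p * (1 + c * r z) powr p \<partial>circle_measure)" .
  qed
  \<comment> \<open>Concavity makes \<open>u\<close> nonnegative, whereas adding the two minimality
    inequalities makes its integral nonpositive. Hence \<open>u\<close> vanishes almost everywhere,
    and strict concavity forces r = 0 wherever h is nonzero.\<close>
  define u where "u = (\<lambda>z. norm (h z) powr p * (2 - ((1 + \<delta> * r z) powr p + (1 - \<delta> * r z) powr p)))"
  have hi: "integrable circle_measure (\<lambda>z. norm (h z) powr p)"
    using eb p by (intro ess_bounded_integrable_powr)
  have u_eq: "u = (\<lambda>z. 2 * norm (h z) powr p - (norm (h z) powr p * (1 + \<delta> * r z) powr p
      + norm (h z) powr p * (1 + - \<delta> * r z) powr p))"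
    by (simp add: u_def fun_eq_iff algebra_simps)
  have ui: "integrable circle_measure u"
    unfolding u_eq using hi int[of \<delta>] int[of "- \<delta>"] by (intro Bochner_Integration.integrable_diff Bochner_Integration.integrable_add) auto
  have "(\<integral>z. u z \<partial>circle_measure) = 2 * powr_integral p h - ((\<integral>z. norm (h z) powr p * (1 + \<delta> * r z) powr p \<partial>circle_measure)
      + (\<integral>z. norm (h z) powr p * (1 + - \<delta> * r z) powr p \<partial>circle_measure))"
    unfolding u_eq powr_integral_def using hi int[of \<delta>] int[of "- \<delta>"] by simp
  also have "\<dots> \<le> 0" using le[of \<delta>] le[of "- \<delta>"] by simp
  finally have "(\<integral>z. u z \<partial>circle_measure) \<le> 0" .
  moreover have u0: "AE z in circle_measure. 0 \<le> u z"
    using \<delta>r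
  proof eventually_elim
    case (elim z)
    then show ?case using powr_add_powr_le_two(1)[OF p, of "\<delta> * r z"] by (simp add: u_def)
  qed
  ultimately have "(\<integral>z. u z \<partial>circle_measure) = 0" using integral_nonneg_AE[OF u0] by linarith
  then have "AE z in circle_measure. u z = 0" using integral_nonneg_eq_0_iff_AE[OF ui u0] by simp
  with \<delta>r show ?thesis
  proof eventually_elim
    case (elim z)
    then have "h z = 0 \<or> (1 + \<delta> * r z) powr p + (1 - \<delta> * r z) powr p = 2" by (auto simp: u_def)
    then show ?case using powr_add_powr_le_two(2)[OF p elim(1)] \<delta> by auto
  qed
qed

subsection \<open>The two alternatives\<close>

lemma monom_image_one_eq:
  assumes N: "N \<ge> 1" and nz: "\<not> (AE z in circle_measure. monom_image N z = 0)"
  shows "AE z in circle_measure. monom_image 1 z = z"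
proof -
  define h e \<zeta> where "h = monom_image N" and "e = monom_image 1" and "\<zeta> = (\<lambda>z. z - e z)"
  have h: "fixed h" and e: "fixed e" unfolding h_def e_def by (rule fixed_monom_image)+
  have \<zeta>: "killed \<zeta>" using killed_monom[of 1] by (simp add: \<zeta>_def e_def)
  note hardy = fixed_hardy[OF h] fixed_hardy[OF e] killed_hardy[OF \<zeta>]
  have eb: "ess_bounded h" "ess_bounded e" "ess_bounded \<zeta>" "ess_bounded (monom_image m)" for m
    using hardy fixed_hardy[OF fixed_monom_image[of m]] by auto
  have mean: "(\<integral>z. monom_image m z \<partial>circle_measure) = 0" if "m \<ge> 1" for m
  proof -
    have "(\<integral>z. z ^ m \<partial>circle_measure) - (\<integral>z. monom_image m z \<partial>circle_measure) = (\<integral>z. z ^ m - monom_image m z \<partial>circle_measure)"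
      using eb by (intro Bochner_Integration.integral_diff[symmetric] ess_bounded_integrable ess_bounded_intros)
    also have "\<dots> = 0" by (rule killed_integral[OF killed_monom])
    also have "(\<integral>z. z ^ m \<partial>circle_measure) = 0"
      using bounded_hardyD[OF bounded_hardy_const[of 1] that] by simp
    finally show ?thesis by simp
  qed
  have h\<zeta>: "bounded_hardy (\<lambda>z. h z * \<zeta> z)" using hardy by auto
  \<comment> \<open>Division by z lowers all frequencies by one; the only new condition, at m = 1,
    is that \<open>h\<close> has mean 0. This is where N \<ge> 1 enters.\<close>
  have k0: "bounded_hardy (\<lambda>z. cnj z * h z)"
    unfolding bounded_hardy_def
  proof (intro conjI allI impI)
    fix m :: nat assume m: "m \<ge> 1"
    have "(\<integral>z. z ^ m * (cnj z * h z) \<partial>circle_measure) = (\<integral>z. z ^ (m - 1) * h z \<partial>circle_measure)"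
    proof (rule Bochner_Integration.integral_cong)
      fix z assume "z \<in> space circle_measure"
      then have "cnj z * z = 1" by (intro cnj_mult_self_sphere) simp
      moreover have "z ^ m = z * z ^ (m - 1)" using m by (cases m) auto
      ultimately show "z ^ m * (cnj z * h z) = z ^ (m - 1) * h z" by (simp add: mult_ac)
    qed auto
    also have "\<dots> = 0"
      using m bounded_hardyD[OF hardy(1), of "m - 1"] mean[OF N] by (cases "m = 1") (auto simp: h_def)
    finally show "(\<integral>z. z ^ m * (cnj z * h z) \<partial>circle_measure) = 0" .
  qed (use eb in \<open>intro ess_bounded_intros\<close>)
  \<comment> \<open>The orthogonality relations contain \<zeta> unconjugated. Conjugating the whole
    integral brings products with \<open>cnj \<zeta>\<close> into that form.\<close>
  have conj0: "(\<integral>z. h z * cnj (\<zeta> z) * cnj (f z) \<partial>circle_measure) = 0"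
    if "(\<integral>z. cnj (h z) * f z * \<zeta> z \<partial>circle_measure) = 0" for f
  proof -
    have "(\<integral>z. h z * cnj (\<zeta> z) * cnj (f z) \<partial>circle_measure) = (\<integral>z. cnj (cnj (h z) * f z * \<zeta> z) \<partial>circle_measure)"
      by (rule Bochner_Integration.integral_cong) (simp_all add: mult_ac)
    also have "\<dots> = 0" using that by (simp only: Bochner_Integration.integral_cnj complex_cnj_zero)
    finally show ?thesis .
  qed
  \<comment> \<open>In the m-th coefficient, z^m is the kernel element \<open>z ^ m - ?m\<close>
    plus \<open>?m\<close>, and next to \<open>?m\<close> the factor \<open>cnj e\<close> is
    replaced by \<open>cnj z - cnj \<zeta>\<close>. Of the three integrals, the first and third
    vanish by orthogonality, the second as a product of means with that of \<open>?m\<close> equal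
    to 0.\<close>
  have he: "bounded_hardy (\<lambda>z. h z * cnj (e z))"
    unfolding bounded_hardy_def
  proof (intro conjI allI impI)
    fix m :: nat assume m: "m \<ge> 1"
    let ?m = "monom_image m"
    have int: "integrable circle_measure (\<lambda>z. h z * cnj (e z) * (z ^ m - ?m z))"
      "integrable circle_measure (\<lambda>z. (cnj z * h z) * ?m z)" "integrable circle_measure (\<lambda>z. h z * cnj (\<zeta> z) * ?m z)"
      by (intro ess_bounded_integrable ess_bounded_intros eb)+
    have "(\<integral>z. z ^ m * (h z * cnj (e z)) \<partial>circle_measure) =
       (\<integral>z. h z * cnj (e z) * (z ^ m - ?m z) + ((cnj z * h z) * ?m z - h z * cnj (\<zeta> z) * ?m z) \<partial>circle_measure)"
      by (rule Bochner_Integration.integral_cong) (simp_all add: \<zeta>_def algebra_simps)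
    also have "\<dots> = (\<integral>z. h z * cnj (e z) * (z ^ m - ?m z) \<partial>circle_measure)
       + ((\<integral>z. (cnj z * h z) * ?m z \<partial>circle_measure) - (\<integral>z. h z * cnj (\<zeta> z) * ?m z \<partial>circle_measure))"
      using int by (simp only: Bochner_Integration.integral_add Bochner_Integration.integral_diff
        Bochner_Integration.integrable_diff)
    also have "(\<integral>z. h z * cnj (e z) * (z ^ m - ?m z) \<partial>circle_measure) = 0"
      by (rule killed_orth_mult_cnj[OF h e killed_monom])
    also have "(\<integral>z. (cnj z * h z) * ?m z \<partial>circle_measure) = 0"
      using bounded_hardy_integral_mult[OF k0 fixed_hardy[OF fixed_monom_image[of m]]] mean[OF m] by simp
    also have "(\<integral>z. h z * cnj (\<zeta> z) * ?m z \<partial>circle_measure) = 0"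
      using conj0[of "\<lambda>z. cnj (?m z)"] killed_orth_cnj_mult[OF h fixed_monom_image \<zeta>, of m] by simp
    finally show "(\<integral>z. z ^ m * (h z * cnj (e z)) \<partial>circle_measure) = 0" by simp
  qed (use eb in \<open>intro ess_bounded_intros\<close>)
  \<comment> \<open>Testing against \<open>cnj (monom_image n)\<close> gives the mixed relation for
    the range functions \<open>h\<close> and \<open>monom_image n\<close> and the kernel element
    \<zeta>.\<close>
  have k1: "killed (\<lambda>z. h z * \<zeta> z)"
  proof (rule killed_if_orth_monom_images[OF h\<zeta>])
    show "(\<integral>z. h z * \<zeta> z * cnj (monom_image n z) \<partial>circle_measure) = 0" for n
      using killed_orth_mult_cnj[OF h fixed_monom_image \<zeta>, of n] by (simp add: mult_ac)
  qed
  \<comment> \<open>After conjugation the same relation appears with the roles of \<open>h\<close>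
    and \<open>monom_image n\<close> exchanged.\<close>
  have k2: "killed (\<lambda>z. h z * cnj (\<zeta> z))"
  proof (rule killed_if_orth_monom_images)
    have "(\<lambda>z. h z * cnj (\<zeta> z)) = (\<lambda>z. cnj z * h z - h z * cnj (e z))"
      by (simp add: \<zeta>_def fun_eq_iff algebra_simps)
    then show "bounded_hardy (\<lambda>z. h z * cnj (\<zeta> z))" using k0 he by auto
    show "(\<integral>z. h z * cnj (\<zeta> z) * cnj (monom_image n z) \<partial>circle_measure) = 0" for n
      using killed_orth_mult_cnj[OF fixed_monom_image h \<zeta>, of n] by (intro conj0) (simp add: mult_ac)
  qed
  obtain B where B: "AE z in circle_measure. norm (\<zeta> z) \<le> B"
    using eb(3) by (auto elim: ess_boundedE)
  have [measurable]: "\<zeta> \<in> borel_measurable circle_measure" using eb(3) by auto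
  have "(\<lambda>z. h z * of_real (2 * Re (\<zeta> z))) = (\<lambda>z. h z * \<zeta> z + h z * cnj (\<zeta> z))"
    by (simp add: fun_eq_iff complex_add_cnj flip: distrib_left)
  then have "killed (\<lambda>z. h z * of_real (2 * Re (\<zeta> z)))" using killed_add[OF k1 k2] by simp
  then have re: "AE z in circle_measure. h z * of_real (2 * Re (\<zeta> z)) = 0"
  proof (rule fixed_times_real_killed[OF h])
    show "AE z in circle_measure. \<bar>2 * Re (\<zeta> z)\<bar> \<le> 2 * B"
      using B by eventually_elim (use abs_Re_le_cmod order_trans in \<open>fastforce simp: abs_mult\<close>)
  qed measurable
  have "(\<lambda>z. h z * of_real (2 * Im (\<zeta> z))) = (\<lambda>z. - \<i> * (h z * \<zeta> z) + \<i> * (h z * cnj (\<zeta> z)))"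
    by (simp add: fun_eq_iff complex_eq_iff algebra_simps)
  then have "killed (\<lambda>z. h z * of_real (2 * Im (\<zeta> z)))"
    by (simp only:) (intro killed_add killed_cmult k1 k2)
  then have im: "AE z in circle_measure. h z * of_real (2 * Im (\<zeta> z)) = 0"
  proof (rule fixed_times_real_killed[OF h])
    show "AE z in circle_measure. \<bar>2 * Im (\<zeta> z)\<bar> \<le> 2 * B"
      using B by eventually_elim (use abs_Im_le_cmod order_trans in \<open>fastforce simp: abs_mult\<close>)
  qed measurable
  have "AE z in circle_measure. h z * \<zeta> z = 0"
    using re im by eventually_elim (auto simp: complex_eq_iff)
  \<comment> \<open>Bounded analytic functions have no zero divisors and \<open>h\<close> is not
    null.\<close>
  then have "AE z in circle_measure. \<zeta> z = 0"
    using bounded_hardy_mult_eq_0[OF hardy(1,3)] nz by (simp add: h_def)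
  then show ?thesis by eventually_elim (simp add: \<zeta>_def e_def)
qed

text \<open>Once z and z^n are fixed, the relation with two conjugates makes \<zeta> orthogonal to
  their product z^(n+1). As \<zeta> is also orthogonal to the image of z^(n+1), it is orthogonal to
  itself.\<close>

lemma monom_image_eq_monom:
  assumes 1: "AE z in circle_measure. monom_image 1 z = z"
  shows "AE z in circle_measure. monom_image n z = z ^ n"
proof (induction n)
  case 0
  show ?case using P_one by eventually_elim (simp add: monom_image_def)
next
  case (Suc n)
  have fixed_monom: "fixed (\<lambda>z. z ^ m)" if "AE z in circle_measure. monom_image m z = z ^ m" for m
    using that bounded_hardy_monom[of m] by (simp add: fixed_def monom_image_def)
  have fz: "fixed (\<lambda>z. z)" using fixed_monom[of 1] 1 by simp
  define \<zeta> where "\<zeta> = (\<lambda>z. z ^ Suc n - monom_image (Suc n) z)"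
  have \<zeta>: "killed \<zeta>" unfolding \<zeta>_def by (rule killed_monom)
  have eb: "ess_bounded \<zeta>" "ess_bounded (monom_image (Suc n))"
    using killed_hardy[OF \<zeta>] fixed_hardy[OF fixed_monom_image[of "Suc n"]] by auto
  have i2: "integrable circle_measure (\<lambda>z. norm (\<zeta> z) ^ 2)" by (rule ess_bounded_integrable_norm[OF eb(1)])
  have int: "integrable circle_measure (\<lambda>z. cnj z * cnj (z ^ n) * \<zeta> z)"
      "integrable circle_measure (\<lambda>z. cnj (monom_image (Suc n) z) * \<zeta> z)"
    by (intro ess_bounded_integrable ess_bounded_intros eb)+
  have "complex_of_real (\<integral>z. norm (\<zeta> z) ^ 2 \<partial>circle_measure) = (\<integral>z. of_real (norm (\<zeta> z) ^ 2) \<partial>circle_measure)"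
    by (rule integral_complex_of_real[symmetric])
  also have "\<dots> = (\<integral>z. cnj z * cnj (z ^ n) * \<zeta> z - cnj (monom_image (Suc n) z) * \<zeta> z \<partial>circle_measure)"
    by (rule Bochner_Integration.integral_cong)
       (simp_all only: complex_norm_square, simp_all add: \<zeta>_def algebra_simps)
  also have "\<dots> = 0"
    using killed_orth_cnj_mult[OF fz fixed_monom[OF Suc.IH] \<zeta>] killed_orth_fixed[OF fixed_monom_image \<zeta>, of "Suc n"] int
    by (simp only: Bochner_Integration.integral_diff diff_0_right)
  finally have "(\<integral>z. norm (\<zeta> z) ^ 2 \<partial>circle_measure) = 0" by (simp only: of_real_eq_0_iff)
  then have "AE z in circle_measure. norm (\<zeta> z) ^ 2 = 0"
    using integral_nonneg_eq_0_iff_AE[OF i2] by simp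
  then show ?case by eventually_elim (simp add: \<zeta>_def)
qed

text \<open>As P q = q, the difference P f - f equals P (f - q) - (f - q) for every polynomial q,
  and contractivity makes both parts small.\<close>

lemma P_eq_id:
  assumes id: "\<And>n. AE z in circle_measure. monom_image n z = z ^ n" and f: "f \<in> Hp_circle p"
  shows "AE z in circle_measure. P f z = f z"
proof -
  have Lf: "f \<in> Lp_circle p" "P f \<in> Lp_circle p" using f P_Hp[OF f] by (auto intro: Hp_circle_Lp)
  have "AE z in circle_measure. P f z - f z = 0"
  proof (rule AE_eq_0_if_powr_integral)
    show "(\<lambda>z. P f z - f z) \<in> Lp_circle p" using p Lf by (intro Lp_circle_diff(1)) auto
    fix e :: real assume e: "e > 0"
    obtain q where q: "powr_integral p (\<lambda>z. f z - poly q z) < e / 2"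
      using f half_gt_zero[OF e] Hp_circle_iff[OF p(1)] by blast
    have qH: "poly q \<in> Hp_circle p" by (rule bounded_hardy_Hp_p[OF bounded_hardy_poly])
    have gH: "(\<lambda>z. f z - poly q z) \<in> Hp_circle p" using p f qH by (intro Hp_circle_diff) auto
    have gL: "(\<lambda>z. f z - poly q z) \<in> Lp_circle p" "P (\<lambda>z. f z - poly q z) \<in> Lp_circle p"
      using Hp_circle_Lp[OF gH] Hp_circle_Lp[OF P_Hp[OF gH]] by auto
    have "AE z in circle_measure. \<forall>i\<in>{..degree q}. monom_image i z = z ^ i"
      by (rule AE_finite_allI) (use id in auto)
    then have "AE z in circle_measure. poly_image q z = poly q z"
      by eventually_elim (simp add: poly_image_def poly_altdef)
    with P_poly[of q] P_diff[OF f qH]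
    have "AE z in circle_measure. P f z - f z = P (\<lambda>z. f z - poly q z) z - (f z - poly q z)"
      by eventually_elim simp
    then have "powr_integral p (\<lambda>z. P f z - f z) = powr_integral p (\<lambda>z. P (\<lambda>z. f z - poly q z) z - (f z - poly q z))"
      by (rule powr_integral_cong_AE) (use Lf gL in \<open>auto simp: Lp_circle_def\<close>)
    also have "\<dots> \<le> powr_integral p (P (\<lambda>z. f z - poly q z)) + powr_integral p (\<lambda>z. f z - poly q z)"
      using p gL by (intro Lp_circle_diff(2)) auto
    also have "\<dots> \<le> e" using P_contracts[OF gH] q by simp
    finally show "powr_integral p (\<lambda>z. P f z - f z) \<le> e" .
  qed
  then show ?thesis by eventually_elim simp
qed

text \<open>As P q = q(0), the difference P f - F(0) equals P (f - q) minus F(0) - q(0). The second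
  part is controlled by \<open>analytic_extension_value_le\<close> only in exponent p/2, so the
  smallness of the first in L^p is carried down to that exponent.\<close>

lemma P_eq_value_at_0:
  assumes 0: "\<And>n. n \<ge> 1 \<Longrightarrow> AE z in circle_measure. monom_image n z = 0"
    and f: "f \<in> Hp_circle p" and F: "analytic_extension p f F"
  shows "AE z in circle_measure. P f z = F 0"
proof -
  define s where "s = p / 2"
  have s: "0 < s" "s < p" "s \<le> 1" using p by (auto simp: s_def)
  have Lf: "f \<in> Lp_circle p" "P f \<in> Lp_circle p" using f P_Hp[OF f] by (auto intro: Hp_circle_Lp)
  have Pf0: "(\<lambda>z. P f z - F 0) \<in> Lp_circle p"
    by (rule Lp_circle_diff(1)[OF _ _ Lf(2) Lp_circle_ess_bounded]) (use p in auto)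
  have "AE z in circle_measure. P f z - F 0 = 0"
  proof (rule AE_eq_0_if_powr_integral[where s = s])
    show "(\<lambda>z. P f z - F 0) \<in> Lp_circle s" by (rule Lp_circle_antimono[OF s(1,2) Pf0])
    fix e :: real assume e: "e > 0"
    obtain d where d: "d > 0" "\<forall>g\<in>Lp_circle p. powr_integral p g < d \<longrightarrow> powr_integral s g < e / 2"
      using Lp_circle_small[OF s(1,2), of "e/2"] e by auto
    obtain q where q: "powr_integral p (\<lambda>z. f z - poly q z) < d"
      using f d(1) Hp_circle_iff[OF p(1)] by blast
    have qH: "poly q \<in> Hp_circle p" by (rule bounded_hardy_Hp_p[OF bounded_hardy_poly])
    have gH: "(\<lambda>z. f z - poly q z) \<in> Hp_circle p" using p f qH by (intro Hp_circle_diff) auto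
    have gL: "(\<lambda>z. f z - poly q z) \<in> Lp_circle p" "P (\<lambda>z. f z - poly q z) \<in> Lp_circle p"
      using Hp_circle_Lp[OF gH] Hp_circle_Lp[OF P_Hp[OF gH]] by auto
    have g1: "powr_integral s (\<lambda>z. f z - poly q z) < e / 2" using d(2) gL q by blast
    have g2: "powr_integral s (P (\<lambda>z. f z - poly q z)) < e / 2"
      using d(2) gL(2) P_contracts[OF gH] q by force
    have "AE z in circle_measure. \<forall>i\<in>{1..degree q}. monom_image i z = 0"
      by (rule AE_finite_allI) (use 0 in auto)
    moreover have "AE z in circle_measure. monom_image 0 z = 1"
      using P_one by (simp add: monom_image_def)
    ultimately have "AE z in circle_measure. poly_image q z = poly q 0"
    proof eventually_elim
      case (elim z)
      have "poly_image q z = (\<Sum>i\<in>{0}. coeff q i * monom_image i z)"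
        unfolding poly_image_def by (rule sum.mono_neutral_right) (use elim in auto)
      then show ?case using elim by (simp add: poly_0_coeff_0)
    qed
    with P_poly[of q] P_diff[OF f qH]
    have "AE z in circle_measure. P f z - F 0 = P (\<lambda>z. f z - poly q z) z - (F 0 - poly q 0)"
      by eventually_elim simp
    then have "powr_integral s (\<lambda>z. P f z - F 0) = powr_integral s (\<lambda>z. P (\<lambda>z. f z - poly q z) z - (F 0 - poly q 0))"
      by (rule powr_integral_cong_AE) (use Lf gL in \<open>auto simp: Lp_circle_def\<close>)
    also have "\<dots> \<le> powr_integral s (P (\<lambda>z. f z - poly q z)) + powr_integral s (\<lambda>z. F 0 - poly q 0)"
      by (rule Lp_circle_diff(2)[OF _ _ Lp_circle_antimono[OF s(1,2) gL(2)] Lp_circle_ess_bounded])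
         (use s in auto)
    also have "powr_integral s (\<lambda>z. F 0 - poly q 0) = norm (F 0 - poly q 0) powr s"
      by (simp add: powr_integral_def)
    also have "\<dots> \<le> powr_integral s (\<lambda>z. f z - poly q z)"
      using analytic_extension_value_le[OF p Lf(1) F, of q] by (simp add: s_def powr_integral_def)
    finally show "powr_integral s (\<lambda>z. P f z - F 0) \<le> e" using g1 g2 by simp
  qed
  then show ?thesis by eventually_elim simp
qed

end

theorem theorem1p3:
  fixes p :: real and P :: "(complex \<Rightarrow> complex) \<Rightarrow> complex \<Rightarrow> complex"
  assumes "0 < p" and "p < 1"
    and "contractive_projection p P"
    and "AE z in circle_measure. P (\<lambda>_. 1) z = 1"
    and "\<And>n::nat. n \<ge> 1 \<Longrightarrow> P (\<lambda>z. z ^ n) \<in> Hinf_circle"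
  shows "(\<forall>f\<in>Hp_circle p. \<forall>F. analytic_extension p f F \<longrightarrow>
            (AE z in circle_measure. P f z = F 0)) \<or>
         (\<forall>f\<in>Hp_circle p. AE z in circle_measure. P f z = f z)"
proof -
  interpret unital_contractive_projection p P
    using assms by unfold_locales
  show ?thesis
  proof (cases "\<forall>n\<ge>1. AE z in circle_measure. monom_image n z = 0")
    case True
    then show ?thesis using P_eq_value_at_0 by blast
  next
    case False
    then have "AE z in circle_measure. monom_image 1 z = z"
      using monom_image_one_eq by blast
    then show ?thesis using P_eq_id[OF monom_image_eq_monom] by blast
  qed
qed

end
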